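(* Let $p$ be a prime, $k$ an algebraically closed field of characteristic $p$, and $K=k((t))$. Let $n,m\ge 1$ be integers with $p\nmid m$, and let $L/K$ be a Galois extension whose group $G$ is a semi-direct product $P\rtimes\mathbb{Z}/m$ with $P\simeq\mathbb{Z}/p^n$. Let $L_0=L^P$. Then: (i) the lower jumps in the ramification filtration of the $P$-Galois extension $L/L_0$ are all congruent modulo $m$; (ii) the upper jumps in the ramification filtration of the $P$-Galois extension $L/L_0$ are all congruent modulo $m$.
   Context: The lower jumps (resp. upper jumps) of a totally ramified Galois extension of local fields are the positive breaks of its ramification filtration in the lower numbering (resp. upper numbering), as in Serre, "Local Fields", Ch. IV. The $\mathbb{Z}/p^n$-extension $L/L_0$ has $n$ lower jumps and $n$ upper jumps, all of which are integers. *)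

theory Defs
  imports
    "HOL-Analysis.Analysis"
    "HOL-Number_Theory.Cong"
    "HOL-Computational_Algebra.Formal_Laurent_Series"
    "HOL-Algebra.Elementary_Groups"
begin

section \<open>Galois extensions\<close>

text \<open>An extension \<open>L/K\<close> is given by types for \<open>K\<close> and \<open>L\<close> and an embedding \<open>\<iota>\<close> of \<open>K\<close> in \<open>L\<close>;
  intermediate fields are subsets of \<open>L\<close>.\<close>

definition field_embedding :: "('a::field \<Rightarrow> 'b::field) \<Rightarrow> bool" where
  "field_embedding h \<longleftrightarrow>
     h 1 = 1 \<and> (\<forall>x y. h (x + y) = h x + h y) \<and> (\<forall>x y. h (x * y) = h x * h y)"

definition gal_group :: "'l::field set \<Rightarrow> ('l \<Rightarrow> 'l) monoid" where
  "gal_group F =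
     \<lparr>carrier = {\<sigma>. field_embedding \<sigma> \<and> bij \<sigma> \<and> (\<forall>x\<in>F. \<sigma> x = x)},
      monoid.mult = (\<circ>), one = id\<rparr>"

definition fixed_field :: "('l \<Rightarrow> 'l) set \<Rightarrow> 'l::field set" where
  "fixed_field S = {x. \<forall>\<sigma>\<in>S. \<sigma> x = x}"

definition finite_extension :: "('a::field \<Rightarrow> 'l::field) \<Rightarrow> bool" where
  "finite_extension \<iota> \<longleftrightarrow>
     field_embedding \<iota> \<and> (\<exists>B. finite B \<and> module.span (\<lambda>c x. \<iota> c * x) B = UNIV)"

definition finite_galois :: "('a::field \<Rightarrow> 'l::field) \<Rightarrow> bool" where
  "finite_galois \<iota> \<longleftrightarrow>
     finite_extension \<iota> \<and> fixed_field (carrier (gal_group (range \<iota>))) = range \<iota>"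

definition inner_semidirect_product :: "('g, 'x) monoid_scheme \<Rightarrow> 'g set \<Rightarrow> 'g set \<Rightarrow> bool" where
  "inner_semidirect_product G N H \<longleftrightarrow>
     N \<lhd> G \<and> subgroup H G \<and> N \<inter> H = {\<one>\<^bsub>G\<^esub>} \<and> N <#>\<^bsub>G\<^esub> H = carrier G"


section \<open>Valuation rings\<close>

definition integral_over :: "'l::field set \<Rightarrow> 'l \<Rightarrow> bool" where
  "integral_over A x \<longleftrightarrow>
     (\<exists>q. lead_coeff q = 1 \<and> (\<forall>i. coeff q i \<in> A) \<and> poly q x = 0)"

text \<open>For a finite extension \<open>L\<close> of \<open>K = k((t))\<close>, the valuation ring of \<open>L\<close> is the integral closure
  of \<open>k[[t]]\<close> in \<open>L\<close>. By transitivity of integrality it is also the integral closure in \<open>L\<close> of the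
  valuation ring of any intermediate field.\<close>

definition val_ring :: "('k::field fls \<Rightarrow> 'l::field) \<Rightarrow> 'l set" where
  "val_ring \<iota> = {x. integral_over (\<iota> ` range fps_to_fls) x}"

text \<open>The set of non-units, which is the maximal ideal when \<open>A\<close> is local.\<close>

definition nonunits :: "'l::field set \<Rightarrow> 'l set" where
  "nonunits A = {x\<in>A. \<forall>y\<in>A. x * y \<noteq> 1}"

primrec ideal_power :: "'l::field set \<Rightarrow> 'l set \<Rightarrow> nat \<Rightarrow> 'l set" where
  "ideal_power A I 0 = A"
| "ideal_power A I (Suc j) =
     {(\<Sum>(x, y)\<leftarrow>zs. x * y) | zs. set zs \<subseteq> I \<times> ideal_power A I j}"


section \<open>Ramification filtration\<close>

text \<open>Throughout, \<open>F\<close> is a field between \<open>K = k((t))\<close> and \<open>L\<close>, and the filtration is that of the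
  Galois group of \<open>L/F\<close>. The \<open>i\<close>-th group in the lower numbering consists of the automorphisms
  acting trivially on the valuation ring modulo the \<open>(i+1)\<close>-st power of its maximal ideal
  (for \<open>i \<ge> -1\<close>).\<close>

definition lower_ram_group ::
    "('k::field fls \<Rightarrow> 'l::field) \<Rightarrow> 'l set \<Rightarrow> int \<Rightarrow> ('l \<Rightarrow> 'l) set" where
  "lower_ram_group \<iota> F i =
     {\<sigma> \<in> carrier (gal_group F). \<forall>x \<in> val_ring \<iota>.
        \<sigma> x - x \<in> ideal_power (val_ring \<iota>) (nonunits (val_ring \<iota>)) (nat (i + 1))}"

text \<open>Serre's function \<open>\<phi>(u) = \<integral>\<^sub>0\<^sup>u dw / (G\<^sub>0 : G\<^sub>w)\<close>, where \<open>G\<^sub>w\<close> means the group with index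
  \<open>\<lceil>w\<rceil>\<close>; it is the identity on \<open>[-1, 0]\<close>. Extended by the identity to all negative
  reals it is an increasing bijection of the real line.\<close>

definition herbrand :: "('k::field fls \<Rightarrow> 'l::field) \<Rightarrow> 'l set \<Rightarrow> real \<Rightarrow> real" where
  "herbrand \<iota> F u =
     (if u < 0 then u
      else integral {0..u}
        (\<lambda>w. real (card (lower_ram_group \<iota> F \<lceil>w\<rceil>)) / real (card (lower_ram_group \<iota> F 0))))"

definition upper_ram_group ::
    "('k::field fls \<Rightarrow> 'l::field) \<Rightarrow> 'l set \<Rightarrow> real \<Rightarrow> ('l \<Rightarrow> 'l) set" where
  "upper_ram_group \<iota> F v = lower_ram_group \<iota> F \<lceil>inv_into UNIV (herbrand \<iota> F) v\<rceil>"

definition lower_jumps :: "('k::field fls \<Rightarrow> 'l::field) \<Rightarrow> 'l set \<Rightarrow> int set" where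
  "lower_jumps \<iota> F =
     {i. i > 0 \<and> lower_ram_group \<iota> F i \<noteq> lower_ram_group \<iota> F (i + 1)}"

definition upper_jumps :: "('k::field fls \<Rightarrow> 'l::field) \<Rightarrow> 'l set \<Rightarrow> real set" where
  "upper_jumps \<iota> F =
     {v. v > 0 \<and> (\<forall>\<epsilon>>0. upper_ram_group \<iota> F v \<noteq> upper_ram_group \<iota> F (v + \<epsilon>))}"

end

theory Submission
  imports Defs "Jordan_Normal_Form.Char_Poly"
begin

text \<open>Let \<open>s\<close> and \<open>\<gamma>\<close> generate \<open>P\<close> and the complement \<open>C\<close>, let \<open>\<pi>\<close> be a uniformizer of \<open>L\<close>, and
  write \<open>\<gamma> s \<gamma>\<^sup>-\<^sup>1 = s\<^sup>a\<close> and \<open>\<gamma> \<pi> \<equiv> \<zeta> \<pi>\<close> modulo \<open>\<pi>\<^sup>2\<close>, where \<open>\<zeta>\<close> is a primitive \<open>m\<close>-th root of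
  unity. If \<open>\<sigma> \<pi> \<equiv> \<pi> + c \<pi>\<^sup>i\<^sup>+\<^sup>1\<close> modulo \<open>\<pi>\<^sup>i\<^sup>+\<^sup>2\<close> with \<open>\<sigma>\<close> in \<open>P\<close> and \<open>c \<noteq> 0\<close>, the corresponding coefficient
  of \<open>\<gamma> \<sigma> \<gamma>\<^sup>-\<^sup>1 = \<sigma>\<^sup>a\<close> is both \<open>\<zeta>\<^sup>i c\<close> and \<open>a c\<close>. So \<open>\<zeta>\<^sup>i = a\<close> for every lower jump \<open>i\<close>, and the
  lower jumps are congruent modulo \<open>m\<close>. Two consecutive upper jumps differ by \<open>1 / p\<^sup>q\<close> times the
  difference of the lower jumps, which is divisible by \<open>p\<^sup>q\<close> by Sen's theorem; as \<open>p\<close> does not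
  divide \<open>m\<close>, the quotient is still divisible by \<open>m\<close>.

  That the integral closure \<open>A\<close> of \<open>k[[t]]\<close> in \<open>L\<close> is a discrete valuation ring with residue field \<open>k\<close>
  follows from the completeness of \<open>k[[t]]\<close>: idempotents lift modulo \<open>t\<close>, so the integrally closed
  ring \<open>A\<close> is local. Every element of \<open>L\<close> is a root of a polynomial over \<open>k[[t]]\<close> with a unit
  coefficient, so \<open>A\<close> is a valuation ring, namely that of the valuation of the norm to
  \<open>k((t))\<close>.\<close>

section \<open>Field embeddings\<close>

text \<open>The filtration is defined by an integral closure and its set of non-units, so at the
  outset there is no valuation, and the non-units are not known to form an ideal. The ramification
  theory is therefore developed in an abstract discretely valued field, of which L is later shown to
  be an instance. There separatedness does the work of completeness: an element of every power of
  the maximal ideal is 0.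

  Since k embeds in L, represents all residues and is fixed by the Galois group, leading
  coefficients are elements of k, and conjugation changes them only by a power of \<zeta>.

  The obstacle in (ii) is integrality: congruent lower jumps say nothing about quotients by powers
  of p until these are known to be integers. Sen's theorem is proved by comparing valuations for the
  powers of one wild automorphism.

  Idempotents are lifted in the subring generated by a single element, a finite module thanks to its
  characteristic polynomial, so finiteness of A over k[[t]] is not called upon. The ultrametric
  inequality for the norm valuation is then deduced from A being a valuation ring.\<close>

lemma
  assumes "field_embedding h"
  shows emb_add: "h (x + y) = h x + h y"
    and emb_mult: "h (x * y) = h x * h y"
    and emb_1: "h 1 = 1"
    and emb_0: "h 0 = 0"
    and emb_uminus: "h (- x) = - h x"
    and emb_diff: "h (x - y) = h x - h y"
proof -
  show add: "h (x + y) = h x + h y" for x y using assms by (auto simp: field_embedding_def)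
  show "h (x * y) = h x * h y" "h 1 = 1" using assms by (auto simp: field_embedding_def)
  show z: "h 0 = 0" using add[of 0 0] by (metis add_cancel_right_left add_0)
  show um: "h (- x) = - h x" for x using add[of x "- x"] z by (simp add: eq_neg_iff_add_eq_0 add.commute)
  show "h (x - y) = h x - h y" using add[of x "- y"] um by simp
qed

lemma emb_sum: "field_embedding h \<Longrightarrow> h (sum f A) = (\<Sum>x\<in>A. h (f x))"
  by (induction A rule: infinite_finite_induct) (auto simp: emb_0 emb_add)

lemma emb_prod: "field_embedding h \<Longrightarrow> h (prod f A) = (\<Prod>x\<in>A. h (f x))"
  by (induction A rule: infinite_finite_induct) (auto simp: emb_1 emb_mult)

lemma emb_power: "field_embedding h \<Longrightarrow> h (x ^ n) = h x ^ n"
  by (induction n) (auto simp: emb_1 emb_mult)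

lemma emb_of_nat: "field_embedding h \<Longrightarrow> h (of_nat n) = of_nat n"
  by (induction n) (auto simp: emb_1 emb_0 emb_add)

lemma emb_eq_0_iff: "field_embedding h \<Longrightarrow> h x = 0 \<longleftrightarrow> x = 0"
  by (metis emb_0 emb_1 emb_mult mult_zero_left right_inverse zero_neq_one)

lemma emb_eq_iff: "field_embedding h \<Longrightarrow> h x = h y \<longleftrightarrow> x = y"
  using emb_eq_0_iff[of h "x - y"] by (simp add: emb_diff)

lemma emb_inverse: "field_embedding h \<Longrightarrow> h (inverse x) = inverse (h x)"
proof (cases "x = 0")
  case False
  assume h: "field_embedding h"
  have "h x * h (inverse x) = 1" using False by (simp add: emb_1[OF h] flip: emb_mult[OF h])
  thus ?thesis by (rule inverse_unique[symmetric])
qed (simp add: emb_0)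

lemma emb_divide: "field_embedding h \<Longrightarrow> h (x / y) = h x / h y"
  by (simp add: divide_inverse emb_mult emb_inverse)

lemma emb_comp: "field_embedding g \<Longrightarrow> field_embedding h \<Longrightarrow> field_embedding (g \<circ> h)"
  by (simp add: field_embedding_def)

section \<open>Discrete valuations\<close>

text \<open>\<open>w\<close> is unspecified at 0, so its laws exclude 0. The constants
  \<open>kk c\<close> form a field of representatives of the residue classes and serve as
  coefficients of expansions.\<close>

locale discretely_valued_field =
  fixes w :: "'l::field \<Rightarrow> int" and kk :: "'k::field \<Rightarrow> 'l" and \<pi> :: 'l
  assumes w_mult: "x \<noteq> 0 \<Longrightarrow> y \<noteq> 0 \<Longrightarrow> w (x * y) = w x + w y"
    and w_add: "x \<noteq> 0 \<Longrightarrow> y \<noteq> 0 \<Longrightarrow> x + y \<noteq> 0 \<Longrightarrow> min (w x) (w y) \<le> w (x + y)"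
    and emb_kk: "field_embedding kk"
    and w_kk: "c \<noteq> 0 \<Longrightarrow> w (kk c) = 0"
    and pi_nz: "\<pi> \<noteq> 0" and w_pi: "w \<pi> = 1"
    and residue: "x \<noteq> 0 \<Longrightarrow> 0 \<le> w x \<Longrightarrow> \<exists>c. x = kk c \<or> 0 < w (x - kk c)"
begin

text \<open>The fractional ideal generated by the j-th power of \<open>\<pi>\<close>. Admitting 0
  separately gives it infinite valuation, which \<open>w\<close> cannot express.\<close>

definition fil :: "int \<Rightarrow> 'l set" where
  "fil j = {x. x = 0 \<or> j \<le> w x}"

lemma w_1: "w 1 = 0"
  using w_mult[of 1 1] by simp

lemma w_uminus: "w (- x) = w x"
proof (cases "x = 0")
  case False
  have "w (-1) + w (-1) = 0" using w_mult[of "-1" "-1"] w_1 by simp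
  with w_mult[of "-1" x] False show ?thesis by simp
qed simp

lemma w_power: "x \<noteq> 0 \<Longrightarrow> w (x ^ n) = int n * w x"
  by (induction n) (auto simp: w_1 w_mult algebra_simps)

lemma w_inverse: "x \<noteq> 0 \<Longrightarrow> w (inverse x) = - w x"
  using w_mult[of x "inverse x"] w_1 by simp

lemma w_divide: "x \<noteq> 0 \<Longrightarrow> y \<noteq> 0 \<Longrightarrow> w (x / y) = w x - w y"
  by (simp add: divide_inverse w_mult w_inverse)

lemma w_prod: "finite A \<Longrightarrow> (\<And>x. x \<in> A \<Longrightarrow> f x \<noteq> 0) \<Longrightarrow> w (prod f A) = (\<Sum>x\<in>A. w (f x))"
  by (induction A rule: finite_induct) (auto simp: w_1 w_mult)

lemma fil_0 [simp]: "0 \<in> fil j"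
  by (simp add: fil_def)

lemma fil_add: "x \<in> fil j \<Longrightarrow> y \<in> fil j \<Longrightarrow> x + y \<in> fil j"
  using w_add[of x y] by (cases "x = 0 \<or> y = 0 \<or> x + y = 0") (auto simp: fil_def)

lemma fil_uminus: "- x \<in> fil j \<longleftrightarrow> x \<in> fil j"
  by (simp add: fil_def w_uminus)

lemma fil_diff: "x \<in> fil j \<Longrightarrow> y \<in> fil j \<Longrightarrow> x - y \<in> fil j"
  using fil_add[of x j "- y"] by (simp add: fil_uminus)

lemma fil_trans: "x - y \<in> fil j \<Longrightarrow> y - z \<in> fil j \<Longrightarrow> x - z \<in> fil j"
  using fil_add[of "x - y" j "y - z"] by simp

lemma fil_cong: "x - y \<in> fil j \<Longrightarrow> x \<in> fil j \<longleftrightarrow> y \<in> fil j"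
  using fil_add[of "x - y" j y] fil_diff[of x j "x - y"] by auto

lemma fil_sum: "(\<And>x. x \<in> A \<Longrightarrow> f x \<in> fil j) \<Longrightarrow> sum f A \<in> fil j"
  by (induction A rule: infinite_finite_induct) (auto simp: fil_add)

lemma fil_mult: "x \<in> fil i \<Longrightarrow> y \<in> fil j \<Longrightarrow> x * y \<in> fil (i + j)"
  by (cases "x = 0 \<or> y = 0") (auto simp: fil_def w_mult)

lemma fil_mono: "x \<in> fil i \<Longrightarrow> j \<le> i \<Longrightarrow> x \<in> fil j"
  by (auto simp: fil_def)

lemma fil_kk: "kk c \<in> fil 0"
  using w_kk[of c] by (cases "c = 0") (auto simp: fil_def emb_0[OF emb_kk])

lemma fil_kk_mult: "x \<in> fil j \<Longrightarrow> kk c * x \<in> fil j"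
  using fil_mult[OF fil_kk] by fastforce

lemma fil_self: "x \<in> fil (w x)"
  by (simp add: fil_def)

lemma fil_power: "x \<in> fil i \<Longrightarrow> x ^ n \<in> fil (int n * i)"
proof (induction n)
  case (Suc n)
  thus ?case using fil_mult[of x i "x ^ n" "int n * i"] by (simp add: algebra_simps)
qed (simp add: fil_def w_1)

lemma fil_pi_power: "\<pi> ^ n \<in> fil (int n)"
  using fil_self[of "\<pi> ^ n"] by (simp add: w_power pi_nz w_pi)

lemma fil_all_imp_0:
  assumes "\<And>n. x \<in> fil (int n)"
  shows "x = 0"
  using assms[of "nat (w x + 1)"] by (auto simp: fil_def split: if_splits)

lemma w_eqI: "x \<in> fil j \<Longrightarrow> x \<notin> fil (j + 1) \<Longrightarrow> w x = j"
  by (auto simp: fil_def)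

lemma w_cong: "x \<noteq> 0 \<Longrightarrow> x - y \<in> fil (w x + 1) \<Longrightarrow> y \<noteq> 0 \<and> w y = w x"
proof -
  assume x: "x \<noteq> 0" "x - y \<in> fil (w x + 1)"
  have "x \<notin> fil (w x + 1)" using x by (simp add: fil_def)
  hence y: "y \<notin> fil (w x + 1)" using fil_cong[OF x(2)] by simp
  have "x - y \<in> fil (w x)" using fil_mono[OF x(2)] by simp
  hence "y \<in> fil (w x)" using fil_cong fil_self by blast
  with y show ?thesis using w_eqI fil_0 by metis
qed

lemma fil_divide_iff:
  assumes "y \<noteq> 0"
  shows "x \<in> fil (w y + j) \<longleftrightarrow> x / y \<in> fil j"
  using assms by (cases "x = 0") (auto simp: fil_def w_divide)

lemma leading_coeff_exists:
  assumes "x \<in> fil (w y)" "y \<noteq> 0"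
  shows "\<exists>c. x - kk c * y \<in> fil (w y + 1)"
proof (cases "x = 0")
  case True
  thus ?thesis by (intro exI[of _ 0]) (simp add: emb_0[OF emb_kk])
next
  case False
  have "0 \<le> w (x / y)" using assms False by (auto simp: fil_def w_divide)
  then obtain c where "x / y = kk c \<or> 0 < w (x / y - kk c)"
    using residue[of "x / y"] False assms by auto
  hence "x / y - kk c \<in> fil 1" by (auto simp: fil_def)
  moreover have "(x - kk c * y) / y = x / y - kk c" using assms by (simp add: field_simps)
  ultimately show ?thesis using fil_divide_iff[OF assms(2), of "x - kk c * y" 1] by auto
qed

lemma kk_mult_in_fil_iff:
  assumes "y \<noteq> 0"
  shows "kk c * y \<in> fil (w y + 1) \<longleftrightarrow> c = 0"
proof (cases "c = 0")
  case False
  hence "kk c \<noteq> 0" by (simp add: emb_eq_0_iff[OF emb_kk])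
  thus ?thesis using False assms by (auto simp: fil_def w_mult w_kk)
qed (auto simp: emb_0[OF emb_kk])

lemma w_sum_distinct:
  assumes "finite A" "A \<noteq> {}" "\<And>x. x \<in> A \<Longrightarrow> f x \<noteq> 0" "inj_on (\<lambda>x. w (f x)) A"
  shows "sum f A \<noteq> 0 \<and> w (sum f A) \<in> (\<lambda>x. w (f x)) ` A"
  using assms
proof (induction A rule: finite_ne_induct)
  case (singleton x)
  then show ?case by simp
next
  case (insert a A)
  let ?s = "sum f A"
  have s: "?s \<noteq> 0" "w ?s \<in> (\<lambda>x. w (f x)) ` A" using insert by auto
  have a: "f a \<noteq> 0" and ne: "w (f a) \<noteq> w ?s"
    using insert.prems s insert.hyps by (auto simp: inj_on_def)
  have eq: "sum f (insert a A) = f a + ?s" using insert by simp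
  show ?case
  proof (cases "w (f a) < w ?s")
    case True
    have "f a - (f a + ?s) \<in> fil (w (f a) + 1)" using True by (simp add: fil_def w_uminus)
    from w_cong[OF a this] show ?thesis using eq by auto
  next
    case False
    have "?s - (f a + ?s) \<in> fil (w ?s + 1)" using False ne by (simp add: fil_def w_uminus)
    from w_cong[OF s(1) this] show ?thesis using eq s by auto
  qed
qed

section \<open>Automorphisms of a discretely valued field\<close>

definition valued_auts :: "('l \<Rightarrow> 'l) set" where
  "valued_auts = {\<sigma>. field_embedding \<sigma> \<and> (\<forall>x. w (\<sigma> x) = w x) \<and> (\<forall>c. \<sigma> (kk c) = kk c)}"

lemma
  assumes "\<sigma> \<in> valued_auts"
  shows aut_emb: "field_embedding \<sigma>" and aut_w: "w (\<sigma> x) = w x" and aut_kk: "\<sigma> (kk c) = kk c"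
  using assms by (auto simp: valued_auts_def)

lemma aut_id: "id \<in> valued_auts"
  by (simp add: valued_auts_def field_embedding_def)

lemma aut_comp: "\<sigma> \<in> valued_auts \<Longrightarrow> \<tau> \<in> valued_auts \<Longrightarrow> \<sigma> \<circ> \<tau> \<in> valued_auts"
  by (simp add: valued_auts_def emb_comp)

lemma aut_funpow: "\<sigma> \<in> valued_auts \<Longrightarrow> \<sigma> ^^ n \<in> valued_auts"
  by (induction n) (simp_all add: aut_id aut_comp)

lemma aut_nz: "\<sigma> \<in> valued_auts \<Longrightarrow> \<sigma> x = 0 \<longleftrightarrow> x = 0"
  using aut_emb emb_eq_0_iff by blast

lemma aut_fil: "\<sigma> \<in> valued_auts \<Longrightarrow> \<sigma> x \<in> fil j \<longleftrightarrow> x \<in> fil j"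
  by (simp add: fil_def aut_w aut_nz)

lemma aut_fil_diff:
  assumes "\<sigma> \<in> valued_auts" "x - y \<in> fil j"
  shows "\<sigma> x - \<sigma> y \<in> fil j"
  using aut_fil[OF assms(1), of "x - y"] assms(2) by (simp add: emb_diff[OF aut_emb[OF assms(1)]])

text \<open>An integral x is c + \<open>\<pi> * y\<close> with a constant c fixed by
  \<open>\<sigma>\<close> and y integral, so each induction step gains a factor
  \<open>\<pi>\<close>. Capping the bound at n replaces an infinite expansion of x.\<close>

lemma aut_displacement_le:
  assumes "\<sigma> \<in> valued_auts" "\<sigma> \<pi> - \<pi> \<in> fil (int i + 1)" "x \<in> fil 0"
  shows "\<sigma> x - x \<in> fil (min (int i + 1) (int n))"
  using assms(3)
proof (induction n arbitrary: x)
  case 0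
  thus ?case using fil_diff[of "\<sigma> x" 0 x] aut_fil[OF assms(1)] by simp
next
  case (Suc n)
  obtain c where "x - kk c * 1 \<in> fil (w 1 + 1)" using leading_coeff_exists[of x 1] Suc.prems by (auto simp: w_1)
  hence c: "x - kk c \<in> fil 1" by (simp add: w_1)
  define y where "y = (x - kk c) / \<pi>"
  have y: "y \<in> fil 0" using c fil_divide_iff[of \<pi> "x - kk c" 0] pi_nz unfolding y_def w_pi by simp
  have x: "x = kk c + \<pi> * y" using pi_nz by (simp add: y_def)
  note e = aut_emb[OF assms(1)]
  have "\<sigma> x - x = (\<sigma> \<pi> - \<pi>) * \<sigma> y + \<pi> * (\<sigma> y - y)"
    unfolding x by (simp add: emb_add[OF e] emb_mult[OF e] aut_kk[OF assms(1)] algebra_simps)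
  moreover have "(\<sigma> \<pi> - \<pi>) * \<sigma> y \<in> fil (int i + 1)"
    using fil_mult[OF assms(2), of "\<sigma> y" 0] y by (simp add: aut_fil[OF assms(1)])
  moreover have "\<pi> * (\<sigma> y - y) \<in> fil (1 + min (int i + 1) (int n))"
    using fil_mult[OF fil_self[of \<pi>] Suc.IH[OF y]] by (simp add: w_pi)
  ultimately show ?case by (auto intro!: fil_add elim!: fil_mono)
qed

text \<open>The displacement of an integral element lies in every \<open>fil\<close>, hence
  vanishes; all other elements are inverses of integral ones.\<close>

lemma aut_eq_id:
  assumes "\<sigma> \<in> valued_auts" "\<sigma> \<pi> = \<pi>"
  shows "\<sigma> = id"
proof -
  have *: "\<sigma> x = x" if "x \<in> fil 0" for x
  proof -
    have "\<sigma> x - x \<in> fil (int n)" for n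
      using aut_displacement_le[OF assms(1) _ that, of n n] assms(2) fil_mono by force
    thus ?thesis using fil_all_imp_0[of "\<sigma> x - x"] by simp
  qed
  have "\<sigma> x = x" for x
  proof (cases "x \<in> fil 0")
    case False
    hence "inverse x \<in> fil 0" by (auto simp: fil_def w_inverse)
    from *[OF this] show ?thesis by (simp add: emb_inverse[OF aut_emb[OF assms(1)]])
  qed (use * in auto)
  thus ?thesis by auto
qed

lemma aut_displacement:
  assumes "\<sigma> \<in> valued_auts" "\<sigma> \<pi> - \<pi> \<in> fil (int i + 1)" "x \<in> fil 0"
  shows "\<sigma> x - x \<in> fil (int i + 1)"
  using aut_displacement_le[OF assms, of "Suc i"] by simp

text \<open>In contrast to units, which move in order i + 1, the power \<open>\<pi> ^ j\<close>
  gains only i, since its relative displacement is that of \<open>\<pi>\<close>.\<close>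

lemma aut_displacement_power:
  assumes "\<sigma> \<in> valued_auts" "\<sigma> \<pi> - \<pi> \<in> fil (int i + 1)" "x \<in> fil (int j)"
  shows "\<sigma> x - x \<in> fil (int i + int j)"
  using assms(3)
proof (induction j arbitrary: x)
  case 0
  thus ?case using aut_displacement[OF assms(1,2), of x] fil_mono by force
next
  case (Suc j)
  define y where "y = x / \<pi>"
  have y: "y \<in> fil (int j)" using Suc.prems fil_divide_iff[of \<pi> x "int j"] pi_nz unfolding y_def w_pi by simp
  have x: "x = \<pi> * y" using pi_nz by (simp add: y_def)
  note e = aut_emb[OF assms(1)]
  have "\<sigma> x - x = (\<sigma> \<pi> - \<pi>) * \<sigma> y + \<pi> * (\<sigma> y - y)"
    unfolding x by (simp add: emb_mult[OF e] algebra_simps)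
  moreover have "(\<sigma> \<pi> - \<pi>) * \<sigma> y \<in> fil (int i + 1 + int j)"
    using fil_mult[OF assms(2), of "\<sigma> y" "int j"] y by (simp add: aut_fil[OF assms(1)])
  moreover have "\<pi> * (\<sigma> y - y) \<in> fil (1 + (int i + int j))"
    using fil_mult[OF fil_self[of \<pi>] Suc.IH[OF y]] by (simp add: w_pi)
  ultimately have "\<sigma> x - x \<in> fil (1 + (int i + int j))" using fil_add by (metis add.assoc add.commute)
  thus ?case by (simp add: add_ac)
qed

section \<open>Leading coefficients of automorphisms and the tame character\<close>

text \<open>For \<open>\<sigma>\<close> in the \<open>i\<close>-th ramification group, \<open>c\<close> is the value at \<open>\<sigma>\<close> of the
  homomorphism \<open>\<theta>\<^sub>i\<close> of Serre, Local Fields, IV.2.\<close>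

definition lead :: "nat \<Rightarrow> ('l \<Rightarrow> 'l) \<Rightarrow> 'k \<Rightarrow> bool" where
  "lead i \<sigma> c \<longleftrightarrow> \<sigma> \<in> valued_auts \<and> \<sigma> \<pi> - \<pi> - kk c * \<pi> ^ (i + 1) \<in> fil (int i + 2)"

lemma lead_imp_fil:
  assumes "lead i \<sigma> c"
  shows "\<sigma> \<pi> - \<pi> \<in> fil (int i + 1)"
proof -
  have "\<sigma> \<pi> - \<pi> - kk c * \<pi> ^ (i + 1) \<in> fil (int i + 1)"
    using assms fil_mono unfolding lead_def by force
  moreover have "kk c * \<pi> ^ (i + 1) \<in> fil (int i + 1)"
    using fil_kk_mult[OF fil_pi_power[of "i + 1"]] by (simp add: algebra_simps)
  ultimately show ?thesis using fil_cong by blast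
qed

lemma lead_exists:
  assumes "\<sigma> \<in> valued_auts" "\<sigma> \<pi> - \<pi> \<in> fil (int i + 1)"
  shows "\<exists>c. lead i \<sigma> c"
  using leading_coeff_exists[of "\<sigma> \<pi> - \<pi>" "\<pi> ^ (i + 1)"] assms
  unfolding lead_def by (simp add: w_power pi_nz w_pi w_mult algebra_simps)

lemma lead_eq_0_iff:
  assumes "lead i \<sigma> c"
  shows "\<sigma> \<pi> - \<pi> \<in> fil (int i + 2) \<longleftrightarrow> c = 0"
proof -
  have "\<sigma> \<pi> - \<pi> \<in> fil (int i + 2) \<longleftrightarrow> kk c * \<pi> ^ (i + 1) \<in> fil (int i + 2)"
    using assms fil_cong unfolding lead_def by blast
  also have "\<dots> \<longleftrightarrow> c = 0"
    using kk_mult_in_fil_iff[of "\<pi> ^ (i + 1)" c] pi_nz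
    by (simp add: w_power w_pi w_mult algebra_simps)
  finally show ?thesis .
qed

lemma lead_unique:
  assumes "lead i \<sigma> c" "lead i \<sigma> d"
  shows "c = d"
proof -
  have "kk (c - d) * \<pi> ^ (i + 1) \<in> fil (int i + 2)"
    using fil_diff[of "\<sigma> \<pi> - \<pi> - kk d * \<pi> ^ (i + 1)" "int i + 2" "\<sigma> \<pi> - \<pi> - kk c * \<pi> ^ (i + 1)"] assms
    unfolding lead_def by (simp add: emb_diff[OF emb_kk] algebra_simps)
  thus ?thesis using kk_mult_in_fil_iff[of "\<pi> ^ (i + 1)" "c - d"] pi_nz
    by (simp add: w_power w_pi w_mult algebra_simps)
qed

lemma lead_id: "lead i id 0"
  by (simp add: lead_def aut_id emb_0[OF emb_kk])

text \<open>The displacement of \<open>\<sigma> \<circ> \<tau>\<close> is \<sigma>(\<tau> \<pi> -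
  \<pi>) plus that of \<open>\<sigma>\<close>. Applying \<open>\<sigma>\<close> to the leading term
  of \<open>\<tau>\<close> changes it only in order 2 i + 1, which is negligible as i is at least
  1.\<close>

lemma lead_comp:
  assumes "lead i \<sigma> c" "lead i \<tau> d" "1 \<le> i"
  shows "lead i (\<sigma> \<circ> \<tau>) (c + d)"
proof -
  have s: "\<sigma> \<in> valued_auts" and t: "\<tau> \<in> valued_auts" using assms by (auto simp: lead_def)
  note e = aut_emb[OF s]
  let ?P = "\<pi> ^ (i + 1)"
  have 1: "\<sigma> (\<tau> \<pi> - \<pi>) - kk d * \<sigma> ?P \<in> fil (int i + 2)"
    using aut_fil_diff[OF s, of "\<tau> \<pi> - \<pi>" "kk d * ?P"] assms(2)
    unfolding lead_def by (simp add: emb_mult[OF e] aut_kk[OF s])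
  have "\<sigma> ?P - ?P \<in> fil (int i + int (i + 1))"
    using aut_displacement_power[OF s lead_imp_fil[OF assms(1)] fil_pi_power] .
  hence 2: "kk d * \<sigma> ?P - kk d * ?P \<in> fil (int i + 2)"
    using fil_kk_mult[of "\<sigma> ?P - ?P" _ d] assms(3) fil_mono
    by (force simp: right_diff_distrib)
  have 3: "\<sigma> \<pi> - \<pi> - kk c * ?P \<in> fil (int i + 2)" using assms by (auto simp: lead_def)
  have "(\<sigma> \<circ> \<tau>) \<pi> - \<pi> - kk (c + d) * ?P
    = (\<sigma> (\<tau> \<pi> - \<pi>) - kk d * \<sigma> ?P) + (kk d * \<sigma> ?P - kk d * ?P) + (\<sigma> \<pi> - \<pi> - kk c * ?P)"
    by (simp add: emb_diff[OF e] emb_add[OF emb_kk] algebra_simps)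
  with 1 2 3 show ?thesis unfolding lead_def using aut_comp[OF s t] fil_add by presburger
qed

lemma lead_funpow:
  assumes "lead i \<sigma> c" "1 \<le> i"
  shows "lead i (\<sigma> ^^ n) (of_nat n * c)"
proof (induction n)
  case 0
  show ?case using lead_id[of i] by (simp add: id_def)
next
  case (Suc n)
  show ?case using lead_comp[OF assms(1) Suc assms(2)] by (simp add: algebra_simps o_def)
qed

lemma tame_pi_power:
  assumes "\<gamma> \<in> valued_auts" and tame: "\<gamma> \<pi> - kk \<zeta> * \<pi> \<in> fil 2"
  shows "\<gamma> \<pi> ^ n - (kk \<zeta> * \<pi>) ^ n \<in> fil (int n + 1)"
proof (induction n)
  case (Suc n)
  have "\<gamma> \<pi> ^ Suc n - (kk \<zeta> * \<pi>) ^ Suc n =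
    \<gamma> \<pi> * (\<gamma> \<pi> ^ n - (kk \<zeta> * \<pi>) ^ n) + (kk \<zeta> * \<pi>) ^ n * (\<gamma> \<pi> - kk \<zeta> * \<pi>)"
    by (simp add: algebra_simps)
  moreover have "\<gamma> \<pi> * (\<gamma> \<pi> ^ n - (kk \<zeta> * \<pi>) ^ n) \<in> fil (1 + (int n + 1))"
    using fil_mult[OF fil_self[of "\<gamma> \<pi>"] Suc] by (simp add: aut_w[OF assms(1)] w_pi)
  moreover have "kk \<zeta> * \<pi> \<in> fil 1" using fil_kk_mult[OF fil_self[of \<pi>]] by (simp add: w_pi)
  from fil_mult[OF fil_power[OF this, of n] tame]
  have "(kk \<zeta> * \<pi>) ^ n * (\<gamma> \<pi> - kk \<zeta> * \<pi>) \<in> fil (1 + (int n + 1))" by (simp add: algebra_simps)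
  ultimately have "\<gamma> \<pi> ^ Suc n - (kk \<zeta> * \<pi>) ^ Suc n \<in> fil (1 + (int n + 1))"
    using fil_add by metis
  thus ?case by (simp add: add_ac)
qed simp

text \<open>The leading coefficient of the ratio (\<sigma> x - x) / x is the same for every
  uniformizer x. It is read off at \<open>x = \<gamma>' \<pi>\<close>; applying
  \<open>\<gamma>\<close> turns x into \<open>\<pi>\<close> and \<open>\<pi> ^ i\<close> into
  \<open>\<zeta> ^ i * \<pi> ^ i\<close> up to higher order, whence the exponent i and not i +
  1.\<close>

lemma lead_conj:
  assumes "lead i \<sigma> c" "1 \<le> i" "\<gamma> \<in> valued_auts" "\<gamma>' \<in> valued_auts" "\<gamma> \<circ> \<gamma>' = id"
    and tame: "\<gamma> \<pi> - kk \<zeta> * \<pi> \<in> fil 2"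
  shows "lead i (\<gamma> \<circ> \<sigma> \<circ> \<gamma>') (\<zeta> ^ i * c)"
proof -
  have s: "\<sigma> \<in> valued_auts" using assms by (auto simp: lead_def)
  note e = aut_emb[OF s]
  note g = aut_emb[OF assms(3)]
  define x where "x = \<gamma>' \<pi>"
  define u where "u = x / \<pi>"
  have wx: "w x = 1" by (simp add: x_def aut_w[OF assms(4)] w_pi)
  have gx: "\<gamma> x = \<pi>" using assms(5) by (auto simp: x_def fun_eq_iff)
  have xnz: "x \<noteq> 0" using pi_nz by (simp add: x_def aut_nz[OF assms(4)])
  have x: "x = u * \<pi>" using pi_nz by (simp add: u_def)
  have u: "u \<in> fil 0" using fil_divide_iff[OF pi_nz, of x 0] fil_self[of x] unfolding u_def w_pi wx by simp
  have 1: "(\<sigma> u - u) * \<sigma> \<pi> \<in> fil (int i + 2)"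
    using fil_mult[OF aut_displacement[OF s lead_imp_fil[OF assms(1)] u] fil_self[of "\<sigma> \<pi>"]]
    by (simp add: aut_w[OF s] w_pi add_ac)
  have 2: "u * (\<sigma> \<pi> - \<pi> - kk c * \<pi> ^ (i + 1)) \<in> fil (int i + 2)"
    using fil_mult[OF u, of _ "int i + 2"] assms(1) unfolding lead_def by simp
  have "\<sigma> x - x - kk c * (x * \<pi> ^ i) = (\<sigma> u - u) * \<sigma> \<pi> + u * (\<sigma> \<pi> - \<pi> - kk c * \<pi> ^ (i + 1))"
    unfolding x by (simp add: emb_mult[OF e] algebra_simps)
  hence "\<sigma> x - x - kk c * (x * \<pi> ^ i) \<in> fil (int i + 2)" using fil_add[OF 1 2] by simp
  hence 3: "\<gamma> (\<sigma> x - x - kk c * (x * \<pi> ^ i)) \<in> fil (int i + 2)" by (simp add: aut_fil[OF assms(3)])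
  have 4: "\<gamma> \<pi> ^ i - (kk \<zeta> * \<pi>) ^ i \<in> fil (int i + 1)"
    using tame_pi_power[OF assms(3) tame] .
  have "kk c * (\<pi> * (\<gamma> \<pi> ^ i - (kk \<zeta> * \<pi>) ^ i)) \<in> fil (int i + 2)"
    using fil_kk_mult[OF fil_mult[OF fil_self[of \<pi>] 4]] by (simp add: w_pi algebra_simps)
  from fil_add[OF 3 this]
  have "\<gamma> (\<sigma> x) - \<pi> - kk (\<zeta> ^ i * c) * \<pi> ^ (i + 1) \<in> fil (int i + 2)"
    by (simp add: emb_diff[OF g] emb_add[OF g] emb_mult[OF g] emb_power[OF g] gx aut_kk[OF assms(3)]
      emb_mult[OF emb_kk] emb_power[OF emb_kk] algebra_simps)
  thus ?thesis unfolding lead_def x_def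
    using aut_comp[OF aut_comp[OF assms(3) s] assms(4)] by simp
qed

lemma tame_exists:
  assumes "\<sigma> \<in> valued_auts"
  shows "\<exists>c. \<sigma> \<pi> - kk c * \<pi> \<in> fil 2"
  using leading_coeff_exists[of "\<sigma> \<pi>" \<pi>] pi_nz fil_self[of "\<sigma> \<pi>"]
  by (simp add: w_pi aut_w[OF assms])

lemma tame_unique:
  assumes "x - kk c * \<pi> \<in> fil 2" "x - kk d * \<pi> \<in> fil 2"
  shows "c = d"
  using fil_diff[OF assms(2,1)] kk_mult_in_fil_iff[of \<pi> "c - d"] pi_nz
  by (simp add: w_pi emb_diff[OF emb_kk] algebra_simps)

lemma tame_comp:
  assumes "\<sigma> \<in> valued_auts" "\<sigma> \<pi> - kk c * \<pi> \<in> fil 2" "\<tau> \<pi> - kk d * \<pi> \<in> fil 2"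
  shows "(\<sigma> \<circ> \<tau>) \<pi> - kk (c * d) * \<pi> \<in> fil 2"
proof -
  note e = aut_emb[OF assms(1)]
  have "\<sigma> (\<tau> \<pi>) - \<sigma> (kk d * \<pi>) \<in> fil 2" using aut_fil_diff[OF assms(1,3)] .
  moreover have "kk d * (\<sigma> \<pi> - kk c * \<pi>) \<in> fil 2" using fil_kk_mult[OF assms(2)] .
  ultimately show ?thesis
    using fil_add[of "\<sigma> (\<tau> \<pi>) - \<sigma> (kk d * \<pi>)" 2 "kk d * (\<sigma> \<pi> - kk c * \<pi>)"]
    by (simp add: emb_mult[OF e] aut_kk[OF assms(1)] emb_mult[OF emb_kk] algebra_simps)
qed

lemma tame_funpow:
  assumes "\<sigma> \<in> valued_auts" "\<sigma> \<pi> - kk c * \<pi> \<in> fil 2"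
  shows "(\<sigma> ^^ n) \<pi> - kk (c ^ n) * \<pi> \<in> fil 2"
proof (induction n)
  case (Suc n)
  show ?case using tame_comp[OF assms, of "\<sigma> ^^ n" "c ^ n"] Suc by simp
qed (simp add: emb_1[OF emb_kk])

section \<open>Depth and Sen's theorem\<close>

lemma aut_fil_funpow:
  assumes "\<sigma> \<in> valued_auts" "\<sigma> \<pi> - \<pi> \<in> fil j"
  shows "(\<sigma> ^^ n) \<pi> - \<pi> \<in> fil j"
proof (induction n)
  case (Suc n)
  show ?case using fil_trans[OF aut_fil_diff[OF assms(1) Suc] assms(2)] by simp
qed simp

text \<open>The index of the last ramification group containing \<open>\<sigma>\<close>, Serre's
  i(\<sigma>) - 1. At the identity it has no meaning.\<close>

definition depth :: "('l \<Rightarrow> 'l) \<Rightarrow> int" where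
  "depth \<sigma> = w (\<sigma> \<pi> - \<pi>) - 1"

lemma depth_ge_iff:
  assumes "\<sigma> \<in> valued_auts" "\<sigma> \<noteq> id"
  shows "j \<le> depth \<sigma> \<longleftrightarrow> \<sigma> \<pi> - \<pi> \<in> fil (j + 1)"
  using aut_eq_id assms by (auto simp: depth_def fil_def)

lemma depth_eqI:
  assumes "\<sigma> \<in> valued_auts" "\<sigma> \<pi> - \<pi> \<in> fil (j + 1)" "\<sigma> \<pi> - \<pi> \<notin> fil (j + 2)"
  shows "\<sigma> \<noteq> id \<and> depth \<sigma> = j"
  using w_eqI[of "\<sigma> \<pi> - \<pi>" "j + 1"] assms by (auto simp: depth_def algebra_simps)

lemma lead_depth:
  assumes "\<sigma> \<in> valued_auts" "\<sigma> \<noteq> id" "depth \<sigma> = int i"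
  shows "\<exists>c. c \<noteq> 0 \<and> lead i \<sigma> c"
proof -
  have "\<sigma> \<pi> - \<pi> \<in> fil (int i + 1)" "\<sigma> \<pi> - \<pi> \<notin> fil (int i + 2)"
    using depth_ge_iff[OF assms(1,2), of "int i"] depth_ge_iff[OF assms(1,2), of "int i + 1"] assms(3)
    by (auto simp: algebra_simps)
  thus ?thesis using lead_exists[OF assms(1)] lead_eq_0_iff by blast
qed

text \<open>Taking the b-th power multiplies the leading coefficient by b. It survives exactly if b
  is nonzero in k; otherwise the depth grows, as the next lemma records.\<close>

lemma depth_funpow_unit:
  assumes "\<sigma> \<in> valued_auts" "\<sigma> \<noteq> id" "1 \<le> depth \<sigma>" "(of_nat b :: 'k) \<noteq> 0"
  shows "\<sigma> ^^ b \<noteq> id \<and> depth (\<sigma> ^^ b) = depth \<sigma>"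
proof -
  define i where "i = nat (depth \<sigma>)"
  have i: "depth \<sigma> = int i" "1 \<le> i" using assms(3) by (auto simp: i_def)
  obtain c where c: "c \<noteq> 0" "lead i \<sigma> c" using lead_depth[OF assms(1,2) i(1)] by blast
  have l: "lead i (\<sigma> ^^ b) (of_nat b * c)" using lead_funpow[OF c(2) i(2)] .
  thus ?thesis using depth_eqI[OF aut_funpow[OF assms(1)], of b "int i"] lead_imp_fil[OF l]
      lead_eq_0_iff[OF l] c(1) assms(4) i(1) by auto
qed

lemma depth_funpow_zero:
  assumes "\<sigma> \<in> valued_auts" "\<sigma> \<noteq> id" "1 \<le> depth \<sigma>" "(of_nat b :: 'k) = 0" "\<sigma> ^^ b \<noteq> id"
  shows "depth \<sigma> < depth (\<sigma> ^^ b)"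
proof -
  define i where "i = nat (depth \<sigma>)"
  have i: "depth \<sigma> = int i" "1 \<le> i" using assms(3) by (auto simp: i_def)
  obtain c where c: "c \<noteq> 0" "lead i \<sigma> c" using lead_depth[OF assms(1,2) i(1)] by blast
  have l: "lead i (\<sigma> ^^ b) (of_nat b * c)" using lead_funpow[OF c(2) i(2)] .
  thus ?thesis using depth_ge_iff[OF aut_funpow[OF assms(1)] assms(5), of "int i + 1"]
      lead_eq_0_iff[OF l] assms(4) i(1) by (simp add: algebra_simps)
qed

text \<open>The test elements of Sen's argument: of valuation \<open>\<nu>\<close>, and multiplied
  by \<open>(\<sigma> ^^ \<nu>) \<pi> / \<pi>\<close> under \<open>\<sigma>\<close> because the
  product telescopes. Their displacement thus reveals the depth of a power of
  \<open>\<sigma>\<close>.\<close>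

definition orbit_prod :: "('l \<Rightarrow> 'l) \<Rightarrow> nat \<Rightarrow> 'l" where
  "orbit_prod \<sigma> \<nu> = (\<Prod>j<\<nu>. (\<sigma> ^^ j) \<pi>)"

lemma
  assumes "\<sigma> \<in> valued_auts"
  shows orbit_prod_nz: "orbit_prod \<sigma> \<nu> \<noteq> 0" and w_orbit_prod: "w (orbit_prod \<sigma> \<nu>) = int \<nu>"
proof -
  have nz: "(\<sigma> ^^ j) \<pi> \<noteq> 0" for j using pi_nz aut_nz[OF aut_funpow[OF assms]] by simp
  show "orbit_prod \<sigma> \<nu> \<noteq> 0" using nz by (simp add: orbit_prod_def)
  show "w (orbit_prod \<sigma> \<nu>) = int \<nu>" unfolding orbit_prod_def
    by (subst w_prod) (use nz in \<open>auto simp: aut_w[OF aut_funpow[OF assms]] w_pi\<close>)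
qed

lemma orbit_prod_displacement:
  assumes "\<sigma> \<in> valued_auts"
  shows "\<sigma> (orbit_prod \<sigma> \<nu>) - orbit_prod \<sigma> \<nu> = orbit_prod \<sigma> \<nu> / \<pi> * ((\<sigma> ^^ \<nu>) \<pi> - \<pi>)"
proof -
  note e = aut_emb[OF assms]
  have "\<sigma> (orbit_prod \<sigma> \<nu>) * \<pi> = orbit_prod \<sigma> \<nu> * (\<sigma> ^^ \<nu>) \<pi>"
    by (induction \<nu>) (simp_all add: orbit_prod_def emb_1[OF e] emb_mult[OF e] algebra_simps)
  thus ?thesis using pi_nz by (simp add: field_simps)
qed

lemma orbit_prod_displacement_fil:
  assumes "\<sigma> \<in> valued_auts" "(\<sigma> ^^ \<nu>) \<pi> - \<pi> \<in> fil (j + 1)"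
  shows "\<sigma> (orbit_prod \<sigma> \<nu>) - orbit_prod \<sigma> \<nu> \<in> fil (int \<nu> + j)"
proof -
  have "w (orbit_prod \<sigma> \<nu> / \<pi>) = int \<nu> - 1"
    using orbit_prod_nz[OF assms(1)] pi_nz by (simp add: w_divide w_orbit_prod[OF assms(1)] w_pi)
  thus ?thesis using fil_mult[OF fil_self[of "orbit_prod \<sigma> \<nu> / \<pi>"] assms(2)]
    by (simp add: orbit_prod_displacement[OF assms(1)])
qed

lemma orbit_prod_displacement_w:
  assumes "\<sigma> \<in> valued_auts" "\<sigma> ^^ \<nu> \<noteq> id"
  shows "\<sigma> (orbit_prod \<sigma> \<nu>) - orbit_prod \<sigma> \<nu> \<noteq> 0"
    "w (\<sigma> (orbit_prod \<sigma> \<nu>) - orbit_prod \<sigma> \<nu>) = int \<nu> + depth (\<sigma> ^^ \<nu>)"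
proof -
  have "(\<sigma> ^^ \<nu>) \<pi> - \<pi> \<noteq> 0" using aut_eq_id[OF aut_funpow[OF assms(1)]] assms(2) by auto
  thus "\<sigma> (orbit_prod \<sigma> \<nu>) - orbit_prod \<sigma> \<nu> \<noteq> 0"
    "w (\<sigma> (orbit_prod \<sigma> \<nu>) - orbit_prod \<sigma> \<nu>) = int \<nu> + depth (\<sigma> ^^ \<nu>)"
    using orbit_prod_nz[OF assms(1)] pi_nz
    by (simp_all add: orbit_prod_displacement[OF assms(1)] w_mult w_divide w_orbit_prod[OF assms(1)] w_pi depth_def)
qed

lemma fil_expansion:
  assumes "\<And>\<mu>. x \<mu> \<noteq> 0" "\<And>\<mu>. w (x \<mu>) = int \<mu>" "y \<in> fil (int a)"
  shows "\<exists>c. y - (\<Sum>\<mu>\<in>{a..<a + N}. kk (c \<mu>) * x \<mu>) \<in> fil (int (a + N))"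
proof (induction N)
  case 0
  thus ?case using assms by simp
next
  case (Suc N)
  then obtain c where c: "y - (\<Sum>\<mu>\<in>{a..<a + N}. kk (c \<mu>) * x \<mu>) \<in> fil (int (a + N))" by blast
  obtain d where d: "y - (\<Sum>\<mu>\<in>{a..<a + N}. kk (c \<mu>) * x \<mu>) - kk d * x (a + N) \<in> fil (int (a + N) + 1)"
    using leading_coeff_exists[of "y - (\<Sum>\<mu>\<in>{a..<a + N}. kk (c \<mu>) * x \<mu>)" "x (a + N)"] c assms by auto
  have "(\<Sum>\<mu>\<in>{a..<a + Suc N}. kk ((c(a + N := d)) \<mu>) * x \<mu>)
      = (\<Sum>\<mu>\<in>{a..<a + N}. kk (c \<mu>) * x \<mu>) + kk d * x (a + N)" by simp
  thus ?case using d by (intro exI[of _ "c(a + N := d)"]) (simp add: algebra_simps)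
qed

end

section \<open>Jumps of a wild automorphism and Sen's theorem\<close>

locale wild_automorphism = discretely_valued_field w kk \<pi>
  for w :: "'l::field \<Rightarrow> int" and kk :: "'k::field \<Rightarrow> 'l" and \<pi> +
  fixes s :: "'l \<Rightarrow> 'l" and p :: nat
  assumes prime_p: "prime p" and char_p: "CHAR('k) = p"
    and s_aut: "s \<in> valued_auts" and s_wild: "s \<pi> - \<pi> \<in> fil 2"
begin

abbreviation jump :: "nat \<Rightarrow> int" where "jump r \<equiv> depth (s ^^ (p ^ r))"

lemma of_nat_eq_0_iff: "(of_nat b :: 'k) = 0 \<longleftrightarrow> p dvd b"
  using of_nat_eq_0_iff_char_dvd[where 'a = 'k] char_p by simp

lemma depth_ge_1: "s ^^ n \<noteq> id \<Longrightarrow> 1 \<le> depth (s ^^ n)"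
  using depth_ge_iff[OF aut_funpow[OF s_aut], of n 1] aut_fil_funpow[OF s_aut s_wild, of n] by simp

lemma funpow_ne_id: "s ^^ (a * b) \<noteq> id \<Longrightarrow> s ^^ a \<noteq> id"
  by (metis funpow_mult id_funpow)

lemma depth_funpow:
  assumes "\<not> p dvd b" "s ^^ (p ^ q) \<noteq> id"
  shows "s ^^ (p ^ q * b) \<noteq> id \<and> depth (s ^^ (p ^ q * b)) = jump q"
  using depth_funpow_unit[OF aut_funpow[OF s_aut] assms(2) depth_ge_1[OF assms(2)], of b] assms(1)
  by (simp add: of_nat_eq_0_iff funpow_mult mult.commute)

lemma jump_less:
  assumes "s ^^ (p ^ Suc q) \<noteq> id"
  shows "jump q < jump (Suc q)"
proof -
  have *: "s ^^ (p ^ q) \<noteq> id" using funpow_ne_id[of "p ^ q" p] assms by (simp add: mult.commute)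
  have eq: "(s ^^ (p ^ q)) ^^ p = s ^^ (p ^ Suc q)" by (simp add: funpow_mult mult.commute)
  show ?thesis
    using depth_funpow_zero[OF aut_funpow[OF s_aut] * depth_ge_1[OF *], of p] assms
    by (simp add: of_nat_eq_0_iff eq del: power_Suc)
qed

lemma jump_mono:
  assumes "s ^^ (p ^ r) \<noteq> id" "q \<le> r"
  shows "s ^^ (p ^ q) \<noteq> id"
  using funpow_ne_id[of "p ^ q" "p ^ (r - q)"] assms by (simp flip: power_add)

text \<open>Both sides of \<open>(s\<^bsup>p^e\<^esup> - 1) x = (s - 1) (1 + s + \<dots> + s\<^bsup>p^e - 1\<^esup>) x\<close> are computed:
  the left one has a known valuation, and the argument of \<open>s - 1\<close> on the right expands in the
  elements \<open>orbit_prod s \<mu>\<close>, whose images under \<open>s - 1\<close> have distinct valuations.\<close>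

lemma sen_step:
  assumes r: "s ^^ (p ^ r) \<noteq> id"
    and IH: "\<And>a b. a < b \<Longrightarrow> b < r \<Longrightarrow> int p ^ Suc a dvd jump b - jump a"
    and l: "0 < l" "\<not> p ^ r dvd l"
  shows "\<exists>\<mu>. 0 < \<mu> \<and> \<not> p ^ r dvd \<mu> \<and> int l + jump r = int \<mu> + jump (multiplicity p \<mu>)"
proof -
  have nu: "\<not> is_unit p" using prime_p not_prime_unit by blast
  have mult: "\<exists>\<mu>'. \<mu> = p ^ multiplicity p \<mu> * \<mu>' \<and> \<not> p dvd \<mu>'" if "0 < \<mu>" for \<mu> :: nat
    using multiplicity_decompose'[of \<mu> p] that prime_p by (metis not_prime_unit not_gr_zero)
  have mult_less: "multiplicity p \<mu> < r \<longleftrightarrow> \<not> p ^ r dvd \<mu>" if "0 < \<mu>" for \<mu> :: nat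
    using power_dvd_iff_le_multiplicity[of \<mu> p r] nu that by auto
  define q where "q = multiplicity p l"
  \<comment> \<open>Chosen so that \<open>\<tau> ^^ l\<close> is \<open>s ^^ (p ^ r)\<close> raised
    to a power prime to p and hence has depth \<open>jump r\<close>. As q < r, the exponent e is
    positive, so \<open>p ^ e\<close> vanishes in k.\<close>
  define e where "e = r - q"
  have q: "q < r" using l mult_less by (simp add: q_def)
  obtain l' where l': "l = p ^ q * l'" "\<not> p dvd l'" using mult[OF l(1)] by (auto simp: q_def)
  define \<tau> where "\<tau> = s ^^ (p ^ e)"
  have t: "\<tau> \<in> valued_auts" by (simp add: \<tau>_def aut_funpow[OF s_aut])
  have tl: "\<tau> ^^ l = s ^^ (p ^ r * l')"
    using q by (simp add: \<tau>_def funpow_mult l'(1) e_def mult_ac flip: power_add)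
  define x where "x = orbit_prod \<tau> l"
  define Z where "Z = int l + jump r"
  have xw: "x \<noteq> 0" "w x = int l" using orbit_prod_nz[OF t] w_orbit_prod[OF t] by (auto simp: x_def)
  have tx: "\<tau> x - x \<noteq> 0" "w (\<tau> x - x) = Z"
    using orbit_prod_displacement_w[OF t, of l] depth_funpow[OF l'(2) r] by (auto simp: x_def tl Z_def)
  define y where "y = (\<Sum>j<p ^ e. (s ^^ j) x)"
  note es = aut_emb[OF s_aut]
  have sy: "s y - y = \<tau> x - x"
  proof -
    have "s y - y = (\<Sum>j<p ^ e. (s ^^ Suc j) x - (s ^^ j) x)"
      by (simp add: y_def emb_sum[OF es] sum_subtractf)
    also have "\<dots> = \<tau> x - x" by (subst sum_lessThan_telescope) (simp add: \<tau>_def)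
    finally show ?thesis .
  qed
  \<comment> \<open>Each conjugate of x is x up to order l + 1 because s is wild, and the
    \<open>p ^ e\<close> copies of x add up to 0.\<close>
  have y: "y \<in> fil (int (l + 1))"
  proof -
    have "(s ^^ j) x - x \<in> fil (int (l + 1))" for j
      using aut_displacement_power[OF aut_funpow[OF s_aut], of j 1 x l] xw fil_self[of x]
        aut_fil_funpow[OF s_aut s_wild] by (simp add: add.commute)
    hence "(\<Sum>j<p ^ e. (s ^^ j) x - x) \<in> fil (int (l + 1))" by (rule fil_sum)
    moreover have "(of_nat (p ^ e) :: 'l) = kk (of_nat (p ^ e))" by (rule emb_of_nat[OF emb_kk, symmetric])
    moreover have "(of_nat (p ^ e) :: 'k) = 0" using q by (simp only: of_nat_eq_0_iff) (simp add: e_def)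
    ultimately show ?thesis by (simp add: y_def sum_subtractf emb_0[OF emb_kk] del: of_nat_power)
  qed
  \<comment> \<open>The length at which the remainder R of the expansion lies in
    \<open>fil (Z + 1)\<close>, and so does its displacement.\<close>
  define N where "N = nat (jump r)"
  have N: "int N = jump r" using depth_ge_1[OF r] by (simp add: N_def)
  define X where "X = orbit_prod s"
  define I where "I = {l + 1..<l + 1 + N}"
  obtain c where c: "y - (\<Sum>\<mu>\<in>I. kk (c \<mu>) * X \<mu>) \<in> fil (int (l + 1 + N))"
    using fil_expansion[of X y "l + 1" N] y orbit_prod_nz[OF s_aut] w_orbit_prod[OF s_aut]
    by (auto simp: X_def I_def)
  define f where "f \<mu> = kk (c \<mu>) * (s (X \<mu>) - X \<mu>)" for \<mu>
  \<comment> \<open>Indices divisible by \<open>p ^ r\<close> exceed l and displace by at least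
    \<open>jump r\<close>, so they only contribute beyond Z.\<close>
  define T where "T = {\<mu>\<in>I. c \<mu> \<noteq> 0 \<and> \<not> p ^ r dvd \<mu>}"
  have 1: "(s y - y) - sum f I \<in> fil (Z + 1)"
  proof -
    define R where "R = y - (\<Sum>\<mu>\<in>I. kk (c \<mu>) * X \<mu>)"
    have "s R - R \<in> fil (int (l + 1 + N))"
      using c aut_fil[OF s_aut] fil_diff by (simp add: R_def)
    moreover have "s R - R = (s y - y) - sum f I"
      by (simp add: R_def f_def emb_diff[OF es] emb_sum[OF es] emb_mult[OF es] aut_kk[OF s_aut]
          right_diff_distrib sum_subtractf)
    ultimately show ?thesis using N by (simp add: Z_def add_ac)
  qed
  have small: "f \<mu> \<in> fil (Z + 1)" if "\<mu> \<in> I - T" for \<mu>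
  proof (cases "c \<mu> = 0")
    case True
    thus ?thesis by (simp add: f_def emb_0[OF emb_kk])
  next
    case False
    hence "p ^ r dvd \<mu>" using that by (simp add: T_def)
    then obtain k where k: "\<mu> = p ^ r * k" by blast
    have "(s ^^ (p ^ r)) \<pi> - \<pi> \<in> fil (jump r + 1)"
      using depth_ge_iff[OF aut_funpow[OF s_aut] r] by blast
    hence "(s ^^ \<mu>) \<pi> - \<pi> \<in> fil (jump r + 1)"
      using aut_fil_funpow[OF aut_funpow[OF s_aut], of "p ^ r" _ k] by (simp add: k funpow_mult mult.commute)
    hence "f \<mu> \<in> fil (int \<mu> + jump r)"
      using orbit_prod_displacement_fil[OF s_aut] fil_kk_mult by (simp add: f_def X_def)
    thus ?thesis using that by (auto simp: I_def Z_def intro: fil_mono)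
  qed
  have finI: "finite I" "T \<subseteq> I" by (auto simp: I_def T_def)
  have "sum f I = sum f (I - T) + sum f T" using sum.subset_diff[OF finI(2,1)] .
  moreover have "sum f (I - T) \<in> fil (Z + 1)" using small by (rule fil_sum)
  ultimately have "(s y - y) - sum f T \<in> fil (Z + 1)"
    using fil_add[OF 1, of "sum f (I - T)"] by (simp add: algebra_simps)
  hence S: "sum f T \<noteq> 0" "w (sum f T) = Z"
    using w_cong[of "s y - y" "sum f T"] tx sy by auto
  have fT: "f \<mu> \<noteq> 0 \<and> w (f \<mu>) = int \<mu> + jump (multiplicity p \<mu>) \<and> multiplicity p \<mu> < r \<and> 0 < \<mu>"
    if "\<mu> \<in> T" for \<mu>
  proof -
    have m: "0 < \<mu>" "c \<mu> \<noteq> 0" "\<not> p ^ r dvd \<mu>" using that by (auto simp: T_def I_def)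
    have v: "multiplicity p \<mu> < r" using m mult_less by simp
    obtain k where k: "\<mu> = p ^ multiplicity p \<mu> * k" "\<not> p dvd k" using mult[OF m(1)] by blast
    have d: "s ^^ \<mu> \<noteq> id \<and> depth (s ^^ \<mu>) = jump (multiplicity p \<mu>)"
      using depth_funpow[OF k(2) jump_mono[OF r less_imp_le[OF v]]] k(1) by simp
    have "kk (c \<mu>) \<noteq> 0" using m by (simp add: emb_eq_0_iff[OF emb_kk])
    thus ?thesis using orbit_prod_displacement_w[OF s_aut, of \<mu>] d m v
      by (auto simp: f_def X_def w_mult w_kk)
  qed
  \<comment> \<open>Equal valuations with multiplicities a < b would make \<mu> - \<nu> a difference
    of jumps, divisible by \<open>p ^ Suc a\<close> by induction; as \<nu> is too, so would be
    \<mu>.\<close>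
  have inj: "inj_on (\<lambda>\<mu>. w (f \<mu>)) T"
  proof -
    have False if "\<mu> \<in> T" "\<nu> \<in> T" "w (f \<mu>) = w (f \<nu>)" "multiplicity p \<mu> < multiplicity p \<nu>" for \<mu> \<nu>
    proof -
      let ?a = "multiplicity p \<mu>" and ?b = "multiplicity p \<nu>"
      have "int p ^ Suc ?a dvd jump ?b - jump ?a" using IH that fT by blast
      moreover have "p ^ Suc ?a dvd \<nu>"
        using that(4) power_dvd_iff_le_multiplicity[of \<nu> p "Suc ?a"] nu fT[OF that(2)] by auto
      hence "int p ^ Suc ?a dvd int \<nu>" by (metis of_nat_dvd_iff of_nat_power)
      moreover have "int \<mu> = int \<nu> + (jump ?b - jump ?a)" using fT that by auto
      ultimately have "int p ^ Suc ?a dvd int \<mu>" by simp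
      hence "p ^ Suc ?a dvd \<mu>" by (metis of_nat_dvd_iff of_nat_power)
      thus False using power_dvd_iff_le_multiplicity[of \<mu> p "Suc ?a"] nu fT[OF that(1)] by auto
    qed
    moreover have "\<mu> = \<nu>" if "\<mu> \<in> T" "\<nu> \<in> T" "w (f \<mu>) = w (f \<nu>)" "multiplicity p \<mu> = multiplicity p \<nu>" for \<mu> \<nu>
      using fT that by auto
    ultimately show ?thesis unfolding inj_on_def by (metis linorder_neqE_nat)
  qed
  have "T \<noteq> {}" using S by auto
  hence "Z \<in> (\<lambda>\<mu>. w (f \<mu>)) ` T"
    using w_sum_distinct[of T f] finI finite_subset fT inj S(2) by metis
  then obtain \<mu> where "\<mu> \<in> T" "Z = w (f \<mu>)" by blast
  thus ?thesis using fT[of \<mu>] by (intro exI[of _ \<mu>]) (auto simp: Z_def T_def)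
qed

text \<open>If the divisibility failed, the residue l of \<open>jump r - jump (Suc r)\<close> modulo
  \<open>p ^ Suc r\<close> would be an admissible input for \<open>sen_step\<close> at
  \<open>Suc r\<close>. The resulting \<mu>, of multiplicity v, is congruent to
  \<open>jump r - jump v\<close> modulo \<open>p ^ Suc v\<close>, hence to 0 by induction,
  contradicting the choice of v.\<close>

theorem sen:
  assumes "s ^^ (p ^ Suc r) \<noteq> id"
  shows "int p ^ Suc r dvd jump (Suc r) - jump r"
  using assms
proof (induction r rule: less_induct)
  case (less r)
  have step': "int p ^ Suc a dvd jump (Suc a) - jump a" if "a < r" for a
    by (rule less.IH[OF that jump_mono[OF less.prems]]) (use that in simp)
  have IH: "int p ^ Suc a dvd jump b - jump a" if "a \<le> b" "b \<le> r" for a b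
    using that
  proof (induction b rule: dec_induct)
    case (step c)
    have "int p ^ Suc a dvd int p ^ Suc c" using step.hyps by (intro le_imp_power_dvd) auto
    moreover have "int p ^ Suc c dvd jump (Suc c) - jump c" using step.prems by (intro step') simp
    ultimately have d: "int p ^ Suc a dvd jump (Suc c) - jump c" by (rule dvd_trans)
    have "int p ^ Suc a dvd jump c - jump a" using step by simp
    from dvd_add[OF d this] show ?case by (simp del: power_Suc)
  qed simp
  show ?case
  proof (rule ccontr)
    assume nd: "\<not> ?thesis"
    define k where "k = int p ^ Suc r"
    have k: "0 < k" using prime_p prime_gt_0_nat by (simp add: k_def)
    define l where "l = nat ((jump r - jump (Suc r)) mod k)"
    have l: "int l = (jump r - jump (Suc r)) mod k" using k by (simp add: l_def)
    have "\<not> k dvd jump r - jump (Suc r)"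
      using nd dvd_diff_commute[of k "jump (Suc r)" "jump r"] by (simp only: k_def) simp
    hence "int l \<noteq> 0" unfolding l by (simp only: dvd_eq_mod_eq_0) simp
    hence l0: "0 < int l" "int l < k" using pos_mod_bound[OF k] l by simp_all
    have "\<not> k dvd int l" using l0 zdvd_not_zless by blast
    hence "\<not> p ^ Suc r dvd l" unfolding k_def by (metis of_nat_dvd_iff of_nat_power)
    then obtain \<mu> where \<mu>: "0 < \<mu>" "\<not> p ^ Suc r dvd \<mu>"
      "int l + jump (Suc r) = int \<mu> + jump (multiplicity p \<mu>)"
      using sen_step[OF less.prems IH, of l] l0(1) by auto
    let ?v = "multiplicity p \<mu>"
    have nu: "\<not> is_unit p" using prime_p not_prime_unit by blast
    have v: "?v \<le> r" using \<mu>(2) power_dvd_iff_le_multiplicity[of \<mu> p "Suc r"] nu \<mu>(1) by auto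
    have "int p ^ Suc ?v dvd k" unfolding k_def using v by (intro le_imp_power_dvd) auto
    moreover have "k dvd (jump r - jump (Suc r)) - int l" by (simp add: l mod_eq_dvd_iff[symmetric])
    ultimately have "int p ^ Suc ?v dvd (jump r - jump (Suc r)) - int l" by (rule dvd_trans)
    moreover have "int p ^ Suc ?v dvd jump r - jump ?v" using IH v by simp
    moreover have "int \<mu> = (jump r - jump ?v) - ((jump r - jump (Suc r)) - int l)" using \<mu>(3) by simp
    ultimately have "int p ^ Suc ?v dvd int \<mu>" using dvd_diff by metis
    hence "p ^ Suc ?v dvd \<mu>" by (metis of_nat_dvd_iff of_nat_power)
    thus False using power_dvd_iff_le_multiplicity[of \<mu> p "Suc ?v"] nu \<mu>(1) by auto
  qed
qed

end

section \<open>Integral closures\<close>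

lemma emb_comm_ring_hom: "field_embedding h \<Longrightarrow> comm_ring_hom h"
  by unfold_locales (auto simp: emb_0 emb_1 emb_add emb_mult)

lemma
  assumes "field_embedding h"
  shows emb_map_poly_mult: "map_poly h (f * g) = map_poly h f * map_poly h g"
    and emb_map_poly_prod: "map_poly h (\<Prod>x\<in>A. F x) = (\<Prod>x\<in>A. map_poly h (F x))"
    and emb_poly_map_poly: "poly (map_poly h f) (h y) = h (poly f y)"
    and emb_coeff_map_poly: "coeff (map_poly h f) i = h (coeff f i)"
proof -
  interpret comm_ring_hom h using emb_comm_ring_hom[OF assms] .
  interpret mp: map_poly_comm_ring_hom h ..
  show "map_poly h (f * g) = map_poly h f * map_poly h g" by (rule mp.hom_mult)
  show "map_poly h (\<Prod>x\<in>A. F x) = (\<Prod>x\<in>A. map_poly h (F x))" by (rule mp.hom_prod)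
  show "poly (map_poly h f) (h y) = h (poly f y)" by (rule poly_map_poly)
  show "coeff (map_poly h f) i = h (coeff f i)" by simp
qed

lemma monic_root_power:
  fixes x :: "'a::comm_ring_1"
  assumes "lead_coeff q = 1" "poly q x = 0"
  shows "x ^ degree q = (\<Sum>l<degree q. - coeff q l * x ^ l)"
proof -
  have "0 = (\<Sum>l\<le>degree q. coeff q l * x ^ l)" using assms(2) by (simp add: poly_altdef)
  also have "\<dots> = (\<Sum>l<degree q. coeff q l * x ^ l) + x ^ degree q"
    using assms(1) by (simp flip: lessThan_Suc_atMost)
  finally show ?thesis by (simp add: sum_negf eq_neg_iff_add_eq_0 add.commute)
qed

locale field_subring =
  fixes R :: "'l::field set"
  assumes zero_closed: "0 \<in> R" and one_closed: "1 \<in> R"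
    and add_closed: "x \<in> R \<Longrightarrow> y \<in> R \<Longrightarrow> x + y \<in> R"
    and mult_closed: "x \<in> R \<Longrightarrow> y \<in> R \<Longrightarrow> x * y \<in> R"
    and uminus_closed: "x \<in> R \<Longrightarrow> - x \<in> R"
begin

lemma diff_closed: "x \<in> R \<Longrightarrow> y \<in> R \<Longrightarrow> x - y \<in> R"
  using add_closed[of x "- y"] uminus_closed by simp

lemma sum_closed: "(\<And>x. x \<in> S \<Longrightarrow> f x \<in> R) \<Longrightarrow> sum f S \<in> R"
  by (induction S rule: infinite_finite_induct) (auto simp: zero_closed add_closed)

lemma prod_closed: "(\<And>x. x \<in> S \<Longrightarrow> f x \<in> R) \<Longrightarrow> prod f S \<in> R"
  by (induction S rule: infinite_finite_induct) (auto simp: one_closed mult_closed)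

lemma power_closed: "x \<in> R \<Longrightarrow> x ^ n \<in> R"
  by (induction n) (auto simp: one_closed mult_closed)

section \<open>Polynomials and finite modules over a subring\<close>

definition Rpoly :: "'l poly set" where
  "Rpoly = {f. \<forall>i. coeff f i \<in> R}"

lemma Rpoly_coeff: "f \<in> Rpoly \<Longrightarrow> coeff f i \<in> R"
  by (simp add: Rpoly_def)

lemma Rpoly_mult: "f \<in> Rpoly \<Longrightarrow> g \<in> Rpoly \<Longrightarrow> f * g \<in> Rpoly"
  by (auto simp: Rpoly_def coeff_mult intro!: sum_closed mult_closed)

lemma Rpoly_sum: "(\<And>x. x \<in> S \<Longrightarrow> f x \<in> Rpoly) \<Longrightarrow> sum f S \<in> Rpoly"
  by (auto simp: Rpoly_def coeff_sum intro!: sum_closed)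

lemma Rpoly_linear: "a \<in> R \<Longrightarrow> b \<in> R \<Longrightarrow> [:a, b:] \<in> Rpoly"
  by (auto simp: Rpoly_def coeff_pCons zero_closed split: nat.splits)

lemma Rpoly_const: "a \<in> R \<Longrightarrow> [:a:] \<in> Rpoly"
  by (auto simp: Rpoly_def coeff_pCons zero_closed split: nat.splits)

lemma Rpoly_prod: "(\<And>x. x \<in> S \<Longrightarrow> f x \<in> Rpoly) \<Longrightarrow> prod f S \<in> Rpoly"
  using Rpoly_const[OF one_closed]
  by (induction S rule: infinite_finite_induct) (auto simp: Rpoly_mult one_pCons)

definition rspan :: "(nat \<Rightarrow> 'l) \<Rightarrow> nat \<Rightarrow> 'l set" where
  "rspan b n = {\<Sum>k<n. r k * b k | r. \<forall>k. r k \<in> R}"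

lemma rspanI: "(\<And>k. r k \<in> R) \<Longrightarrow> (\<Sum>k<n. r k * b k) \<in> rspan b n"
  by (auto simp: rspan_def)

lemma rspanE:
  assumes "x \<in> rspan b n"
  obtains r where "\<And>k. r k \<in> R" "x = (\<Sum>k<n. r k * b k)"
  using assms by (auto simp: rspan_def)

lemma rspan_base: "k < n \<Longrightarrow> b k \<in> rspan b n"
  using rspanI[of "\<lambda>i. if i = k then 1 else 0" b n] zero_closed one_closed
  by (simp add: if_distrib[of "\<lambda>c. c * _"] cong: if_cong)

lemma rspan_0: "0 \<in> rspan b n"
  using rspanI[of "\<lambda>_. 0"] zero_closed by simp

lemma rspan_add: "x \<in> rspan b n \<Longrightarrow> y \<in> rspan b n \<Longrightarrow> x + y \<in> rspan b n"
  by (elim rspanE) (use rspanI add_closed in \<open>auto simp flip: sum.distrib distrib_right\<close>)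

lemma rspan_scale:
  assumes "c \<in> R" "x \<in> rspan b n"
  shows "c * x \<in> rspan b n"
proof -
  obtain r where r: "\<And>k. r k \<in> R" "x = (\<Sum>k<n. r k * b k)" using rspanE[OF assms(2)] by blast
  show ?thesis using rspanI[of "\<lambda>k. c * r k" b n] r(1) assms(1) mult_closed
    by (simp add: r(2) sum_distrib_left mult.assoc)
qed

lemma rspan_sum: "(\<And>x. x \<in> S \<Longrightarrow> f x \<in> rspan b n) \<Longrightarrow> sum f S \<in> rspan b n"
  by (induction S rule: infinite_finite_induct) (auto simp: rspan_0 rspan_add)

lemma rspan_mult_closed:
  assumes "\<And>k. k < n \<Longrightarrow> z * b k \<in> rspan b n" "x \<in> rspan b n"
  shows "z * x \<in> rspan b n"
proof -
  obtain r where r: "\<And>k. r k \<in> R" "x = (\<Sum>k<n. r k * b k)" using rspanE[OF assms(2)] by blast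
  have "z * x = (\<Sum>k<n. r k * (z * b k))" by (simp add: r(2) sum_distrib_left mult_ac)
  thus ?thesis using r(1) assms(1) by (simp only:) (rule rspan_sum, rule rspan_scale, auto)
qed

text \<open>Determinant trick: the nonzero vector b is an eigenvector, with eigenvalue z, of a
  matrix over \<open>R\<close>, so z is a root of its monic characteristic polynomial.\<close>

lemma integral_if_rspan_stable:
  assumes "\<And>k. k < n \<Longrightarrow> z * b k \<in> rspan b n" "k0 < n" "b k0 \<noteq> 0"
  shows "integral_over R z"
proof -
  have "\<forall>i. \<exists>r. i < n \<longrightarrow> (\<forall>k. r k \<in> R) \<and> z * b i = (\<Sum>k<n. r k * b k)"
    using assms(1) by (auto elim!: rspanE)
  then obtain r where r: "\<And>i k. i < n \<Longrightarrow> r i k \<in> R" "\<And>i. i < n \<Longrightarrow> z * b i = (\<Sum>k<n. r i k * b k)"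
    by metis
  define M where "M = mat n n (\<lambda>(i, k). r i k)"
  have M: "M \<in> carrier_mat n n" by (simp add: M_def)
  have "eigenvector M (vec n b) z"
    unfolding eigenvector_def
  proof (intro conjI)
    show "vec n b \<in> carrier_vec (dim_row M)" by (simp add: M_def)
    show "vec n b \<noteq> 0\<^sub>v (dim_row M)"
    proof
      assume "vec n b = 0\<^sub>v (dim_row M)"
      hence "vec_index (vec n b) k0 = vec_index (0\<^sub>v (dim_row M)) k0" by simp
      thus False using assms by (simp add: M_def)
    qed
    show "M *\<^sub>v vec n b = z \<cdot>\<^sub>v vec n b"
      by (rule eq_vecI) (auto simp: M_def scalar_prod_def r(2) lessThan_atLeast0)
  qed
  hence root: "poly (char_poly M) z = 0"
    using eigenvalue_root_char_poly[OF M] by (auto simp: eigenvalue_def)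
  have entries: "char_poly_matrix M $$ (i, j) \<in> Rpoly" if "i < n" "j < n" for i j
    using that r(1) Rpoly_linear[of "- r i j" 1] Rpoly_const[of "- r i j"] one_closed uminus_closed
    by (auto simp: char_poly_matrix_def M_def one_pCons)
  have "char_poly M \<in> Rpoly"
    unfolding char_poly_def det_def'[OF char_poly_matrix_closed[OF M]]
  proof (intro Rpoly_sum Rpoly_mult Rpoly_prod)
    fix q i assume "q \<in> {q. q permutes {0..<n}}" "i \<in> {0..<n}"
    thus "char_poly_matrix M $$ (i, q i) \<in> Rpoly"
      using entries[of i "q i"] permutes_in_image[of q "{0..<n}" i] by auto
  next
    fix q :: "nat \<Rightarrow> nat"
    show "signof q \<in> Rpoly"
      using Rpoly_const[of 1] Rpoly_const[of "-1"] one_closed uminus_closed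
      by (cases q rule: sign_cases) (auto simp: one_pCons)
  qed
  thus ?thesis unfolding integral_over_def Rpoly_def
    using root degree_monic_char_poly[OF M] by (intro exI[of _ "char_poly M"]) auto
qed

lemma integral_base: "x \<in> R \<Longrightarrow> integral_over R x"
  unfolding integral_over_def
  by (rule exI[of _ "[:- x, 1:]"]) (use Rpoly_linear[of "- x" 1] one_closed uminus_closed in \<open>auto simp: Rpoly_def\<close>)

lemma integralE:
  assumes "integral_over R x"
  obtains q where "lead_coeff q = 1" "q \<in> Rpoly" "poly q x = 0" "0 < degree q"
proof -
  obtain q where q: "lead_coeff q = 1" "q \<in> Rpoly" "poly q x = 0"
    using assms by (auto simp: integral_over_def Rpoly_def)
  moreover have "0 < degree q"
  proof (rule ccontr)
    assume "\<not> 0 < degree q"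
    then obtain c where "q = [:c:]" using degree_eq_zeroE by blast
    with q show False by simp
  qed
  ultimately show ?thesis using that by blast
qed

lemma integral_add_mult:
  assumes "integral_over R x" "integral_over R y"
  shows "integral_over R (x + y)" "integral_over R (x * y)"
proof -
  obtain f where f: "lead_coeff f = 1" "f \<in> Rpoly" "poly f x = 0" "0 < degree f"
    using integralE[OF assms(1)] by blast
  obtain g where g: "lead_coeff g = 1" "g \<in> Rpoly" "poly g y = 0" "0 < degree g"
    using integralE[OF assms(2)] by blast
  define d where "d = degree f"
  define e where "e = degree g"
  \<comment> \<open>The monomials of exponents (i, j) with i < d and j < e, numbered by i e + j; the
    two monic equations keep their span stable under x and y.\<close>
  define b where "b k = x ^ (k div e) * y ^ (k mod e)" for k
  have e: "0 < e" using g by (simp add: e_def)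
  have n: "0 < d * e" using f g by (simp add: d_def e_def)
  have small: "x ^ i * y ^ j \<in> rspan b (d * e)" if "i < d" "j < e" for i j
  proof -
    have "i * e + j < Suc i * e" using that by simp
    also have "\<dots> \<le> d * e" using that by (intro mult_right_mono) auto
    finally have "i * e + j < d * e" .
    moreover have "b (i * e + j) = x ^ i * y ^ j" using that by (simp add: b_def)
    ultimately show ?thesis using rspan_base by metis
  qed
  have x: "x * b k \<in> rspan b (d * e)" if "k < d * e" for k
  proof (cases "Suc (k div e) < d")
    case True
    thus ?thesis using small[of "Suc (k div e)" "k mod e"] e by (simp add: b_def mult.assoc)
  next
    case False
    have "k div e < d" using that by (simp add: less_mult_imp_div_less)
    hence "x ^ Suc (k div e) = x ^ d" using False by (metis Suc_lessI)
    hence "x * b k = x ^ d * y ^ (k mod e)" by (simp add: b_def flip: mult.assoc)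
    hence "x * b k = (\<Sum>l<d. - coeff f l * (x ^ l * y ^ (k mod e)))"
      using monic_root_power[OF f(1,3)] by (simp add: d_def sum_distrib_left mult_ac)
    also have "\<dots> \<in> rspan b (d * e)"
      using small e f by (intro rspan_sum rspan_scale[OF uminus_closed[OF Rpoly_coeff]]) auto
    finally show ?thesis .
  qed
  have y: "y * b k \<in> rspan b (d * e)" if "k < d * e" for k
  proof (cases "Suc (k mod e) < e")
    case True
    thus ?thesis using small[of "k div e" "Suc (k mod e)"] that
      by (simp add: b_def less_mult_imp_div_less mult_ac)
  next
    case False
    have "k mod e < e" using e by simp
    hence "y ^ Suc (k mod e) = y ^ e" using False by (metis Suc_lessI)
    hence "y * b k = x ^ (k div e) * y ^ e" by (simp add: b_def mult_ac)
    hence "y * b k = (\<Sum>l<e. - coeff g l * (x ^ (k div e) * y ^ l))"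
      using monic_root_power[OF g(1,3)] by (simp add: e_def sum_distrib_left mult_ac)
    also have "\<dots> \<in> rspan b (d * e)"
      using small that g by (intro rspan_sum rspan_scale[OF uminus_closed[OF Rpoly_coeff]]) (auto simp: less_mult_imp_div_less)
    finally show ?thesis .
  qed
  have "b 0 \<noteq> 0" by (simp add: b_def)
  moreover have "(x + y) * b k \<in> rspan b (d * e)" if "k < d * e" for k
    using x[OF that] y[OF that] rspan_add by (simp add: distrib_right)
  moreover have "(x * y) * b k \<in> rspan b (d * e)" if "k < d * e" for k
    using rspan_mult_closed[OF x y[OF that]] by (simp add: mult.assoc)
  ultimately show "integral_over R (x + y)" "integral_over R (x * y)"
    using integral_if_rspan_stable n by blast+
qed

text \<open>Dividing the monic equation of degree d + 1 by the d-th power of x expresses x through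
  powers of its inverse.\<close>

lemma integral_inverse:
  assumes "integral_over R x" "inverse x \<in> R"
  shows "x \<in> R"
proof (cases "x = 0")
  case False
  obtain f where f: "lead_coeff f = 1" "f \<in> Rpoly" "poly f x = 0" "0 < degree f"
    using integralE[OF assms(1)] by blast
  then obtain d where d: "degree f = Suc d" using gr0_conv_Suc by blast
  have "x = x ^ degree f * inverse x ^ d" using False by (simp add: d field_simps)
  also have "\<dots> = (\<Sum>l<degree f. - coeff f l * x ^ l * inverse x ^ d)"
    by (simp add: monic_root_power[OF f(1,3)] sum_distrib_right)
  also have "\<dots> = (\<Sum>l<degree f. - coeff f l * inverse x ^ (d - l))"
  proof (intro sum.cong refl)
    fix l assume "l \<in> {..<degree f}"
    hence "d = l + (d - l)" by (simp add: d)
    hence "x ^ l * inverse x ^ d = x ^ l * (inverse x ^ l * inverse x ^ (d - l))" by (metis power_add)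
    also have "\<dots> = inverse x ^ (d - l)" using False by (simp add: field_simps)
    finally show "- coeff f l * x ^ l * inverse x ^ d = - coeff f l * inverse x ^ (d - l)"
      by (simp add: mult.assoc)
  qed
  also have "\<dots> \<in> R" using f assms(2) by (intro sum_closed mult_closed uminus_closed power_closed Rpoly_coeff) auto
  finally show ?thesis .
qed (simp add: zero_closed)

end

section \<open>The valuation ring of a Galois extension of \<open>k((t))\<close>\<close>

text \<open>Inverses are not postulated: composition with an element of the finite set
  \<open>G\<close> is injective, hence a permutation of \<open>G\<close>.\<close>

locale fls_galois =
  fixes \<iota> :: "'k::alg_closed_field fls \<Rightarrow> 'l::field" and G :: "('l \<Rightarrow> 'l) set" and p :: nat
  assumes emb_iota: "field_embedding \<iota>"
    and prime_p: "prime p" and char_p: "CHAR('k) = p"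
    and finite_G: "finite G" and id_G: "id \<in> G"
    and comp_G: "\<sigma> \<in> G \<Longrightarrow> \<tau> \<in> G \<Longrightarrow> \<sigma> \<circ> \<tau> \<in> G"
    and emb_G: "\<sigma> \<in> G \<Longrightarrow> field_embedding \<sigma>"
    and fixed_G: "(\<forall>\<sigma>\<in>G. \<sigma> x = x) \<longleftrightarrow> x \<in> range \<iota>"
begin

abbreviation R :: "'l set" where "R \<equiv> \<iota> ` range fps_to_fls"
abbreviation A :: "'l set" where "A \<equiv> val_ring \<iota>"

definition ii :: "'k fps \<Rightarrow> 'l" where
  "ii f = \<iota> (fps_to_fls f)"

lemma ii_0 [simp]: "ii 0 = 0"
  and ii_1 [simp]: "ii 1 = 1"
  and ii_add: "ii (f + g) = ii f + ii g"
  and ii_diff: "ii (f - g) = ii f - ii g"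
  and ii_uminus: "ii (- f) = - ii f"
  and ii_mult: "ii (f * g) = ii f * ii g"
  by (simp_all add: ii_def emb_0[OF emb_iota] emb_1[OF emb_iota] emb_add[OF emb_iota] emb_diff[OF emb_iota]
      emb_uminus[OF emb_iota] emb_mult[OF emb_iota] fls_times_fps_to_fls)

lemma ii_sum: "ii (sum f S) = (\<Sum>x\<in>S. ii (f x))"
  by (induction S rule: infinite_finite_induct) (auto simp: ii_add)

lemma ii_power: "ii (f ^ n) = ii f ^ n"
  by (induction n) (auto simp: ii_mult)

lemma ii_eq_iff: "ii f = ii g \<longleftrightarrow> f = g"
  by (simp add: ii_def emb_eq_iff[OF emb_iota])

lemma ii_in_R [simp]: "ii f \<in> R"
  by (simp add: ii_def)

lemma RE:
  assumes "x \<in> R"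
  obtains f where "x = ii f"
  using assms by (auto simp: ii_def)

lemma iota_in_R_iff: "\<iota> z \<in> R \<longleftrightarrow> 0 \<le> fls_subdegree z"
proof
  assume "\<iota> z \<in> R"
  then obtain f where "\<iota> z = ii f" by (rule RE)
  thus "0 \<le> fls_subdegree z" by (simp add: ii_def emb_eq_iff[OF emb_iota] fls_subdegree_fls_to_fps)
next
  assume "0 \<le> fls_subdegree z"
  hence "fps_to_fls (fls_regpart z) = z" by simp
  thus "\<iota> z \<in> R" by (metis ii_def ii_in_R)
qed

sublocale R: field_subring R
proof
  show "0 \<in> R" "1 \<in> R" using ii_in_R[of 0] ii_in_R[of 1] by (simp_all del: ii_in_R)
  show "x + y \<in> R" if "x \<in> R" "y \<in> R" for x y
    using that ii_in_R by (metis RE ii_add)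
  show "x * y \<in> R" if "x \<in> R" "y \<in> R" for x y
    using that ii_in_R by (metis RE ii_mult)
  show "- x \<in> R" if "x \<in> R" for x
    using that ii_in_R by (metis RE ii_uminus)
qed

lemma A_iff: "x \<in> A \<longleftrightarrow> integral_over R x"
  by (simp add: val_ring_def)

lemma R_subset_A: "x \<in> R \<Longrightarrow> x \<in> A"
  using R.integral_base A_iff by blast

sublocale A: field_subring A
proof
  show "0 \<in> A" "1 \<in> A" using R_subset_A R.zero_closed R.one_closed by blast+
  show "x + y \<in> A" "x * y \<in> A" if "x \<in> A" "y \<in> A" for x y
    using R.integral_add_mult that by (simp_all add: A_iff)
  show "- x \<in> A" if "x \<in> A" for x
    using R.integral_add_mult(2)[of "- 1" x] R.integral_base[OF R.uminus_closed[OF R.one_closed]] that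
    by (simp add: A_iff)
qed

lemma iota_in_A_imp: "\<iota> z \<in> A \<Longrightarrow> 0 \<le> fls_subdegree z"
proof (rule ccontr)
  assume "\<iota> z \<in> A" and neg: "\<not> 0 \<le> fls_subdegree z"
  have "inverse (\<iota> z) \<in> R"
    using neg iota_in_R_iff[of "inverse z"]
    by (cases "z = 0") (auto simp: emb_inverse[OF emb_iota])
  hence "\<iota> z \<in> R" using \<open>\<iota> z \<in> A\<close> R.integral_inverse by (simp add: A_iff)
  thus False using neg iota_in_R_iff by blast
qed

lemma A_inter_range: "x \<in> A \<Longrightarrow> x \<in> range \<iota> \<Longrightarrow> x \<in> R"
  using iota_in_A_imp iota_in_R_iff by blast

lemma G_fixes_iota: "\<sigma> \<in> G \<Longrightarrow> \<sigma> (\<iota> z) = \<iota> z"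
  using fixed_G[of "\<iota> z"] by blast

lemma G_ii: "\<sigma> \<in> G \<Longrightarrow> \<sigma> (ii f) = ii f"
  by (simp add: ii_def G_fixes_iota)

lemma G_A:
  assumes "\<sigma> \<in> G" "x \<in> A"
  shows "\<sigma> x \<in> A"
proof -
  obtain q where q: "lead_coeff q = 1" "q \<in> R.Rpoly" "poly q x = 0"
    using assms(2) R.integralE by (auto simp: A_iff)
  have "\<sigma> (coeff q i) = coeff q i" for i
    using R.Rpoly_coeff[OF q(2), of i] by (rule RE) (simp add: G_ii[OF assms(1)])
  hence "map_poly \<sigma> q = q" by (intro poly_eqI) (simp add: emb_coeff_map_poly[OF emb_G[OF assms(1)]])
  hence "poly q (\<sigma> x) = 0"
    using emb_poly_map_poly[OF emb_G[OF assms(1)], of q x] q(3) by (simp add: emb_0[OF emb_G[OF assms(1)]])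
  thus ?thesis using q(1,2) unfolding A_iff integral_over_def R.Rpoly_def by blast
qed

lemma G_bij: "\<tau> \<in> G \<Longrightarrow> bij_betw (\<lambda>\<sigma>. \<tau> \<circ> \<sigma>) G G"
proof -
  assume t: "\<tau> \<in> G"
  have "inj_on (\<lambda>\<sigma>. \<tau> \<circ> \<sigma>) G"
    using emb_eq_iff[OF emb_G[OF t]] by (auto simp: inj_on_def fun_eq_iff)
  moreover have "(\<lambda>\<sigma>. \<tau> \<circ> \<sigma>) ` G \<subseteq> G" using comp_G t by blast
  ultimately show ?thesis using finite_G endo_inj_surj by (metis bij_betw_def)
qed

subsection \<open>Characteristic polynomials\<close>

text \<open>The product is invariant under \<open>G\<close>, so its coefficients lie in k((t)) and
  in \<open>A\<close>; k[[t]] being integrally closed, they lie in \<open>R\<close>.\<close>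

lemma prod_conj_in_Rpoly:
  assumes "f \<in> A.Rpoly"
  shows "(\<Prod>\<sigma>\<in>G. map_poly \<sigma> f) \<in> R.Rpoly"
proof -
  let ?F = "\<Prod>\<sigma>\<in>G. map_poly \<sigma> f"
  have "?F \<in> A.Rpoly"
    using assms G_A by (intro A.Rpoly_prod) (auto simp: A.Rpoly_def emb_coeff_map_poly[OF emb_G])
  moreover have "map_poly \<tau> ?F = ?F" if t: "\<tau> \<in> G" for \<tau>
  proof -
    have "map_poly \<tau> (map_poly \<sigma> f) = map_poly (\<tau> \<circ> \<sigma>) f" if "\<sigma> \<in> G" for \<sigma>
      using emb_0[OF emb_G[OF t]] emb_0[OF emb_G[OF that]] by (intro map_poly_map_poly)
    hence "map_poly \<tau> ?F = (\<Prod>\<sigma>\<in>G. map_poly (\<tau> \<circ> \<sigma>) f)"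
      by (simp add: emb_map_poly_prod[OF emb_G[OF t]])
    also have "\<dots> = ?F" using prod.reindex_bij_betw[OF G_bij[OF t]] .
    finally show ?thesis .
  qed
  hence "\<tau> (coeff ?F i) = coeff ?F i" if "\<tau> \<in> G" for \<tau> i
    using that emb_coeff_map_poly[OF emb_G[OF that], of ?F i] by simp
  hence "coeff ?F i \<in> range \<iota>" for i using fixed_G by blast
  ultimately show ?thesis using A_inter_range by (auto simp: A.Rpoly_def R.Rpoly_def)
qed

text \<open>The product of the conjugates of f is monic over \<open>R\<close> and has f as a factor,
  so x is already integral over \<open>R\<close>.\<close>

lemma A_integrally_closed:
  assumes "f \<in> A.Rpoly" "lead_coeff f = 1" "poly f x = 0"
  shows "x \<in> A"
proof -
  let ?F = "\<Prod>\<sigma>\<in>G. map_poly \<sigma> f"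
  have "lead_coeff (map_poly \<sigma> f) = 1" if "\<sigma> \<in> G" for \<sigma>
  proof -
    interpret comm_ring_hom \<sigma> using emb_comm_ring_hom[OF emb_G[OF that]] .
    have "degree (map_poly \<sigma> f) = degree f" using assms(2) by (cases "f = 0") (auto intro!: degree_map_poly)
    thus ?thesis using assms(2) by simp
  qed
  hence "lead_coeff ?F = 1" by (simp add: lead_coeff_prod)
  moreover have "poly ?F x = 0"
    using id_G finite_G assms(3) by (auto simp: poly_prod map_poly_id' intro!: bexI[of _ id])
  ultimately show ?thesis using prod_conj_in_Rpoly[OF assms(1)]
    unfolding A_iff integral_over_def R.Rpoly_def by blast
qed

definition charpoly :: "'l \<Rightarrow> 'l poly" where
  "charpoly a = (\<Prod>\<sigma>\<in>G. [:- \<sigma> a, 1:])"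

lemma charpoly_eq: "charpoly a = (\<Prod>\<sigma>\<in>G. map_poly \<sigma> [:- a, 1:])"
  unfolding charpoly_def
  by (intro prod.cong refl) (auto simp: map_poly_pCons emb_uminus[OF emb_G] emb_1[OF emb_G] emb_0[OF emb_G])

lemma lead_coeff_charpoly: "lead_coeff (charpoly a) = 1"
  by (simp add: charpoly_def lead_coeff_prod)

lemma degree_charpoly: "degree (charpoly a) = card G"
  unfolding charpoly_def by (subst degree_prod_eq_sum_degree) auto

lemma poly_charpoly: "poly (charpoly a) x = (\<Prod>\<sigma>\<in>G. x - \<sigma> a)"
  by (simp add: charpoly_def poly_prod)

lemma poly_charpoly_self: "poly (charpoly a) a = 0"
  using id_G finite_G by (auto simp: poly_charpoly intro!: bexI[of _ id])

lemma charpoly_in_range: "coeff (charpoly a) i \<in> range \<iota>"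
proof -
  have "\<tau> (coeff (charpoly a) i) = coeff (charpoly a) i" if t: "\<tau> \<in> G" for \<tau>
  proof -
    have "map_poly \<tau> (charpoly a) = (\<Prod>\<sigma>\<in>G. [:- (\<tau> \<circ> \<sigma>) a, 1:])"
      unfolding charpoly_def emb_map_poly_prod[OF emb_G[OF t]]
      by (intro prod.cong refl)
        (auto simp: map_poly_pCons emb_uminus[OF emb_G[OF t]] emb_1[OF emb_G[OF t]] emb_0[OF emb_G[OF t]])
    also have "\<dots> = charpoly a" unfolding charpoly_def
      using prod.reindex_bij_betw[OF G_bij[OF t], of "\<lambda>\<sigma>. [:- \<sigma> a, 1:]"] .
    finally show ?thesis using emb_coeff_map_poly[OF emb_G[OF t], of "charpoly a" i] by simp
  qed
  thus ?thesis using fixed_G by blast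
qed

lemma charpoly_in_Rpoly: "a \<in> A \<Longrightarrow> charpoly a \<in> R.Rpoly"
  unfolding charpoly_eq by (intro prod_conj_in_Rpoly A.Rpoly_linear A.uminus_closed A.one_closed)

subsection \<open>The norm valuation\<close>

definition nrm :: "'l \<Rightarrow> 'k fls" where
  "nrm x = inv_into UNIV \<iota> (\<Prod>\<sigma>\<in>G. \<sigma> x)"

text \<open>Not normalized: \<open>tt\<close> has value \<open>card G\<close>. It is multiplicative
  by construction, but the ultrametric inequality must wait until \<open>A\<close> is known to be a
  valuation ring.\<close>

definition val :: "'l \<Rightarrow> int" where
  "val x = fls_subdegree (nrm x)"

lemma iota_nrm: "\<iota> (nrm x) = (\<Prod>\<sigma>\<in>G. \<sigma> x)"
proof -
  have "\<tau> (\<Prod>\<sigma>\<in>G. \<sigma> x) = (\<Prod>\<sigma>\<in>G. \<sigma> x)" if "\<tau> \<in> G" for \<tau>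
    using prod.reindex_bij_betw[OF G_bij[OF that], of "\<lambda>\<sigma>. \<sigma> x"]
    by (simp add: emb_prod[OF emb_G[OF that]])
  hence "(\<Prod>\<sigma>\<in>G. \<sigma> x) \<in> range \<iota>" using fixed_G by blast
  thus ?thesis by (simp add: nrm_def f_inv_into_f)
qed

lemma nrm_eqI: "\<iota> z = (\<Prod>\<sigma>\<in>G. \<sigma> x) \<Longrightarrow> nrm x = z"
  using iota_nrm emb_eq_iff[OF emb_iota] by metis

lemma nrm_mult: "nrm (x * y) = nrm x * nrm y"
  by (rule nrm_eqI) (simp add: emb_mult[OF emb_iota] iota_nrm prod.distrib[symmetric] emb_mult[OF emb_G] cong: prod.cong)

lemma nrm_eq_0_iff: "nrm x = 0 \<longleftrightarrow> x = 0"
proof -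
  have "nrm x = 0 \<longleftrightarrow> (\<Prod>\<sigma>\<in>G. \<sigma> x) = 0" using emb_eq_0_iff[OF emb_iota, of "nrm x"] by (simp add: iota_nrm)
  also have "\<dots> \<longleftrightarrow> x = 0" using finite_G id_G emb_eq_0_iff[OF emb_G] by auto
  finally show ?thesis .
qed

lemma val_mult: "x \<noteq> 0 \<Longrightarrow> y \<noteq> 0 \<Longrightarrow> val (x * y) = val x + val y"
  by (simp add: val_def nrm_mult nrm_eq_0_iff)

lemma val_1: "val 1 = 0"
  using val_mult[of 1 1] by simp

lemma val_inverse: "x \<noteq> 0 \<Longrightarrow> val (inverse x) = - val x"
  using val_mult[of x "inverse x"] val_1 by simp

lemma val_power: "x \<noteq> 0 \<Longrightarrow> val (x ^ n) = int n * val x"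
  by (induction n) (auto simp: val_1 val_mult algebra_simps)

lemma val_G: "\<tau> \<in> G \<Longrightarrow> val (\<tau> x) = val x"
proof -
  assume t: "\<tau> \<in> G"
  have "\<iota> (nrm x) = \<tau> (\<iota> (nrm x))" using G_fixes_iota[OF t] by simp
  also have "\<dots> = (\<Prod>\<sigma>\<in>G. \<tau> (\<sigma> x))" by (simp add: iota_nrm emb_prod[OF emb_G[OF t]])
  finally have *: "\<iota> (nrm x) = (\<Prod>\<sigma>\<in>G. \<tau> (\<sigma> x))" .
  have surj: "\<exists>\<rho>\<in>G. \<tau> \<circ> \<rho> = id" using G_bij[OF t] id_G unfolding bij_betw_def by (metis imageE)
  then obtain \<rho> where r: "\<rho> \<in> G" "\<tau> \<circ> \<rho> = id" by blast
  have inj: "inj_on (\<lambda>\<sigma>. \<sigma> \<circ> \<tau>) G"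
  proof (rule inj_onI)
    fix \<sigma> \<sigma>' assume "\<sigma> \<circ> \<tau> = \<sigma>' \<circ> \<tau>"
    hence "\<sigma> \<circ> (\<tau> \<circ> \<rho>) = \<sigma>' \<circ> (\<tau> \<circ> \<rho>)" by (metis comp_assoc)
    thus "\<sigma> = \<sigma>'" by (simp add: r(2))
  qed
  moreover have "(\<lambda>\<sigma>. \<sigma> \<circ> \<tau>) ` G \<subseteq> G" using comp_G t by blast
  ultimately have "bij_betw (\<lambda>\<sigma>. \<sigma> \<circ> \<tau>) G G" using finite_G endo_inj_surj by (metis bij_betw_def)
  from prod.reindex_bij_betw[OF this, of "\<lambda>\<sigma>. \<sigma> x"]
  have "(\<Prod>\<sigma>\<in>G. \<sigma> (\<tau> x)) = \<iota> (nrm x)" by (simp add: iota_nrm)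
  hence "nrm (\<tau> x) = nrm x" by (intro nrm_eqI) simp
  thus ?thesis by (simp add: val_def)
qed

lemma val_iota: "z \<noteq> 0 \<Longrightarrow> val (\<iota> z) = int (card G) * fls_subdegree z"
proof -
  assume "z \<noteq> 0"
  have "nrm (\<iota> z) = z ^ card G"
    by (rule nrm_eqI) (simp add: emb_power[OF emb_iota] G_fixes_iota cong: prod.cong)
  thus ?thesis using \<open>z \<noteq> 0\<close> by (simp add: val_def fls_subdegree_pow)
qed

lemma card_G_pos: "0 < card G"
  using finite_G id_G card_gt_0_iff by blast

lemma prod_G_in_A: "x \<in> A \<Longrightarrow> (\<Prod>\<sigma>\<in>G. \<sigma> x) \<in> A"
  using G_A by (intro A.prod_closed) auto

lemma val_nonneg: "x \<in> A \<Longrightarrow> 0 \<le> val x"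
  using prod_G_in_A[of x] iota_in_A_imp[of "nrm x"] by (simp add: val_def iota_nrm)

text \<open>The inverse is the product of the other conjugates divided by the norm, a unit of
  k[[t]].\<close>

lemma unit_in_A: 
  assumes "x \<in> A" "x \<noteq> 0" "val x = 0"
  shows "inverse x \<in> A"
proof -
  define y where "y = (\<Prod>\<sigma>\<in>G - {id}. \<sigma> x)"
  have "\<iota> (nrm x) = x * y"
    using prod.remove[OF finite_G id_G, of "\<lambda>\<sigma>. \<sigma> x"] by (simp add: iota_nrm y_def)
  moreover have "nrm x \<noteq> 0" using assms nrm_eq_0_iff by blast
  ultimately have "\<iota> (inverse (nrm x)) = inverse x * inverse y" "y \<noteq> 0"
    using emb_eq_0_iff[OF emb_iota, of "nrm x"] by (auto simp: emb_inverse[OF emb_iota])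
  hence "inverse x = \<iota> (inverse (nrm x)) * y" by simp
  moreover have "\<iota> (inverse (nrm x)) \<in> A"
    using assms iota_in_R_iff[of "inverse (nrm x)"] R_subset_A \<open>nrm x \<noteq> 0\<close> by (simp add: val_def)
  moreover have "y \<in> A" unfolding y_def using assms(1) G_A by (intro A.prod_closed) auto
  ultimately show ?thesis using A.mult_closed by simp
qed

text \<open>The future maximal ideal. Closure under addition is precisely locality of
  \<open>A\<close> and is obtained only in \<open>mm_add\<close>.\<close>

definition mm :: "'l set" where
  "mm = {x \<in> A. x = 0 \<or> 0 < val x}"

lemma mm_A: "x \<in> mm \<Longrightarrow> x \<in> A"
  by (simp add: mm_def)

lemma zero_mm: "0 \<in> mm"
  by (simp add: mm_def A.zero_closed)

lemma one_not_mm: "1 \<notin> mm"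
  by (simp add: mm_def val_1)

lemma mm_mult: "x \<in> mm \<Longrightarrow> y \<in> A \<Longrightarrow> x * y \<in> mm"
  using val_nonneg[of y] val_mult[of x y] by (cases "x = 0 \<or> y = 0") (auto simp: mm_def A.mult_closed)

lemma mm_uminus: "x \<in> mm \<Longrightarrow> - x \<in> mm"
  using mm_mult[of x "- 1"] A.uminus_closed[OF A.one_closed] by simp

lemma not_mm_inverse:
  assumes "x \<in> A" "x \<notin> mm"
  shows "x \<noteq> 0 \<and> inverse x \<in> A"
  using assms unit_in_A[of x] val_nonneg[of x] by (auto simp: mm_def)

lemma nonunits_eq: "nonunits A = mm"
proof (intro equalityI subsetI)
  fix x assume "x \<in> nonunits A"
  hence "x \<in> A" "\<forall>y\<in>A. x * y \<noteq> 1" by (auto simp: nonunits_def)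
  thus "x \<in> mm" using not_mm_inverse[of x] right_inverse[of x] by blast
next
  fix x assume x: "x \<in> mm"
  have "x * y \<noteq> 1" if "y \<in> A" for y using mm_mult[OF x that] one_not_mm by auto
  thus "x \<in> nonunits A" using x mm_A by (auto simp: nonunits_def)
qed

lemma iota_in_mm_imp: "\<iota> z \<in> mm \<Longrightarrow> z = 0 \<or> 0 < fls_subdegree z"
proof -
  assume *: "\<iota> z \<in> mm"
  have "0 < fls_subdegree z" if "z \<noteq> 0"
  proof -
    have "\<iota> z \<noteq> 0" using that by (simp add: emb_eq_0_iff[OF emb_iota])
    hence "0 < int (card G) * fls_subdegree z" using * val_iota[OF that] by (simp add: mm_def)
    thus ?thesis by (simp add: zero_less_mult_iff)
  qed
  thus ?thesis by blast
qed

lemma in_mm_iff: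
  assumes "x \<in> A" "(\<Prod>\<sigma>\<in>G. \<sigma> x) = ii f"
  shows "x \<in> mm \<longleftrightarrow> fps_nth f 0 = 0"
proof -
  have "nrm x = fps_to_fls f" using assms(2) by (intro nrm_eqI) (simp add: ii_def)
  moreover have "0 < subdegree f \<longleftrightarrow> f \<noteq> 0 \<and> fps_nth f 0 = 0"
    using subdegree_eq_0_iff[of f] by auto
  ultimately show ?thesis using assms(1) nrm_eq_0_iff[of x]
    by (auto simp: mm_def val_def fls_subdegree_fls_to_fps)
qed

definition kk :: "'k \<Rightarrow> 'l" where
  "kk c = ii (fps_const c)"

abbreviation tt :: 'l where "tt \<equiv> ii fps_X"

lemma emb_kk: "field_embedding kk"
  unfolding field_embedding_def kk_def
  by (simp add: ii_add[symmetric] ii_mult[symmetric] del: fps_const_add fps_const_mult)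
    (simp add: ii_add ii_mult flip: fps_const_add fps_const_mult)

lemma kk_A: "kk c \<in> A"
  unfolding kk_def by (intro R_subset_A ii_in_R)

lemma tt_A: "tt \<in> A"
  by (intro R_subset_A ii_in_R)

lemma tt_nz: "tt \<noteq> 0"
  using ii_eq_iff[of fps_X 0] by simp

lemma val_tt: "val tt = int (card G)"
  using val_iota[of "fps_to_fls fps_X"] by (simp add: ii_def fls_subdegree_fls_to_fps)

lemma G_kk: "\<sigma> \<in> G \<Longrightarrow> \<sigma> (kk c) = kk c"
  by (simp add: kk_def G_ii)

text \<open>t lies in the Jacobson radical: the norm of \<open>1 - tt * x\<close> has constant term
  1.\<close>

lemma one_minus_tt_not_mm:
  assumes "x \<in> A"
  shows "1 - tt * x \<notin> mm"
proof -
  \<comment> \<open>Partial products are not invariant under \<open>G\<close>, so y is first found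
    in \<open>A\<close>; for the full product it is also in k((t)), hence in
    \<open>R\<close>.\<close>
  have "\<exists>y\<in>A. (\<Prod>\<sigma>\<in>S. \<sigma> (1 - tt * x)) = 1 - tt * y" if "finite S" "S \<subseteq> G" for S
    using that
  proof (induction S rule: finite_induct)
    case empty
    show ?case using A.zero_closed by (intro bexI[of _ 0]) auto
  next
    case (insert \<sigma> S)
    then obtain y where y: "y \<in> A" "(\<Prod>\<sigma>\<in>S. \<sigma> (1 - tt * x)) = 1 - tt * y" by auto
    have s: "\<sigma> \<in> G" using insert by simp
    have "\<sigma> (1 - tt * x) = 1 - tt * \<sigma> x"
      by (simp add: emb_diff[OF emb_G[OF s]] emb_1[OF emb_G[OF s]] emb_mult[OF emb_G[OF s]] G_ii[OF s])
    moreover have "(\<Prod>\<sigma>\<in>insert \<sigma> S. \<sigma> (1 - tt * x)) = \<sigma> (1 - tt * x) * (\<Prod>\<sigma>\<in>S. \<sigma> (1 - tt * x))"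
      using insert.hyps by simp
    ultimately have "(\<Prod>\<sigma>\<in>insert \<sigma> S. \<sigma> (1 - tt * x)) = 1 - tt * (\<sigma> x + y - tt * (\<sigma> x * y))"
      unfolding y(2) by (simp only:) (simp add: algebra_simps)
    moreover have "\<sigma> x + y - tt * (\<sigma> x * y) \<in> A"
      using G_A[OF s assms] y(1) tt_A by (intro A.diff_closed A.add_closed A.mult_closed)
    ultimately show ?case by blast
  qed
  from this[OF finite_G] obtain y where y: "y \<in> A" "(\<Prod>\<sigma>\<in>G. \<sigma> (1 - tt * x)) = 1 - tt * y" by auto
  have "y = (1 - \<iota> (nrm (1 - tt * x))) / tt" using y(2) tt_nz by (simp add: iota_nrm)
  also have "\<dots> = \<iota> ((1 - nrm (1 - tt * x)) / fps_to_fls fps_X)"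
    by (simp only: ii_def emb_divide[OF emb_iota] emb_diff[OF emb_iota] emb_1[OF emb_iota])
  finally have "y \<in> R" using y(1) A_inter_range by blast
  then obtain f where f: "y = ii f" by (rule RE)
  have "(\<Prod>\<sigma>\<in>G. \<sigma> (1 - tt * x)) = ii (1 - fps_X * f)"
    by (simp add: y(2) f ii_diff ii_mult)
  moreover have "1 - tt * x \<in> A" using assms tt_A A.one_closed by (intro A.diff_closed A.mult_closed)
  ultimately show ?thesis using in_mm_iff by simp
qed

subsection \<open>The residue field\<close>

text \<open>\<open>f\<close> is the reduction modulo \<open>t\<close> of the characteristic polynomial of \<open>a\<close>.\<close>

lemma reduced_charpoly:
  assumes "a \<in> A"
  obtains f :: "'k poly" where "degree f = card G" "f \<noteq> 0"
    "\<And>c. poly f c = 0 \<longleftrightarrow> kk c - a \<in> mm"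
    "\<exists>b \<in> R.rspan (\<lambda>i. a ^ i) (card G). poly (map_poly kk f) a = tt * b"
proof -
  let ?g = "card G"
  have "\<forall>i. \<exists>r. coeff (charpoly a) i = ii r"
    using R.Rpoly_coeff[OF charpoly_in_Rpoly[OF assms]] RE by metis
  then obtain r where r: "\<And>i. coeff (charpoly a) i = ii (r i)" by metis
  have r0: "r i = 0" if "i > ?g" for i
    using r[of i] coeff_eq_0[of "charpoly a" i] that ii_eq_iff[of "r i" 0] by (simp add: degree_charpoly)
  have rg: "r ?g = 1"
    using r[of ?g] lead_coeff_charpoly[of a] ii_eq_iff[of "r ?g" 1] by (simp add: degree_charpoly)
  define f where "f = Abs_poly (\<lambda>i. fps_nth (r i) 0)"
  have f: "coeff f i = fps_nth (r i) 0" for i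
    unfolding f_def by (subst coeff_Abs_poly[where n = ?g]) (auto simp: r0)
  have deg: "degree f = ?g"
    by (intro antisym degree_le le_degree) (auto simp: f r0 rg)
  have "f \<noteq> 0" using f[of ?g] rg by auto
  have "poly f c = 0 \<longleftrightarrow> kk c - a \<in> mm" for c
  proof -
    have "(\<Prod>\<sigma>\<in>G. \<sigma> (kk c - a)) = poly (charpoly a) (kk c)"
      by (simp add: poly_charpoly emb_diff[OF emb_G] G_kk cong: prod.cong)
    also have "\<dots> = ii (\<Sum>i\<le>?g. r i * fps_const (c ^ i))"
      by (simp add: poly_altdef degree_charpoly r kk_def ii_sum ii_mult flip: ii_power)
    finally have "kk c - a \<in> mm \<longleftrightarrow> fps_nth (\<Sum>i\<le>?g. r i * fps_const (c ^ i)) 0 = 0"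
      using in_mm_iff A.diff_closed[OF kk_A assms] by blast
    thus ?thesis by (simp add: poly_altdef deg f fps_sum_nth)
  qed
  moreover have "\<exists>b \<in> R.rspan (\<lambda>i. a ^ i) ?g. poly (map_poly kk f) a = tt * b"
  proof
    define s where "s i = fps_shift 1 (fps_const (fps_nth (r i) 0) - r i)" for i
    have s: "fps_const (fps_nth (r i) 0) - r i = fps_X * s i" for i
      unfolding s_def by (rule fps_ext) (auto simp: fps_X_mult_nth)
    define b where "b = (\<Sum>i<?g. ii (s i) * a ^ i)"
    show "b \<in> R.rspan (\<lambda>i. a ^ i) ?g" unfolding b_def by (rule R.rspanI) simp
    have dk: "degree (map_poly kk f) = ?g"
      using deg \<open>f \<noteq> 0\<close> emb_1[OF emb_kk] by (subst degree_map_poly) (auto simp: f rg)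
    \<comment> \<open>Subtracting \<open>charpoly a\<close>, which vanishes at a, leaves
      coefficients divisible by t. Both polynomials are monic of the same degree, so only powers of
      a below \<open>card G\<close> remain.\<close>
    have "poly (map_poly kk f) a = poly (map_poly kk f) a - poly (charpoly a) a"
      by (simp add: poly_charpoly_self)
    also have "\<dots> = (\<Sum>i\<le>?g. (kk (fps_nth (r i) 0) - ii (r i)) * a ^ i)"
      by (simp add: poly_altdef dk degree_charpoly r emb_coeff_map_poly[OF emb_kk] f sum_subtractf left_diff_distrib)
    also have "\<dots> = (\<Sum>i<?g. (kk (fps_nth (r i) 0) - ii (r i)) * a ^ i)"
      by (simp add: rg kk_def flip: lessThan_Suc_atMost)
    also have "\<dots> = (\<Sum>i<?g. tt * (ii (s i) * a ^ i))"
    proof (intro sum.cong refl)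
      fix i
      have "kk (fps_nth (r i) 0) - ii (r i) = ii (fps_const (fps_nth (r i) 0) - r i)"
        by (simp add: kk_def ii_diff)
      thus "(kk (fps_nth (r i) 0) - ii (r i)) * a ^ i = tt * (ii (s i) * a ^ i)"
        unfolding s by (simp add: ii_mult mult.assoc)
    qed
    finally show "poly (map_poly kk f) a = tt * b" by (simp add: b_def sum_distrib_left)
  qed
  ultimately show ?thesis using that deg \<open>f \<noteq> 0\<close> by blast
qed

lemma residue_exists:
  assumes "a \<in> A"
  shows "\<exists>c. a - kk c \<in> mm"
proof -
  obtain f :: "'k poly" where f: "degree f = card G" "\<And>c. poly f c = 0 \<longleftrightarrow> kk c - a \<in> mm"
    using reduced_charpoly[OF assms] by metis
  obtain c where "poly f c = 0" using alg_closed_imp_poly_has_root[of f] f(1) card_G_pos by auto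
  thus ?thesis using f(2) mm_uminus[of "kk c - a"] by auto
qed

lemma char_l: "CHAR('l) = p"
proof (rule CHAR_eqI)
  have *: "(of_nat n :: 'l) = kk (of_nat n)" for n by (simp add: emb_of_nat[OF emb_kk])
  show "(of_nat p :: 'l) = 0" using of_nat_CHAR[where 'a = 'k] by (simp add: * char_p emb_0[OF emb_kk])
  show "p dvd n" if "(of_nat n :: 'l) = 0" for n
    using that of_nat_eq_0_iff_char_dvd[where 'a = 'k] by (simp add: * char_p emb_eq_0_iff[OF emb_kk])
qed

text \<open>Completeness of k[[t]]: each coefficient of the formal sum is a finite sum, and
  \<open>c N\<close> is the tail divided by \<open>fps_X ^ N\<close>. The next lemma transfers this
  to finite modules coordinate by coordinate.\<close>

lemma fps_series:
  fixes r :: "nat \<Rightarrow> 'k fps"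
  obtains s c where "\<And>N. s - (\<Sum>n<N. fps_X ^ n * r n) = fps_X ^ N * c N"
proof
  define s where "s = Abs_fps (\<lambda>j. \<Sum>n\<le>j. fps_nth (r n) (j - n))"
  define c where "c N = fps_shift N (s - (\<Sum>n<N. fps_X ^ n * r n))" for N
  show "s - (\<Sum>n<N. fps_X ^ n * r n) = fps_X ^ N * c N" for N
  proof (rule fps_ext)
    fix j
    have "fps_nth (s - (\<Sum>n<N. fps_X ^ n * r n)) j = 0" if "j < N"
    proof -
      have "fps_nth (\<Sum>n<N. fps_X ^ n * r n) j = (\<Sum>n<N. if j < n then 0 else fps_nth (r n) (j - n))"
        by (simp add: fps_sum_nth fps_X_power_mult_nth)
      also have "\<dots> = (\<Sum>n\<le>j. fps_nth (r n) (j - n))"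
        using that by (intro sum.mono_neutral_cong_right) auto
      finally show ?thesis by (simp add: s_def)
    qed
    thus "fps_nth (s - (\<Sum>n<N. fps_X ^ n * r n)) j = fps_nth (fps_X ^ N * c N) j"
      by (cases "j < N") (auto simp: fps_X_power_mult_nth c_def)
  qed
qed

lemma rspan_series:
  assumes "\<And>n. y n \<in> R.rspan b d"
  obtains s c where "s \<in> R.rspan b d" "\<And>N. c N \<in> R.rspan b d"
    "\<And>N. s - (\<Sum>n<N. tt ^ n * y n) = tt ^ N * c N"
proof -
  have "\<forall>n. \<exists>r. y n = (\<Sum>k<d. ii (r k) * b k)"
  proof
    fix n
    obtain r where r: "\<And>k. r k \<in> R" "y n = (\<Sum>k<d. r k * b k)" using R.rspanE[OF assms] by metis
    have "\<forall>k. \<exists>f. r k = ii f" using r(1) RE by metis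
    then obtain f where "\<And>k. r k = ii (f k)" by metis
    thus "\<exists>r. y n = (\<Sum>k<d. ii (r k) * b k)" by (intro exI[of _ f]) (simp add: r(2))
  qed
  then obtain r where r: "\<And>n. y n = (\<Sum>k<d. ii (r n k) * b k)" by metis
  have "\<forall>k. \<exists>s c. \<forall>N. s - (\<Sum>n<N. fps_X ^ n * r n k) = fps_X ^ N * c N"
    using fps_series by metis
  then obtain s c where sc: "\<And>k N. s k - (\<Sum>n<N. fps_X ^ n * r n k) = fps_X ^ N * c k N" by metis
  show ?thesis
  proof (rule that)
    show "(\<Sum>k<d. ii (s k) * b k) \<in> R.rspan b d" "(\<Sum>k<d. ii (c k N) * b k) \<in> R.rspan b d" for N
      by (rule R.rspanI, simp)+
    fix N
    have "(\<Sum>n<N. tt ^ n * y n) = (\<Sum>k<d. \<Sum>n<N. tt ^ n * ii (r n k) * b k)"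
      by (simp add: r sum_distrib_left mult.assoc) (rule sum.swap)
    also have "\<dots> = (\<Sum>k<d. ii (\<Sum>n<N. fps_X ^ n * r n k) * b k)"
      by (simp add: ii_sum ii_mult ii_power sum_distrib_right)
    finally have "(\<Sum>k<d. ii (s k) * b k) - (\<Sum>n<N. tt ^ n * y n)
        = (\<Sum>k<d. ii (s k - (\<Sum>n<N. fps_X ^ n * r n k)) * b k)"
      by (simp add: ii_diff left_diff_distrib sum_subtractf)
    also have "\<dots> = tt ^ N * (\<Sum>k<d. ii (c k N) * b k)"
      by (simp add: sc ii_mult ii_power sum_distrib_left mult.assoc)
    finally show "(\<Sum>k<d. ii (s k) * b k) - (\<Sum>n<N. tt ^ n * y n) = tt ^ N * (\<Sum>k<d. ii (c k N) * b k)" .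
  qed
qed

lemma all_tt_powers_imp_0:
  assumes "\<And>N. \<exists>y\<in>A. x = tt ^ N * y"
  shows "x = 0"
proof (rule ccontr)
  assume x: "x \<noteq> 0"
  define N where "N = nat (val x + 1)"
  obtain y where y: "y \<in> A" "x = tt ^ N * y" using assms by blast
  have "y \<noteq> 0" using x y(2) by auto
  hence "val (tt ^ N * y) = int N * int (card G) + val y"
    using tt_nz by (simp add: val_mult val_power val_tt)
  hence "val x = int N * int (card G) + val y" by (simp only: y(2)[symmetric])
  moreover have "int N * 1 \<le> int N * int (card G)" using card_G_pos by (intro mult_left_mono) auto
  moreover have "val x < int N" by (simp add: N_def)
  ultimately show False using val_nonneg[OF y(1)] by linarith
qed

subsection \<open>Lifting idempotents\<close>

text \<open>B is a subring of \<open>A\<close> that is a finite module over \<open>R\<close>, so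
  that series in powers of t converge in it.\<close>

context
  fixes B :: "'l set" and b :: "nat \<Rightarrow> 'l" and d :: nat
  assumes B: "B = R.rspan b d" and B_mult: "\<And>x y. x \<in> B \<Longrightarrow> y \<in> B \<Longrightarrow> x * y \<in> B"
    and B_1: "1 \<in> B" and B_A: "B \<subseteq> A"
begin

lemma B_add: "x \<in> B \<Longrightarrow> y \<in> B \<Longrightarrow> x + y \<in> B"
  by (simp add: B R.rspan_add)

lemma B_scale: "x \<in> R \<Longrightarrow> y \<in> B \<Longrightarrow> x * y \<in> B"
  by (simp add: B R.rspan_scale)

lemma B_uminus: "x \<in> B \<Longrightarrow> - x \<in> B"
  using B_scale[of "- 1" x] R.uminus_closed[OF R.one_closed] by simp

lemma B_diff: "x \<in> B \<Longrightarrow> y \<in> B \<Longrightarrow> x - y \<in> B"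
  using B_add[of x "- y"] B_uminus by simp

lemma B_power: "x \<in> B \<Longrightarrow> x ^ n \<in> B"
  by (induction n) (auto simp: B_1 B_mult)

lemma B_sum: "(\<And>x. x \<in> S \<Longrightarrow> f x \<in> B) \<Longrightarrow> sum f S \<in> B"
  by (simp add: B R.rspan_sum)

text \<open>The powers \<open>e ^ (p ^ N)\<close> converge in \<open>B\<close> to an idempotent congruent to \<open>e\<close>; as \<open>L\<close> is a field,
  it is 0 or 1.\<close>

lemma idempotent_mod_tt:
  assumes e: "e \<in> B" and idem: "e * e - e = tt * y" "y \<in> B"
  shows "\<exists>z\<in>A. e = tt * z \<or> e = 1 + tt * z"
proof -
  have prime: "prime CHAR('l)" using prime_p char_l by simp
  have p2: "2 \<le> p" using prime_p prime_ge_2_nat by blast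
  have pN: "N < p ^ N" for N using p2 by (intro less_exp[THEN order.strict_trans2] power_mono) auto
  define f where "f N = e ^ (p ^ N)" for N
  obtain q where q: "p = Suc (Suc q)" using p2 by (metis add_2_eq_Suc le_Suc_ex)
  define u where "u = y * (\<Sum>i<Suc q. e ^ i)"
  have u: "u \<in> B" unfolding u_def using e idem(2) by (intro B_mult B_sum B_power)
  have "e ^ p - e = e * (e ^ Suc q - 1)" by (simp add: q algebra_simps)
  also have "\<dots> = (e * e - e) * (\<Sum>i<Suc q. e ^ i)"
    using power_diff_1_eq[of e "Suc q"] by (simp only:) (simp add: algebra_simps)
  finally have ep: "e ^ p - e = tt * u" by (simp only: idem(1) u_def mult.assoc)
  have fr: "(x + y) ^ (p ^ N) = x ^ (p ^ N) + y ^ (p ^ N)" for x y :: 'l and N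
    using freshmans_dream'[OF prime, of "p ^ N" N x y] char_l by simp
  have fdiff: "(x - y) ^ (p ^ N) = x ^ (p ^ N) - y ^ (p ^ N)" for x y :: 'l and N
    using fr[of "x - y" y N] by (simp add: algebra_simps)
  \<comment> \<open>By Frobenius, the difference of consecutive \<open>f N\<close> is the p^N-th
    power of \<open>tt * u\<close>. Only \<open>Suc N\<close> factors t are split off, which brings
    the limit into the form e plus t times a series with coefficients \<open>v n\<close>.\<close>
  define v where "v N = tt ^ (p ^ N - Suc N) * u ^ (p ^ N)" for N
  have v: "v N \<in> B" for N unfolding v_def using u by (intro B_scale R.power_closed B_power ii_in_R)
  have step: "f (Suc N) - f N = tt ^ Suc N * v N" for N
  proof -
    have "f (Suc N) - f N = (e ^ p - e) ^ (p ^ N)"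
      by (simp add: f_def fdiff flip: power_mult)
    also have "\<dots> = tt ^ (Suc N + (p ^ N - Suc N)) * u ^ (p ^ N)"
      using le_add_diff_inverse[OF Suc_leI[OF pN[of N]]] by (simp only: ep power_mult_distrib)
    finally show ?thesis by (simp only: v_def power_add mult.assoc)
  qed
  obtain s c where s: "s \<in> B" "\<And>N. c N \<in> B" "\<And>N. s - (\<Sum>n<N. tt ^ n * v n) = tt ^ N * c N"
    unfolding B by (rule rspan_series[of v b d]) (use v in \<open>auto simp: B\<close>)
  define E where "E = e + tt * s"
  have fN: "f N = e + tt * (\<Sum>n<N. tt ^ n * v n)" for N
  proof (induction N)
    case (Suc N)
    have "f (Suc N) = f N + tt ^ Suc N * v N" using step[of N] by (simp add: algebra_simps)
    thus ?case by (simp add: Suc algebra_simps)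
  qed (simp add: f_def)
  have Ef: "E = f N + tt ^ N * (tt * c N)" for N
  proof -
    have "E - f N = tt * (s - (\<Sum>n<N. tt ^ n * v n))" by (simp add: E_def fN algebra_simps)
    also have "\<dots> = tt ^ N * (tt * c N)" unfolding s(3) by (simp add: mult_ac)
    finally show ?thesis by (simp add: algebra_simps)
  qed
  have fB: "f N \<in> B" for N using e by (simp add: f_def B_power)
  \<comment> \<open>E agrees with \<open>f N\<close> up to a multiple of \<open>tt ^ N\<close>, and
    so does \<open>f N * f N\<close> with \<open>f N\<close>, being off by the p^N-th power of
    \<open>tt * y\<close>.\<close>
  have "E * E - E = 0"
  proof (rule all_tt_powers_imp_0)
    fix N
    have "f N * f N - f N = (e * e - e) ^ (p ^ N)"
      by (simp add: f_def fdiff power_mult_distrib)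
    also have "\<dots> = tt ^ (N + (p ^ N - N)) * y ^ (p ^ N)"
      using pN[of N] by (simp add: idem(1) power_mult_distrib)
    finally have ff: "f N * f N - f N = tt ^ N * (tt ^ (p ^ N - N) * y ^ (p ^ N))"
      by (simp only: power_add mult.assoc)
    let ?c = "tt * c N"
    have "E * E - E = (f N * f N - f N) + tt ^ N * (?c * (2 * f N + tt ^ N * ?c - 1))"
      unfolding Ef[of N] by (simp add: algebra_simps)
    also have "\<dots> = tt ^ N * (tt ^ (p ^ N - N) * y ^ (p ^ N) + ?c * (f N + f N + tt ^ N * ?c - 1))"
      unfolding ff by (simp add: algebra_simps)
    finally have "E * E - E = tt ^ N * (tt ^ (p ^ N - N) * y ^ (p ^ N) + ?c * (f N + f N + tt ^ N * ?c - 1))" .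
    moreover have "tt ^ (p ^ N - N) * y ^ (p ^ N) + ?c * (f N + f N + tt ^ N * ?c - 1) \<in> B"
      using idem(2) s(2) fB B_1
      by (intro B_add B_diff B_mult[of "tt * c N"]) (auto intro!: B_scale R.power_closed B_power)
    ultimately show "\<exists>z\<in>A. E * E - E = tt ^ N * z" using B_A by blast
  qed
  hence "E * (E - 1) = 0" by (simp add: algebra_simps)
  hence "E = 0 \<or> E = 1" by auto
  hence "e = tt * (- s) \<or> e = 1 + tt * (- s)" by (auto simp: E_def eq_neg_iff_add_eq_0 algebra_simps)
  thus ?thesis using B_uminus[OF s(1)] B_A by blast
qed

end

subsection \<open>Locality\<close>

lemma power_span_closed:
  assumes "a \<in> A" "x \<in> R.rspan (\<lambda>i. a ^ i) (card G)"
  shows "a * x \<in> R.rspan (\<lambda>i. a ^ i) (card G)"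
proof (rule R.rspan_mult_closed[OF _ assms(2)])
  fix k assume k: "k < card G"
  show "a * a ^ k \<in> R.rspan (\<lambda>i. a ^ i) (card G)"
  proof (cases "Suc k < card G")
    case True
    thus ?thesis using R.rspan_base[of "Suc k" "card G" "\<lambda>i. a ^ i"] by simp
  next
    case False
    hence "a * a ^ k = a ^ degree (charpoly a)" using k by (metis Suc_lessI degree_charpoly power_Suc)
    also have "\<dots> = (\<Sum>l<card G. - coeff (charpoly a) l * a ^ l)"
      using monic_root_power[OF lead_coeff_charpoly poly_charpoly_self] by (simp add: degree_charpoly)
    also have "\<dots> \<in> R.rspan (\<lambda>i. a ^ i) (card G)"
      using charpoly_in_Rpoly[OF assms(1)] by (intro R.rspanI R.uminus_closed R.Rpoly_coeff)
    finally show ?thesis .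
  qed
qed

text \<open>Otherwise the reduction \<open>f\<close> of the characteristic polynomial of \<open>a\<close> has the roots 0 and 1. Writing
  \<open>f = X ^ \<mu> * g\<close> with \<open>g\<close> proportional to \<open>1 - X h\<close>, the element \<open>e = (a h(a)) ^ \<mu>\<close> is idempotent
  modulo \<open>t\<close>, while \<open>e\<close> and \<open>1 - e\<close> are multiples of the non-units \<open>a\<close> and \<open>1 - a\<close>.\<close>

lemma not_both_nonunits:
  assumes a: "a \<in> mm" and a1: "1 - a \<in> mm"
  shows False
proof -
  have aA: "a \<in> A" using a mm_A by blast
  define B where "B = R.rspan (\<lambda>i. a ^ i) (card G)"
  have B_a: "a * x \<in> B" if "x \<in> B" for x using power_span_closed[OF aA] that by (simp add: B_def)
  have B_add: "x + y \<in> B" if "x \<in> B" "y \<in> B" for x y using that by (simp add: B_def R.rspan_add)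
  have B_scale: "x * y \<in> B" if "x \<in> R" "y \<in> B" for x y using that by (simp add: B_def R.rspan_scale)
  have B_1: "1 \<in> B" using R.rspan_base[of 0 "card G" "\<lambda>i. a ^ i"] card_G_pos by (simp add: B_def)
  have B_pow: "a ^ n * x \<in> B" if "x \<in> B" for n x
    using that by (induction n) (auto simp: B_a mult.assoc)
  have B_mult: "x * y \<in> B" if "x \<in> B" "y \<in> B" for x y
  proof -
    obtain r where r: "\<And>k. r k \<in> R" "x = (\<Sum>k<card G. r k * a ^ k)"
      using \<open>x \<in> B\<close> unfolding B_def by (rule R.rspanE) blast
    have "x * y = (\<Sum>k<card G. r k * (a ^ k * y))" by (simp add: r(2) sum_distrib_right mult.assoc)
    moreover have "r k * (a ^ k * y) \<in> B" for k by (rule B_scale[OF r(1) B_pow[OF that(2)]])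
    hence "(\<Sum>k<card G. r k * (a ^ k * y)) \<in> B" unfolding B_def by (intro R.rspan_sum)
    ultimately show ?thesis by simp
  qed
  have B_A: "B \<subseteq> A"
  proof
    fix x assume "x \<in> B"
    then obtain r where r: "\<And>k. r k \<in> R" "x = (\<Sum>k<card G. r k * a ^ k)"
      unfolding B_def by (rule R.rspanE) blast
    show "x \<in> A" unfolding r(2)
      using r(1) aA by (intro A.sum_closed A.mult_closed[OF R_subset_A A.power_closed])
  qed
  have kR: "kk c \<in> R" for c by (simp add: kk_def)
  define ev where "ev f = poly (map_poly kk f) a" for f :: "'k poly"
  have ev_mult: "ev (f * g) = ev f * ev g" for f g by (simp add: ev_def emb_map_poly_mult[OF emb_kk])
  have ev_pCons: "ev (pCons c f) = kk c + a * ev f" for c f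
    by (simp add: ev_def Polynomial.map_poly_pCons[of kk, OF emb_0[OF emb_kk]])
  have ev_0: "ev 0 = 0" by (simp add: ev_def)
  have ev_B: "ev f \<in> B" for f
  proof (induction f)
    case 0
    show ?case by (simp add: ev_0 B_def R.rspan_0)
  next
    case (pCons c f)
    have "kk c * 1 \<in> B" by (rule B_scale[OF kR B_1])
    thus ?case using pCons B_a B_add by (simp add: ev_pCons)
  qed
  obtain f :: "'k poly" where f: "f \<noteq> 0" "\<And>c. poly f c = 0 \<longleftrightarrow> kk c - a \<in> mm"
    "\<exists>b\<in>B. ev f = tt * b"
    unfolding B_def ev_def by (rule reduced_charpoly[OF aA]) (rule that, auto simp: B_def ev_def)
  have f0: "poly f 0 = 0" using f(2)[of 0] mm_uminus[OF a] by (simp add: emb_0[OF emb_kk])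
  have f1: "poly f 1 = 0" using f(2)[of 1] a1 by (simp add: emb_1[OF emb_kk])
  obtain g where g: "f = [:- 0, 1:] ^ Polynomial.order 0 f * g" "\<not> [:- 0, 1:] dvd g"
    using order_decomp[OF f(1), of 0] by blast
  define \<mu> where "\<mu> = Polynomial.order 0 f"
  have mu: "\<mu> \<noteq> 0" using f0 f(1) by (simp add: \<mu>_def order_root)
  define u where "u = poly g 0"
  have u: "u \<noteq> 0" using g(2) by (simp add: u_def poly_eq_0_iff_dvd)
  have "poly f 1 = poly g 1" by (subst g(1)) (simp add: poly_power)
  hence g1: "poly g 1 = 0" using f1 by simp
  obtain h where h: "g = [:- 1, 1:] * h" using g1 by (auto simp: poly_eq_0_iff_dvd)
  obtain g' where g': "g = pCons u g'" by (cases g) (simp add: u_def)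
  \<comment> \<open>From g = u + X g', this is the value of - X g' / u at a, so that
    \<open>1 - \<alpha>\<close> is g(a) / u. It is the element a h(a) of the remark above the lemma;
    \<open>h\<close> in the code is instead the cofactor of X - 1 in g.\<close>
  define \<alpha> where "\<alpha> = - (a * (kk (inverse u) * ev g'))"
  have ku: "kk u * kk (inverse u) = 1"
    using u by (simp flip: emb_mult[OF emb_kk] add: emb_1[OF emb_kk])
  have alpha: "1 - \<alpha> = kk (inverse u) * ev g"
    using ku by (simp add: \<alpha>_def g' ev_pCons algebra_simps)
  have evg: "ev g = (a - 1) * ev h"
    unfolding h ev_mult by (simp add: ev_pCons ev_0 emb_1[OF emb_kk] emb_uminus[OF emb_kk])
  have alpha_B: "\<alpha> \<in> B"
  proof -
    have "- 1 * (a * (kk (inverse u) * ev g')) \<in> B"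
      using R.uminus_closed[OF R.one_closed] by (intro B_scale B_a kR ev_B)
    thus ?thesis by (simp add: \<alpha>_def)
  qed
  have B_power: "x ^ n \<in> B" if "x \<in> B" for x n using that by (induction n) (auto simp: B_1 B_mult)
  define S where "S = (\<Sum>j<\<mu>. \<alpha> ^ j)"
  have S: "S \<in> B" using B_power[OF alpha_B] unfolding S_def B_def by (intro R.rspan_sum)
  have mR: "- 1 \<in> R" using R.uminus_closed[OF R.one_closed] .
  define e where "e = \<alpha> ^ \<mu>"
  have e1: "1 - e = (1 - \<alpha>) * S" using one_diff_power_eq[of \<alpha> \<mu>] by (simp add: e_def S_def)
  have evf: "ev f = a ^ \<mu> * ev g"
  proof -
    have "ev ([:- 0, 1:] ^ n) = a ^ n" for n
      by (induction n) (simp_all add: ev_mult ev_pCons ev_0 emb_0[OF emb_kk] emb_1[OF emb_kk] one_pCons)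
    thus ?thesis by (subst g(1)) (simp add: ev_mult \<mu>_def)
  qed
  obtain b where b: "b \<in> B" "ev f = tt * b" using f(3) by blast
  \<comment> \<open>The factors of \<open>e * (1 - e)\<close> left after splitting off f(a), which
    is the product of \<open>a ^ \<mu>\<close> and g(a) and is divisible by t.\<close>
  define k where "k = (- kk (inverse u) * ev g') ^ \<mu> * (kk (inverse u) * S)"
  have "- kk (inverse u) * ev g' \<in> B" by (rule B_scale[OF R.uminus_closed[OF kR] ev_B])
  hence kB: "k \<in> B" unfolding k_def by (rule B_mult[OF B_power B_scale[OF kR S]])
  have "e = a ^ \<mu> * (- kk (inverse u) * ev g') ^ \<mu>"
    by (simp add: e_def \<alpha>_def flip: power_mult_distrib)
  hence "e * (1 - e) = ev f * k" unfolding e1 alpha evf k_def by (simp add: mult_ac)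
  hence "e * e - e = tt * (- 1 * (b * k))" by (simp add: b(2) algebra_simps)
  moreover have "- 1 * (b * k) \<in> B"
    by (rule B_scale[OF mR B_mult[OF b(1) kB]])
  ultimately obtain z where z: "z \<in> A" "e = tt * z \<or> e = 1 + tt * z"
    using idempotent_mod_tt[OF B_def B_mult B_1 B_A B_power[OF alpha_B, of \<mu>], folded e_def] by blast
  have "e \<in> mm"
  proof -
    obtain m where m: "\<mu> = Suc m" using mu not0_implies_Suc by blast
    have "e = a * (- 1 * (kk (inverse u) * ev g') * \<alpha> ^ m)"
      by (simp add: e_def m \<alpha>_def mult_ac)
    moreover have "- 1 * (kk (inverse u) * ev g') * \<alpha> ^ m \<in> B"
      by (rule B_mult[OF B_scale[OF mR B_scale[OF kR ev_B]] B_power[OF alpha_B]])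
    ultimately show ?thesis using mm_mult[OF a] subsetD[OF B_A] by metis
  qed
  moreover have "1 - e \<in> mm"
  proof -
    have "1 - e = (1 - a) * (- 1 * (kk (inverse u) * (ev h * S)))"
      by (simp add: e1 alpha evg algebra_simps)
    moreover have "- 1 * (kk (inverse u) * (ev h * S)) \<in> B"
      by (rule B_scale[OF mR B_scale[OF kR B_mult[OF ev_B S]]])
    ultimately show ?thesis using mm_mult[OF a1] subsetD[OF B_A] by metis
  qed
  \<comment> \<open>These exclude both outcomes for e: the first would put \<open>1 - tt * z\<close>
    into \<open>mm\<close>, the second \<open>- (1 + tt * z)\<close> up to sign.\<close>
  moreover have "1 - tt * z \<notin> mm" "1 - tt * (- z) \<notin> mm"
    using z(1) one_minus_tt_not_mm A.uminus_closed by blast+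
  ultimately show False using z(2) by auto
qed

lemma mm_add:
  assumes "x \<in> mm" "y \<in> mm"
  shows "x + y \<in> mm"
proof (rule ccontr)
  assume n: "x + y \<notin> mm"
  have "x + y \<in> A" using assms mm_A A.add_closed by blast
  from not_mm_inverse[OF this n] have u: "x + y \<noteq> 0" "inverse (x + y) \<in> A" by auto
  have "x * inverse (x + y) \<in> mm" "y * inverse (x + y) \<in> mm" using assms u(2) mm_mult by auto
  moreover have "1 - x * inverse (x + y) = y * inverse (x + y)" using u(1) by (simp add: field_simps)
  ultimately show False using not_both_nonunits by metis
qed

lemma mm_diff: "x \<in> mm \<Longrightarrow> y \<in> mm \<Longrightarrow> x - y \<in> mm"
  using mm_add[of x "- y"] mm_uminus by simp

subsection \<open>The discrete valuation\<close>

text \<open>The product \<open>b\<close> of the leading coefficient with \<open>z\<close> is integral over \<open>A\<close>, hence in \<open>A\<close>. If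
  neither the leading coefficient nor \<open>b\<close> is a unit, absorbing \<open>b\<close> in the next coefficient
  lowers the degree and keeps a unit coefficient, as \<open>A\<close> is local.\<close>

lemma val_ring_criterion:
  fixes c :: "nat \<Rightarrow> 'l"
  assumes "\<And>i. i \<le> n \<Longrightarrow> c i \<in> A" "(\<Sum>i\<le>n. c i * z ^ i) = 0" "i0 \<le> n" "c i0 \<notin> mm"
  shows "z \<in> A \<or> inverse z \<in> A"
  using assms
proof (induction n arbitrary: c i0)
  case 0
  thus ?case using zero_mm by auto
next
  case (Suc n)
  define b where "b = c (Suc n) * z"
  have bA: "b \<in> A"
  proof (rule A_integrally_closed)
    \<comment> \<open>The relation multiplied by \<open>c (Suc n) ^ n\<close>, rewritten as a monic
      equation for b.\<close>
    define f where "f = monom 1 (Suc n) + (\<Sum>i\<le>n. monom (c i * c (Suc n) ^ (n - i)) i)"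
    have coeff: "coeff f j = (if j = Suc n then 1 else if j \<le> n then c j * c (Suc n) ^ (n - j) else 0)" for j
      by (auto simp: f_def coeff_sum)
    show "f \<in> A.Rpoly" unfolding A.Rpoly_def
      using Suc.prems(1) A.zero_closed A.one_closed
      by (auto simp: coeff intro!: A.mult_closed A.power_closed)
    have "degree f = Suc n" by (intro antisym degree_le le_degree) (auto simp: coeff)
    thus "lead_coeff f = 1" by (simp add: coeff)
    have "poly f b = b ^ Suc n + (\<Sum>i\<le>n. c i * c (Suc n) ^ (n - i) * b ^ i)"
      by (simp add: f_def poly_sum poly_monom)
    also have "(\<Sum>i\<le>n. c i * c (Suc n) ^ (n - i) * b ^ i) = (\<Sum>i\<le>n. c (Suc n) ^ n * (c i * z ^ i))"
    proof (intro sum.cong refl)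
      fix i assume "i \<in> {..n}"
      hence "c (Suc n) ^ n = c (Suc n) ^ (n - i) * c (Suc n) ^ i" by (simp flip: power_add)
      thus "c i * c (Suc n) ^ (n - i) * b ^ i = c (Suc n) ^ n * (c i * z ^ i)"
        by (simp add: b_def power_mult_distrib mult_ac)
    qed
    also have "b ^ Suc n + (\<Sum>i\<le>n. c (Suc n) ^ n * (c i * z ^ i)) = c (Suc n) ^ n * (\<Sum>i\<le>Suc n. c i * z ^ i)"
      by (simp add: b_def power_mult_distrib sum_distrib_left algebra_simps)
    finally show "poly f b = 0" using Suc.prems(2) by simp
  qed
  have cA: "c (Suc n) \<in> A" using Suc.prems(1) by simp
  consider "c (Suc n) \<notin> mm" | "b \<notin> mm" | "c (Suc n) \<in> mm" "b \<in> mm" by blast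
  thus ?case
  proof cases
    case 1
    from not_mm_inverse[OF cA 1] have "c (Suc n) \<noteq> 0" "inverse (c (Suc n)) \<in> A" by auto
    moreover from this have "z = inverse (c (Suc n)) * b" by (simp add: b_def)
    ultimately show ?thesis using bA A.mult_closed by metis
  next
    case 2
    from not_mm_inverse[OF bA 2] have "b \<noteq> 0" "inverse b \<in> A" by auto
    moreover from this have "inverse z = c (Suc n) * inverse b" by (auto simp: b_def)
    ultimately show ?thesis using cA A.mult_closed by metis
  next
    case 3
    define c' where "c' = c(n := c n + b)"
    have "(\<Sum>i\<le>n. c' i * z ^ i) = (\<Sum>i<n. c i * z ^ i) + (c n + b) * z ^ n"
      by (simp add: c'_def flip: lessThan_Suc_atMost)
    also have "\<dots> = (\<Sum>i\<le>Suc n. c i * z ^ i)"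
      by (simp add: b_def algebra_simps flip: lessThan_Suc_atMost)
    finally have "(\<Sum>i\<le>n. c' i * z ^ i) = 0" using Suc.prems(2) by simp
    moreover have "c' i \<in> A" if "i \<le> n" for i
      using that Suc.prems(1) bA A.add_closed by (simp add: c'_def)
    moreover have i0: "i0 \<le> n" using Suc.prems(3,4) 3 by (metis le_SucE)
    moreover have "c' i0 \<notin> mm"
      using Suc.prems(4) mm_diff[of "c n + b" b] 3(2) by (auto simp: c'_def)
    ultimately show ?thesis using Suc.IH by blast
  qed
qed

text \<open>Dividing the characteristic polynomial of z by the power of t given by the least order M
  of its coefficients makes all of them integral and at least one a unit.\<close>

lemma A_or_inverse: "z \<in> A \<or> inverse z \<in> A"
proof -
  let ?g = "card G"
  have "\<forall>i. \<exists>k. coeff (charpoly z) i = \<iota> k" using charpoly_in_range by blast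
  then obtain k where k: "\<And>i. coeff (charpoly z) i = \<iota> (k i)" by metis
  have kg: "k ?g = 1" using k[of ?g] lead_coeff_charpoly[of z] emb_eq_iff[OF emb_iota, of "k ?g" 1]
    by (simp add: degree_charpoly emb_1[OF emb_iota])
  define I where "I = {i. i \<le> ?g \<and> k i \<noteq> 0}"
  have I: "finite I" "I \<noteq> {}" using kg by (auto simp: I_def)
  define M where "M = Min ((\<lambda>i. fls_subdegree (k i)) ` I)"
  have "M \<in> (\<lambda>i. fls_subdegree (k i)) ` I" unfolding M_def using I by (intro Min_in) auto
  then obtain i0 where i0: "i0 \<le> ?g" "k i0 \<noteq> 0" "fls_subdegree (k i0) = M" by (auto simp: I_def)
  have M: "M \<le> fls_subdegree (k i)" if "i \<le> ?g" "k i \<noteq> 0" for i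
    unfolding M_def using that I by (intro Min_le) (auto simp: I_def)
  define c where "c i = \<iota> (fls_shift M (k i))" for i
  have c: "c i = \<iota> (fls_X_intpow (- M)) * coeff (charpoly z) i" for i
  proof -
    have "fls_shift M (k i) = fls_X_intpow (- M) * k i"
      unfolding fls_X_intpow_times_conv_shift by simp
    thus ?thesis by (simp only: c_def k emb_mult[OF emb_iota])
  qed
  have "c i \<in> A" if "i \<le> ?g" for i
    using M[OF that] unfolding c_def
    by (intro R_subset_A, subst iota_in_R_iff) (cases "k i = 0", auto)
  moreover have "(\<Sum>i\<le>?g. c i * z ^ i) = \<iota> (fls_X_intpow (- M)) * poly (charpoly z) z"
    by (simp add: c poly_altdef degree_charpoly sum_distrib_left mult.assoc)
  hence "(\<Sum>i\<le>?g. c i * z ^ i) = 0" by (simp add: poly_charpoly_self)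
  moreover have "c i0 \<notin> mm"
    using iota_in_mm_imp[of "fls_shift M (k i0)"] i0(2,3) fls_shift_eq0_iff[of M "k i0"]
    by (auto simp: c_def)
  ultimately show ?thesis using val_ring_criterion[of ?g c z i0] i0(1) by blast
qed

text \<open>If x has nonnegative value but only its inverse is known to be integral, that inverse
  has value 0 and is therefore a unit of \<open>A\<close>.\<close>

lemma A_iff_val: "x \<in> A \<longleftrightarrow> x = 0 \<or> 0 \<le> val x"
proof
  assume "x = 0 \<or> 0 \<le> val x"
  thus "x \<in> A"
  proof
    assume v: "0 \<le> val x"
    show "x \<in> A"
    proof (cases "inverse x \<in> A \<and> x \<noteq> 0")
      case True
      hence "val (inverse x) = 0" using val_nonneg[of "inverse x"] v val_inverse[of x] by simp
      thus ?thesis using unit_in_A[of "inverse x"] True by simp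
    next
      case False
      thus ?thesis using A_or_inverse[of x] A.zero_closed by auto
    qed
  qed (simp add: A.zero_closed)
qed (use val_nonneg in auto)

lemma val_add:
  assumes "x \<noteq> 0" "y \<noteq> 0" "x + y \<noteq> 0"
  shows "min (val x) (val y) \<le> val (x + y)"
proof -
  have *: "val u \<le> val (u + v)" if "u \<noteq> 0" "u + v \<noteq> 0" "v / u \<in> A" for u v
  proof -
    have "u + v = u * (1 + v / u)" using that by (simp add: field_simps)
    moreover from this have "1 + v / u \<noteq> 0" using that by auto
    moreover have "0 \<le> val (1 + v / u)" using that A.one_closed A.add_closed val_nonneg by blast
    ultimately show ?thesis using val_mult[of u "1 + v / u"] that(1) by simp
  qed
  have "y / x \<in> A \<or> x / y \<in> A" using A_or_inverse[of "y / x"] by simp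
  thus ?thesis using *[of x y] *[of y x] assms by (auto simp: add.commute)
qed

section \<open>Normalizing the valuation\<close>

definition ram_index :: int where
  "ram_index = int (LEAST n. 0 < n \<and> (\<exists>x. x \<noteq> 0 \<and> val x = int n))"

lemma ram_index:
  shows ram_index_pos: "0 < ram_index"
    and ram_index_attained: "\<exists>x. x \<noteq> 0 \<and> val x = ram_index"
    and ram_index_le: "x \<noteq> 0 \<Longrightarrow> 0 < val x \<Longrightarrow> ram_index \<le> val x"
proof -
  let ?P = "\<lambda>n. 0 < n \<and> (\<exists>x. x \<noteq> 0 \<and> val x = int n)"
  have "?P (card G)" using card_G_pos tt_nz val_tt by blast
  hence "?P (Least ?P)" by (rule LeastI)
  thus "0 < ram_index" "\<exists>x. x \<noteq> 0 \<and> val x = ram_index" by (auto simp: ram_index_def)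
  show "ram_index \<le> val x" if "x \<noteq> 0" "0 < val x"
  proof -
    have "?P (nat (val x))" using that by auto
    from Least_le[of ?P, OF this] show ?thesis using that(2) by (simp add: ram_index_def)
  qed
qed

text \<open>\<open>ram_index\<close> is the positive generator of the value group of
  \<open>val\<close>, that is, the factor by which \<open>val\<close> must be divided, and not the
  ramification index of L over k((t)). Division with remainder by it would otherwise give a smaller
  positive value.\<close>

lemma ram_index_dvd:
  assumes "x \<noteq> 0"
  shows "ram_index dvd val x"
proof (rule ccontr)
  assume n: "\<not> ram_index dvd val x"
  obtain u where u: "u \<noteq> 0" "val u = ram_index" using ram_index_attained by blast
  have vp: "val (u powi k) = k * ram_index" for k
    using u val_power[of u] val_power[of "inverse u"] val_inverse[of u] by (cases k) (auto simp: power_int_def algebra_simps)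
  define q where "q = val x div ram_index"
  define y where "y = x * u powi (- q)"
  have y: "y \<noteq> 0" using assms u by (simp add: y_def)
  have "val y = val x - q * ram_index" using assms u by (simp add: y_def val_mult vp)
  hence "val y = val x mod ram_index" by (simp add: q_def minus_div_mult_eq_mod)
  moreover have "0 < val x mod ram_index" "val x mod ram_index < ram_index"
    using n ram_index_pos pos_mod_sign[OF ram_index_pos, of "val x"] by (auto simp: dvd_eq_mod_eq_0 order_le_less)
  ultimately show False using ram_index_le[OF y] by simp
qed

definition nval :: "'l \<Rightarrow> int" where
  "nval x = val x div ram_index"

lemma val_eq_nval: "x \<noteq> 0 \<Longrightarrow> val x = nval x * ram_index"
  using ram_index_dvd by (simp add: nval_def)

definition unif :: 'l where
  "unif = (SOME x. x \<noteq> 0 \<and> val x = ram_index)"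

lemma unif: "unif \<noteq> 0" "val unif = ram_index"
  using someI_ex[OF ram_index_attained] by (auto simp: unif_def)

sublocale L: discretely_valued_field nval kk unif
proof
  show "nval (x * y) = nval x + nval y" if "x \<noteq> 0" "y \<noteq> 0" for x y
    using that ram_index_dvd by (simp add: nval_def val_mult div_plus_div_distrib_dvd_left)
  show "min (nval x) (nval y) \<le> nval (x + y)" if "x \<noteq> 0" "y \<noteq> 0" "x + y \<noteq> 0" for x y
  proof -
    have "val x \<le> val (x + y) \<or> val y \<le> val (x + y)" using val_add[OF that] by linarith
    hence "nval x \<le> nval (x + y) \<or> nval y \<le> nval (x + y)"
      using zdiv_mono1 ram_index_pos unfolding nval_def by blast
    thus ?thesis by auto
  qed
  show "field_embedding kk" by (rule emb_kk)
  show "nval (kk c) = 0" if "c \<noteq> 0" for c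
    using that val_iota[of "fps_to_fls (fps_const c)"]
    by (simp add: kk_def ii_def nval_def fls_subdegree_fls_to_fps)
  show "unif \<noteq> 0" "nval unif = 1" using unif ram_index_pos by (auto simp: nval_def)
  show "\<exists>c. x = kk c \<or> 0 < nval (x - kk c)" if "x \<noteq> 0" "0 \<le> nval x" for x
  proof -
    have "0 \<le> val x" using val_eq_nval[OF that(1)] mult_nonneg_nonneg[OF that(2), of ram_index] ram_index_pos
      by linarith
    hence "x \<in> A" using A_iff_val[of x] by simp
    from residue_exists[OF this] obtain c where c: "x - kk c \<in> mm" ..
    show ?thesis
    proof (cases "x = kk c")
      case False
      hence "x - kk c \<noteq> 0" by simp
      hence "0 < nval (x - kk c) * ram_index" using c val_eq_nval[of "x - kk c"] by (simp add: mm_def)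
      thus ?thesis using ram_index_pos by (auto simp: zero_less_mult_iff)
    qed auto
  qed
qed

lemma A_eq_fil: "A = L.fil 0"
proof -
  have "0 \<le> val x \<longleftrightarrow> 0 \<le> nval x" if "x \<noteq> 0" for x
    using val_eq_nval[OF that] ram_index_pos by (simp add: zero_le_mult_iff)
  thus ?thesis unfolding L.fil_def using A_iff_val by auto
qed

lemma mm_eq_fil: "mm = L.fil 1"
proof -
  have "0 < val x \<longleftrightarrow> 1 \<le> nval x" if "x \<noteq> 0" for x
    using val_eq_nval[OF that] ram_index_pos by (auto simp: zero_less_mult_iff)
  moreover have "x \<in> mm \<longleftrightarrow> x = 0 \<or> 0 < val x" for x
    using A_iff_val[of x] by (auto simp: mm_def)
  ultimately have "x \<in> mm \<longleftrightarrow> x \<in> L.fil 1" for x by (auto simp: L.fil_def)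
  thus ?thesis by blast
qed

text \<open>The maximal ideal is generated by \<open>unif\<close>, so every element of its power is
  a single product; sums of products stay in \<open>fil\<close>.\<close>

lemma ideal_power_eq_fil: "ideal_power A (nonunits A) j = L.fil (int j)"
proof (induction j)
  case 0
  show ?case by (simp add: A_eq_fil)
next
  case (Suc j)
  show ?case
  proof (intro equalityI subsetI)
    fix x assume "x \<in> ideal_power A (nonunits A) (Suc j)"
    then obtain zs where zs: "set zs \<subseteq> mm \<times> L.fil (int j)" "x = (\<Sum>(x, y)\<leftarrow>zs. x * y)"
      unfolding ideal_power.simps unfolding Suc unfolding nonunits_eq by blast
    have "(\<Sum>(x, y)\<leftarrow>zs. x * y) \<in> L.fil (int (Suc j))" using zs(1)
    proof (induction zs)
      case (Cons z zs)
      obtain u v where z: "z = (u, v)" by force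
      have "u * v \<in> L.fil (1 + int j)" using Cons.prems by (intro L.fil_mult) (auto simp: z mm_eq_fil)
      thus ?case using Cons L.fil_add by (simp add: z)
    qed simp
    thus "x \<in> L.fil (int (Suc j))" by (simp add: zs(2))
  next
    fix x assume x: "x \<in> L.fil (int (Suc j))"
    have "x / unif \<in> L.fil (int j)"
      using x L.fil_divide_iff[OF L.pi_nz, of x "int j"] by (simp add: L.w_pi)
    moreover have "unif \<in> mm" using L.fil_self[of unif] by (simp add: mm_eq_fil L.w_pi)
    ultimately have "x = (\<Sum>(x, y)\<leftarrow>[(unif, x / unif)]. x * y)" "set [(unif, x / unif)] \<subseteq> mm \<times> L.fil (int j)"
      using L.pi_nz by auto
    thus "x \<in> ideal_power A (nonunits A) (Suc j)"
      unfolding ideal_power.simps unfolding Suc unfolding nonunits_eq by blast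
  qed
qed

lemma G_valued_auts: "\<sigma> \<in> G \<Longrightarrow> \<sigma> \<in> L.valued_auts"
  by (simp add: L.valued_auts_def emb_G G_kk nval_def val_G)

end

section \<open>Cyclic-by-tame Galois groups\<close>

locale wild_tame_galois = fls_galois \<iota> G p
  for \<iota> :: "'k::alg_closed_field fls \<Rightarrow> 'l::field" and G :: "('l \<Rightarrow> 'l) set" and p :: nat +
  fixes s \<gamma> \<gamma>' :: "'l \<Rightarrow> 'l" and n m a :: nat
  assumes G_carrier: "G = carrier (gal_group (range \<iota>))"
    and n_pos: "0 < n" and m: "\<not> p dvd m"
    and s_G: "s \<in> G" and gamma_G: "\<gamma> \<in> G" and gamma'_G: "\<gamma>' \<in> G"
    and gamma_inv: "\<gamma> \<circ> \<gamma>' = id" "\<gamma>' \<circ> \<gamma> = id"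
    and s_order: "s ^^ b = id \<longleftrightarrow> p ^ n dvd b"
    and gamma_order: "\<gamma> ^^ b = id \<longleftrightarrow> m dvd b"
    and s_conj: "\<gamma> \<circ> s \<circ> \<gamma>' = s ^^ a"
    and G_eq: "\<sigma> \<in> G \<Longrightarrow> \<exists>b c. \<sigma> = s ^^ b \<circ> \<gamma> ^^ c"
begin

lemma s_aut: "s \<in> L.valued_auts" and gamma_aut: "\<gamma> \<in> L.valued_auts" and gamma'_aut: "\<gamma>' \<in> L.valued_auts"
  using G_valued_auts s_G gamma_G gamma'_G by auto

lemma k_of_nat_eq_0_iff: "(of_nat b :: 'k) = 0 \<longleftrightarrow> p dvd b"
  using of_nat_eq_0_iff_char_dvd[where 'a = 'k] char_p by simp

lemma k_root_of_unity:
  assumes "(c :: 'k) ^ (p ^ n) = 1"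
  shows "c = 1"
proof -
  have "(c - 1 + 1) ^ (p ^ n) = (c - 1) ^ (p ^ n) + 1 ^ (p ^ n)"
    by (rule freshmans_dream'[of "p ^ n" n]) (auto simp: char_p prime_p)
  hence "(c - 1) ^ (p ^ n) = 0" using assms by simp
  thus ?thesis by simp
qed

text \<open>The tame character sends s to a p^n-th root of unity in k, and in characteristic p the
  only one is 1.\<close>

lemma s_wild: "s unif - unif \<in> L.fil 2"
proof -
  obtain c where c: "s unif - kk c * unif \<in> L.fil 2" using L.tame_exists[OF s_aut] by blast
  have "s ^^ (p ^ n) = id" by (simp add: s_order)
  hence "unif - kk (c ^ (p ^ n)) * unif \<in> L.fil 2"
    using L.tame_funpow[OF s_aut c, of "p ^ n"] by simp
  moreover have "unif - kk 1 * unif \<in> L.fil 2" by (simp add: emb_1[OF emb_kk])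
  ultimately have "c ^ (p ^ n) = 1" by (rule L.tame_unique)
  hence "c = 1" by (rule k_root_of_unity)
  thus ?thesis using c by (simp add: emb_1[OF emb_kk])
qed

sublocale W: wild_automorphism nval kk unif s p
  by unfold_locales (use prime_p char_p s_aut s_wild in auto)

definition \<zeta> :: 'k where
  "\<zeta> = (SOME c. \<gamma> unif - kk c * unif \<in> L.fil 2)"

lemma zeta: "\<gamma> unif - kk \<zeta> * unif \<in> L.fil 2"
  unfolding \<zeta>_def using someI_ex[OF L.tame_exists[OF gamma_aut]] .

text \<open>If \<open>\<zeta> ^ r = 1\<close>, then \<open>\<gamma> ^^ r\<close> is wild. A
  nontrivial wild automorphism keeps its depth under the m-th power, as m is nonzero in k; but this
  m-th power is the identity.\<close>

lemma zeta_order: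
  assumes "\<zeta> ^ r = 1"
  shows "m dvd r"
proof -
  define \<tau> where "\<tau> = \<gamma> ^^ r"
  have t: "\<tau> \<in> L.valued_auts" unfolding \<tau>_def using gamma_aut by (rule L.aut_funpow)
  have wild: "\<tau> unif - unif \<in> L.fil (1 + 1)"
    using L.tame_funpow[OF gamma_aut zeta, of r] assms by (simp add: \<tau>_def emb_1[OF emb_kk])
  have "\<tau> = id"
  proof (rule ccontr)
    assume ne: "\<tau> \<noteq> id"
    have "1 \<le> L.depth \<tau>" using L.depth_ge_iff[OF t ne] wild by blast
    hence "\<tau> ^^ m \<noteq> id" using L.depth_funpow_unit[OF t ne, of m] m by (simp add: k_of_nat_eq_0_iff)
    moreover have "\<tau> ^^ m = id" unfolding \<tau>_def funpow_mult by (simp add: gamma_order)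
    ultimately show False by simp
  qed
  thus ?thesis by (simp add: \<tau>_def gamma_order)
qed

lemma zeta_nz: "\<zeta> \<noteq> 0"
proof
  assume z: "\<zeta> = 0"
  have "m \<noteq> 0" using m by (metis dvd_0_right)
  have "\<gamma> ^^ m = id" by (simp add: gamma_order)
  hence "unif - kk (\<zeta> ^ m) * unif \<in> L.fil 2" using L.tame_funpow[OF gamma_aut zeta, of m] by simp
  hence "unif \<in> L.fil 2" using z \<open>m \<noteq> 0\<close> by (simp add: emb_0[OF emb_kk] power_0_left)
  thus False by (simp add: L.fil_def L.pi_nz L.w_pi)
qed

lemma conj_funpow: "\<gamma> \<circ> s ^^ b \<circ> \<gamma>' = (s ^^ b) ^^ a"
proof -
  have "\<gamma> \<circ> s ^^ b \<circ> \<gamma>' = (\<gamma> \<circ> s \<circ> \<gamma>') ^^ b"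
  proof (induction b)
    case 0
    show ?case using gamma_inv by simp
  next
    case (Suc b)
    have "\<gamma> \<circ> s ^^ Suc b \<circ> \<gamma>' = \<gamma> \<circ> s \<circ> (\<gamma>' \<circ> \<gamma>) \<circ> s ^^ b \<circ> \<gamma>'"
      by (simp add: gamma_inv comp_assoc)
    also have "\<dots> = (\<gamma> \<circ> s \<circ> \<gamma>') \<circ> (\<gamma> \<circ> s ^^ b \<circ> \<gamma>')" by (simp only: comp_assoc)
    finally show ?case by (simp only: Suc funpow.simps)
  qed
  thus ?thesis by (simp add: s_conj funpow_mult mult.commute)
qed

lemma zeta_power_depth:
  assumes "s ^^ b \<noteq> id"
  shows "\<zeta> ^ nat (L.depth (s ^^ b)) = of_nat a"
proof -
  let ?\<sigma> = "s ^^ b"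
  have sig: "?\<sigma> \<in> L.valued_auts" using s_aut by (rule L.aut_funpow)
  define i where "i = nat (L.depth ?\<sigma>)"
  have i: "L.depth ?\<sigma> = int i" "1 \<le> i" using W.depth_ge_1[OF assms] by (auto simp: i_def)
  obtain c where c: "c \<noteq> 0" "L.lead i ?\<sigma> c" using L.lead_depth[OF sig assms i(1)] by blast
  have "L.lead i (\<gamma> \<circ> ?\<sigma> \<circ> \<gamma>') (\<zeta> ^ i * c)"
    using c(2) i(2) gamma_aut gamma'_aut gamma_inv(1) zeta by (rule L.lead_conj)
  hence "L.lead i (?\<sigma> ^^ a) (\<zeta> ^ i * c)" by (simp only: conj_funpow)
  moreover have "L.lead i (?\<sigma> ^^ a) (of_nat a * c)" using c(2) i(2) by (rule L.lead_funpow)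
  ultimately have "\<zeta> ^ i * c = of_nat a * c" by (rule L.lead_unique)
  thus ?thesis using c(1) by (simp add: i_def)
qed

lemma depth_cong:
  assumes "s ^^ b \<noteq> id" "s ^^ c \<noteq> id"
  shows "int m dvd L.depth (s ^^ b) - L.depth (s ^^ c)"
proof -
  have *: "int m dvd int i - int j" if "\<zeta> ^ i = \<zeta> ^ j" "j \<le> i" for i j
  proof -
    have "\<zeta> ^ j * \<zeta> ^ (i - j) = \<zeta> ^ j * 1" using that by (simp flip: power_add)
    hence "m dvd i - j" using zeta_order zeta_nz by simp
    thus ?thesis using that(2) by (metis of_nat_diff of_nat_dvd_iff)
  qed
  define i where "i = nat (L.depth (s ^^ b))"
  define j where "j = nat (L.depth (s ^^ c))"
  have ij: "L.depth (s ^^ b) = int i" "L.depth (s ^^ c) = int j"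
    using W.depth_ge_1[OF assms(1)] W.depth_ge_1[OF assms(2)] by (auto simp: i_def j_def)
  have eq: "\<zeta> ^ i = \<zeta> ^ j" using zeta_power_depth assms by (simp add: i_def j_def)
  show ?thesis
  proof (cases "j \<le> i")
    case True
    thus ?thesis using *[OF eq] ij by simp
  next
    case False
    thus ?thesis using *[OF eq[symmetric]] ij dvd_diff_commute by fastforce
  qed
qed

text \<open>The norm of the uniformizer from \<open>L\<close> to \<open>L\<^sub>0\<close> has valuation \<open>p ^ n\<close>, so that an
  element of \<open>G\<close> fixing it acts on \<open>unif\<close> modulo \<open>unif\<^sup>2\<close> by some \<open>d\<close> with
  \<open>d ^ (p ^ n) = 1\<close>, that is, \<open>d = 1\<close>.\<close>

lemma galois_correspondence:
  assumes "\<tau> \<in> G" "\<forall>x \<in> fixed_field (range (\<lambda>b. s ^^ b)). \<tau> x = x"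
  shows "\<tau> \<in> range (\<lambda>b. s ^^ b)"
proof -
  obtain b c where bc: "\<tau> = s ^^ b \<circ> \<gamma> ^^ c" using G_eq[OF assms(1)] by blast
  define x where "x = L.orbit_prod s (p ^ n)"
  have x: "x \<noteq> 0" "nval x = int (p ^ n)"
    using L.orbit_prod_nz[OF s_aut] L.w_orbit_prod[OF s_aut] by (simp_all add: x_def)
  have "s ^^ (p ^ n) = id" by (simp add: s_order)
  hence "s x = x" using L.orbit_prod_displacement[OF s_aut, of "p ^ n"] by (simp add: x_def)
  hence sx: "(s ^^ b) x = x" for b by (induction b) auto
  hence "x \<in> fixed_field (range (\<lambda>b. s ^^ b))" by (auto simp: fixed_field_def)
  hence "(s ^^ b) ((\<gamma> ^^ c) x) = (s ^^ b) x" using assms(2) by (simp add: bc sx)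
  hence gx: "(\<gamma> ^^ c) x = x" using emb_eq_iff[OF L.aut_emb[OF L.aut_funpow[OF s_aut]]] by blast
  define \<rho> where "\<rho> = \<gamma> ^^ c"
  define d where "d = \<zeta> ^ c"
  have r: "\<rho> \<in> L.valued_auts" unfolding \<rho>_def using gamma_aut by (rule L.aut_funpow)
  have rd: "\<rho> unif - kk d * unif \<in> L.fil 2" unfolding \<rho>_def d_def using L.tame_funpow[OF gamma_aut zeta] .
  let ?q = "p ^ n"
  define u where "u = x / unif ^ ?q"
  have u: "u \<noteq> 0" "nval u = 0" "x = unif ^ ?q * u"
    using x L.pi_nz by (simp_all add: u_def L.w_divide L.w_power L.w_pi)
  have uf: "u \<in> L.fil 0" using u by (simp add: L.fil_def)
  have "\<rho> unif \<in> L.fil 1" "unif \<in> L.fil 1"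
    using L.fil_self[of unif] by (simp_all add: L.aut_fil[OF r] L.w_pi)
  hence "\<rho> unif - unif \<in> L.fil (int 0 + 1)" by (simp add: L.fil_diff)
  hence 1: "\<rho> u - u \<in> L.fil 1" using L.aut_displacement[OF r, of 0 u] uf by simp
  have 2: "\<rho> unif ^ ?q - (kk d * unif) ^ ?q \<in> L.fil (int ?q + 1)" using L.tame_pi_power[OF r rd] .
  have kd: "(kk d * unif) ^ ?q \<in> L.fil (int ?q)"
    using L.fil_power[OF L.fil_kk_mult[OF L.fil_self[of unif]], of d ?q] by (simp add: L.w_pi)
  have ru: "\<rho> u \<in> L.fil 0" using uf by (simp add: L.aut_fil[OF r])
  \<comment> \<open>Up to higher order, \<open>\<rho>\<close> multiplies the q-th power of
    \<open>unif\<close> by the q-th power of d and leaves the unit u alone. As it fixes x, that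
    power of d is 1.\<close>
  have "x - kk (d ^ ?q) * x = (\<rho> unif ^ ?q - (kk d * unif) ^ ?q) * \<rho> u + (kk d * unif) ^ ?q * (\<rho> u - u)"
  proof -
    have "x = \<rho> x" using gx by (simp add: \<rho>_def)
    also have "\<dots> = \<rho> unif ^ ?q * \<rho> u"
      by (simp add: u(3) emb_mult[OF L.aut_emb[OF r]] emb_power[OF L.aut_emb[OF r]])
    finally have xe: "x = \<rho> unif ^ ?q * \<rho> u" .
    have "kk (d ^ ?q) * x = (kk d * unif) ^ ?q * u"
      by (simp add: u(3) emb_power[OF emb_kk] power_mult_distrib mult_ac)
    thus ?thesis using xe by (simp add: algebra_simps)
  qed
  moreover have "(\<rho> unif ^ ?q - (kk d * unif) ^ ?q) * \<rho> u \<in> L.fil (int ?q + 1)"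
    using L.fil_mult[OF 2 ru] by simp
  moreover have "(kk d * unif) ^ ?q * (\<rho> u - u) \<in> L.fil (int ?q + 1)"
    using L.fil_mult[OF kd 1] by simp
  ultimately have "x - kk (d ^ ?q) * x \<in> L.fil (int ?q + 1)" using L.fil_add by metis
  hence "kk (1 - d ^ ?q) * x \<in> L.fil (nval x + 1)"
    by (simp add: emb_diff[OF emb_kk] emb_1[OF emb_kk] left_diff_distrib x(2))
  hence "1 - d ^ ?q = 0" using L.kk_mult_in_fil_iff[OF x(1)] by blast
  hence "d = 1" using k_root_of_unity by simp
  hence "\<gamma> ^^ c = id" using zeta_order by (simp add: gamma_order d_def)
  thus ?thesis by (simp add: bc)
qed

subsection \<open>The ramification groups of \<open>L/L\<^sub>0\<close>\<close>

abbreviation L\<^sub>0 :: "'l set" where "L\<^sub>0 \<equiv> fixed_field (range (\<lambda>b. s ^^ b))"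
abbreviation ram :: "int \<Rightarrow> ('l \<Rightarrow> 'l) set" where "ram \<equiv> lower_ram_group \<iota> L\<^sub>0"

lemma carrier_gal_L0: "carrier (gal_group L\<^sub>0) = range (\<lambda>b. s ^^ b)"
proof (intro equalityI subsetI)
  fix \<tau> assume t: "\<tau> \<in> carrier (gal_group L\<^sub>0)"
  have "range \<iota> \<subseteq> L\<^sub>0"
  proof
    fix x assume "x \<in> range \<iota>"
    hence "s x = x" using fixed_G[of x] s_G by blast
    hence "(s ^^ b) x = x" for b by (induction b) auto
    thus "x \<in> L\<^sub>0" by (auto simp: fixed_field_def)
  qed
  hence "\<tau> \<in> G" using t by (auto simp: G_carrier gal_group_def)
  moreover have "\<forall>x\<in>L\<^sub>0. \<tau> x = x" using t by (simp add: gal_group_def)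
  ultimately show "\<tau> \<in> range (\<lambda>b. s ^^ b)" by (rule galois_correspondence)
next
  fix \<tau> assume t: "\<tau> \<in> range (\<lambda>b. s ^^ b)"
  have "s ^^ b \<in> G" for b by (induction b) (simp_all only: funpow.simps id_G comp_G s_G)
  hence "\<tau> \<in> G" using t by auto
  thus "\<tau> \<in> carrier (gal_group L\<^sub>0)" using t by (auto simp: G_carrier gal_group_def fixed_field_def)
qed

lemma ram_eq:
  assumes "0 \<le> i"
  shows "ram i = {\<sigma> \<in> range (\<lambda>b. s ^^ b). \<sigma> unif - unif \<in> L.fil (i + 1)}"
proof -
  have "(\<forall>x\<in>A. \<sigma> x - x \<in> L.fil (i + 1)) \<longleftrightarrow> \<sigma> unif - unif \<in> L.fil (i + 1)" if "\<sigma> \<in> range (\<lambda>b. s ^^ b)" for \<sigma>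
  proof -
    have "\<sigma> \<in> L.valued_auts" using that L.aut_funpow[OF s_aut] by auto
    moreover have "unif \<in> A" using L.fil_mono[OF L.fil_self[of unif], of 0] by (simp add: A_eq_fil L.w_pi)
    moreover have "int (nat i) = i" using assms by simp
    ultimately show ?thesis using L.aut_displacement[of \<sigma> "nat i"] by (auto simp: A_eq_fil)
  qed
  moreover have "int (nat (i + 1)) = i + 1" using assms by simp
  ultimately show ?thesis
    unfolding lower_ram_group_def carrier_gal_L0 ideal_power_eq_fil by auto
qed

lemma in_ram_iff:
  assumes "0 \<le> i"
  shows "s ^^ b \<in> ram i \<longleftrightarrow> s ^^ b = id \<or> i \<le> L.depth (s ^^ b)"
  using L.depth_ge_iff[OF L.aut_funpow[OF s_aut], of b i] rangeI[of "\<lambda>b. s ^^ b" b]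
  by (cases "s ^^ b = id") (auto simp: ram_eq[OF assms])

lemma ramE:
  assumes "\<sigma> \<in> ram i" "0 \<le> i"
  obtains b where "\<sigma> = s ^^ b"
  using assms by (auto simp: ram_eq)

lemma ram_antimono: "0 \<le> i \<Longrightarrow> i \<le> j \<Longrightarrow> ram j \<subseteq> ram i"
  using L.fil_mono by (auto simp: ram_eq)

lemma s_power_ne_id: "q < n \<Longrightarrow> s ^^ (p ^ q) \<noteq> id"
  by (auto simp: s_order dest!: power_dvd_imp_le[OF _ prime_gt_1_nat[OF prime_p]])

lemma depth_of_power:
  assumes "s ^^ b \<noteq> id"
  obtains q where "q < n" "L.depth (s ^^ b) = W.jump q" "q = multiplicity p b"
proof -
  have b: "\<not> p ^ n dvd b" using assms by (simp add: s_order)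
  hence "b \<noteq> 0" by (intro notI) simp
  have np: "\<not> is_unit p" using prime_p not_prime_unit by blast
  obtain k where k: "b = p ^ multiplicity p b * k" "\<not> p dvd k"
    using multiplicity_decompose'[OF \<open>b \<noteq> 0\<close> np] by blast
  have "multiplicity p b < n"
    using b power_dvd_iff_le_multiplicity[OF \<open>b \<noteq> 0\<close> np] by (simp add: not_le)
  moreover have "L.depth (s ^^ b) = W.jump (multiplicity p b)"
    using W.depth_funpow[OF k(2) s_power_ne_id[OF calculation]] k(1) by simp
  ultimately show ?thesis using that by blast
qed

lemma jump_strict_mono: "q < r \<Longrightarrow> r < n \<Longrightarrow> W.jump q < W.jump r"
proof (induction r)
  case (Suc r)
  have "W.jump r < W.jump (Suc r)" using Suc.prems s_power_ne_id by (intro W.jump_less)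
  thus ?case using Suc by (cases "q = r") auto
qed simp

lemma jump_pos: "q < n \<Longrightarrow> 1 \<le> W.jump q"
  using W.depth_ge_1 s_power_ne_id by blast

text \<open>An inclusion suffices, since a congruence between all \<open>W.jump q\<close> passes to
  every subset.\<close>

lemma lower_jumps_subset: "lower_jumps \<iota> L\<^sub>0 \<subseteq> W.jump ` {..<n}"
proof
  fix i assume i: "i \<in> lower_jumps \<iota> L\<^sub>0"
  hence i: "0 < i" "ram i \<noteq> ram (i + 1)" by (auto simp: lower_jumps_def)
  moreover have "ram (i + 1) \<subseteq> ram i" using i by (intro ram_antimono) auto
  ultimately obtain \<sigma> where s: "\<sigma> \<in> ram i" "\<sigma> \<notin> ram (i + 1)" by blast
  obtain b where b: "\<sigma> = s ^^ b" using s(1) i(1) by (elim ramE) auto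
  have ne: "s ^^ b \<noteq> id" and d: "L.depth (s ^^ b) = i"
    using s i(1) in_ram_iff[of i b] in_ram_iff[of "i + 1" b] by (auto simp: b)
  obtain q where "q < n" "L.depth (s ^^ b) = W.jump q" using depth_of_power[OF ne] .
  thus "i \<in> W.jump ` {..<n}" using d by blast
qed

lemma s_power_inj:
  assumes "s ^^ x = s ^^ y" "x \<le> y"
  shows "p ^ n dvd y - x"
proof -
  have "s ^^ x \<circ> s ^^ (y - x) = s ^^ (x + (y - x))" by (rule funpow_add[symmetric])
  hence "s ^^ x \<circ> s ^^ (y - x) = s ^^ x \<circ> id" using assms by simp
  hence "s ^^ (y - x) = id"
    using emb_eq_iff[OF L.aut_emb[OF L.aut_funpow[OF s_aut]]] by (auto simp: fun_eq_iff)
  thus ?thesis by (simp add: s_order)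
qed

text \<open>Between two consecutive jumps the group is generated by \<open>s ^^ (p ^ q)\<close>. The
  guards cover the ends: for q = 0 it is all of P, for q = n it is trivial.\<close>

lemma card_ram:
  assumes "q \<le> n" "0 \<le> i" "q < n \<Longrightarrow> i \<le> W.jump q" "0 < q \<Longrightarrow> W.jump (q - 1) < i"
  shows "card (ram i) = p ^ (n - q)"
proof -
  have p0: "0 < p" using prime_p prime_gt_0_nat by blast
  have mem: "s ^^ b \<in> ram i \<longleftrightarrow> p ^ q dvd b" for b
  proof (cases "s ^^ b = id")
    case True
    have "p ^ q dvd p ^ n" using assms(1) by (rule le_imp_power_dvd)
    thus ?thesis using True in_ram_iff[OF assms(2), of b] s_order[of b] dvd_trans by blast
  next
    case False
    obtain r where r: "r < n" "L.depth (s ^^ b) = W.jump r" "r = multiplicity p b"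
      using depth_of_power[OF False] .
    have "\<not> p ^ n dvd b" using False by (simp add: s_order)
    hence "b \<noteq> 0" by (intro notI) simp
    moreover have "\<not> is_unit p" using prime_p not_prime_unit by blast
    ultimately have "p ^ q dvd b \<longleftrightarrow> q \<le> r" unfolding r(3) by (rule power_dvd_iff_le_multiplicity)
    moreover have "i \<le> W.jump r" if "q \<le> r"
    proof -
      have "W.jump q \<le> W.jump r" using jump_strict_mono[of q r] r(1) that by (cases "q = r") auto
      thus ?thesis using assms(3) that r(1) by linarith
    qed
    moreover have "W.jump r < i" if "r < q"
    proof -
      have "q - 1 < n" "r \<le> q - 1" using that assms(1) by linarith+
      hence "W.jump r \<le> W.jump (q - 1)"
        using jump_strict_mono[of r "q - 1"] by (cases "r = q - 1") auto
      thus ?thesis using assms(4) that by linarith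
    qed
    ultimately show ?thesis using False in_ram_iff[OF assms(2), of b] r(2) by (metis not_le)
  qed
  have "ram i = (\<lambda>k. s ^^ (p ^ q * k)) ` {..<p ^ (n - q)}"
  proof (intro equalityI subsetI)
    fix \<sigma> assume s: "\<sigma> \<in> ram i"
    then obtain b where b: "\<sigma> = s ^^ b" using assms(2) by (elim ramE)
    then obtain k where k: "b = p ^ q * k" using s mem by (auto elim: dvdE)
    have "p ^ q * k = p ^ n * (k div p ^ (n - q)) + p ^ q * (k mod p ^ (n - q))"
    proof -
      have "p ^ n = p ^ q * p ^ (n - q)" using assms(1) by (simp flip: power_add)
      hence "p ^ n * (k div p ^ (n - q)) + p ^ q * (k mod p ^ (n - q))
        = p ^ q * (p ^ (n - q) * (k div p ^ (n - q)) + k mod p ^ (n - q))"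
        by (simp only: distrib_left mult.assoc)
      thus ?thesis by simp
    qed
    moreover have "s ^^ (p ^ n * (k div p ^ (n - q))) = id" by (simp add: s_order)
    ultimately have "\<sigma> = s ^^ (p ^ q * (k mod p ^ (n - q)))" by (simp add: b k funpow_add)
    thus "\<sigma> \<in> (\<lambda>k. s ^^ (p ^ q * k)) ` {..<p ^ (n - q)}" using p0 by auto
  next
    fix \<sigma> assume "\<sigma> \<in> (\<lambda>k. s ^^ (p ^ q * k)) ` {..<p ^ (n - q)}"
    then obtain k where "\<sigma> = s ^^ (p ^ q * k)" by blast
    thus "\<sigma> \<in> ram i" by (simp only: mem dvd_triv_left)
  qed
  moreover have "inj_on (\<lambda>k. s ^^ (p ^ q * k)) {..<p ^ (n - q)}"
  proof (rule linorder_inj_onI)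
    fix x y assume xy: "x < y" "x \<in> {..<p ^ (n - q)}" "y \<in> {..<p ^ (n - q)}"
    show "s ^^ (p ^ q * x) \<noteq> s ^^ (p ^ q * y)"
    proof
      assume "s ^^ (p ^ q * x) = s ^^ (p ^ q * y)"
      hence "p ^ n dvd p ^ q * y - p ^ q * x" using xy by (intro s_power_inj) auto
      hence "p ^ n dvd p ^ q * (y - x)" by (simp add: diff_mult_distrib2)
      moreover have "p ^ n = p ^ q * p ^ (n - q)" using assms(1) by (simp flip: power_add)
      ultimately have "p ^ (n - q) dvd y - x" using p0 by simp
      thus False using xy by (auto dest!: dvd_imp_le)
    qed
  qed auto
  ultimately show ?thesis by (simp add: card_image)
qed

lemma finite_ram: "0 \<le> i \<Longrightarrow> finite (ram i)"
proof -
  assume i: "0 \<le> i"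
  have "ram 0 \<noteq> {}" using in_ram_iff[of 0 0] by auto
  moreover have "card (ram 0) = p ^ (n - 0)"
    using jump_pos[OF n_pos] by (intro card_ram) auto
  hence "finite (ram 0)" using prime_p by (metis card.infinite power_eq_0_iff not_prime_0)
  ultimately show ?thesis using ram_antimono[of 0 i] i finite_subset by blast
qed

lemma card_ram_0: "card (ram 0) = p ^ n"
  using card_ram[of 0 0] jump_pos[OF n_pos] by simp

lemma card_ram_pos: "0 \<le> i \<Longrightarrow> 0 < card (ram i)"
  using in_ram_iff[of i 0] finite_ram[of i] by (auto simp: card_gt_0_iff)

subsection \<open>The Herbrand function\<close>

definition slope :: "real \<Rightarrow> real" where
  "slope x = real (card (ram \<lceil>x\<rceil>)) / real (card (ram 0))"

abbreviation \<phi> :: "real \<Rightarrow> real" where "\<phi> \<equiv> herbrand \<iota> L\<^sub>0"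

lemma phi_eq: "\<phi> u = (if u < 0 then u else integral {0..u} slope)"
  by (simp add: herbrand_def slope_def [abs_def])

lemma slope_integrable:
  assumes "0 \<le> x"
  shows "slope integrable_on {x..y}"
proof -
  have "slope z \<le> slope w" if "0 \<le> w" "w \<le> z" for w z
  proof -
    have "card (ram \<lceil>z\<rceil>) \<le> card (ram \<lceil>w\<rceil>)"
      using that ceiling_mono[of w z] by (intro card_mono finite_ram ram_antimono) auto
    thus ?thesis unfolding slope_def by (intro divide_right_mono) auto
  qed
  hence "mono_on {x..y} (\<lambda>z. - slope z)" using assms by (auto simp: mono_on_def)
  from integrable_on_mono_on[OF this] show ?thesis by (simp add: integrable_neg_iff)
qed

lemma phi_diff:
  assumes "0 \<le> x" "x \<le> y"
  shows "\<phi> y - \<phi> x = integral {x..y} slope"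
  using Henstock_Kurzweil_Integration.integral_combine[of 0 x y slope] slope_integrable[of 0 y] assms
  by (simp add: phi_eq)

lemma slope_lower_bound: "0 \<le> x \<Longrightarrow> 1 / real (p ^ n) \<le> slope x"
  using card_ram_pos[of "\<lceil>x\<rceil>"] unfolding slope_def card_ram_0 by (intro divide_right_mono) auto

text \<open>This lower bound yields both the strict monotonicity of \<open>\<phi>\<close> and its
  unboundedness, so that \<open>inv_into\<close> in the upper numbering is a true inverse.\<close>

lemma phi_growth:
  assumes "0 \<le> x" "x \<le> y"
  shows "(y - x) / real (p ^ n) \<le> \<phi> y - \<phi> x"
proof -
  have "integral {x..y} (\<lambda>_. 1 / real (p ^ n)) \<le> integral {x..y} slope"
    using assms slope_lower_bound by (intro integral_le slope_integrable) auto
  thus ?thesis using assms by (simp add: phi_diff)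
qed

lemma phi_strict_mono: "strict_mono \<phi>"
proof (rule strict_monoI)
  fix x y :: real assume xy: "x < y"
  have p: "0 < real (p ^ n)" using prime_p prime_gt_0_nat by simp
  have phi0: "\<phi> 0 = 0" by (simp add: phi_eq)
  have pos: "\<phi> u < \<phi> v" if "0 \<le> u" "u < v" for u v
  proof -
    have "0 < (v - u) / real (p ^ n)" using p that by simp
    thus ?thesis using phi_growth[of u v] that by linarith
  qed
  consider "y < 0" | "x < 0" "0 \<le> y" | "0 \<le> x" by linarith
  thus "\<phi> x < \<phi> y"
  proof cases
    case 2
    have "\<phi> x < 0" using 2 by (simp add: phi_eq)
    also have "0 \<le> \<phi> y" using pos[of 0 y] phi0 2 by (cases "y = 0") auto
    finally show ?thesis .
  qed (use xy pos in \<open>auto simp: phi_eq\<close>)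
qed

lemma phi_surj: "surj \<phi>"
proof -
  have "\<exists>u. \<phi> u = v" for v
  proof (cases "v < 0")
    case True
    thus ?thesis by (intro exI[of _ v]) (simp add: phi_eq)
  next
    case False
    \<comment> \<open>By the growth bound \<open>\<phi> y\<close> is at least v, so the intermediate
      value theorem applies on \<open>{0..y}\<close>.\<close>
    define y where "y = v * real (p ^ n)"
    have p: "0 < real (p ^ n)" using prime_p prime_gt_0_nat by simp
    have y: "0 \<le> y" using False p by (simp add: y_def)
    have "y / real (p ^ n) = v" using p by (simp add: y_def del: of_nat_power)
    moreover have phi0: "\<phi> 0 = 0" by (simp add: phi_eq)
    ultimately have vy: "v \<le> \<phi> y" using phi_growth[of 0 y] y by (simp del: of_nat_power)
    have "continuous_on {0..y} (\<lambda>u. integral {0..u} slope)"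
      by (intro indefinite_integral_continuous_1 slope_integrable) simp
    hence "continuous_on {0..y} \<phi>" by (rule continuous_on_eq) (simp add: phi_eq)
    hence "\<exists>u. 0 \<le> u \<and> u \<le> y \<and> \<phi> u = v"
      using phi0 vy False y by (intro IVT') simp_all
    thus ?thesis by blast
  qed
  thus ?thesis by (metis surj_def)
qed

lemma phi_inv: "inv_into UNIV \<phi> (\<phi> u) = u" "\<phi> (inv_into UNIV \<phi> v) = v"
  using strict_mono_imp_inj_on[OF phi_strict_mono] phi_surj by (simp_all add: surj_f_inv_f)

text \<open>As a function of real u, \<open>ram \<lceil>u\<rceil>\<close> is constant up to and
  including the next integer, so it can change immediately to the right of u only if u is an
  integer, and then u is a lower jump.\<close>

lemma upper_jumps_subset: "upper_jumps \<iota> L\<^sub>0 \<subseteq> (\<lambda>i. \<phi> (real_of_int i)) ` lower_jumps \<iota> L\<^sub>0"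
proof
  fix v assume "v \<in> upper_jumps \<iota> L\<^sub>0"
  hence v: "0 < v" "\<And>\<epsilon>. 0 < \<epsilon> \<Longrightarrow> upper_ram_group \<iota> L\<^sub>0 v \<noteq> upper_ram_group \<iota> L\<^sub>0 (v + \<epsilon>)"
    by (auto simp: upper_jumps_def)
  define u where "u = inv_into UNIV \<phi> v"
  have vu: "v = \<phi> u" by (simp add: u_def phi_inv)
  have u: "0 < u"
  proof (rule ccontr)
    assume "\<not> 0 < u"
    hence "\<phi> u \<le> 0" by (cases "u = 0") (auto simp: phi_eq)
    thus False using v(1) vu by simp
  qed
  have ne: "ram \<lceil>u\<rceil> \<noteq> ram \<lceil>u'\<rceil>" if "u < u'" for u'
  proof -
    have "\<phi> u < \<phi> u'" using phi_strict_mono that by (simp add: strict_mono_def)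
    hence "upper_ram_group \<iota> L\<^sub>0 (\<phi> u) \<noteq> upper_ram_group \<iota> L\<^sub>0 (\<phi> u')"
      using v(2)[of "\<phi> u' - \<phi> u"] by (simp add: vu)
    thus ?thesis by (simp add: upper_ram_group_def phi_inv)
  qed
  have int: "u = real_of_int \<lceil>u\<rceil>"
    using ne[of "real_of_int \<lceil>u\<rceil>"] le_of_int_ceiling[of u] by (cases "u = real_of_int \<lceil>u\<rceil>") auto
  have "\<lceil>u\<rceil> \<in> lower_jumps \<iota> L\<^sub>0"
    using ne[of "real_of_int (\<lceil>u\<rceil> + 1)"] u int unfolding lower_jumps_def
    by (simp only: ceiling_of_int) (use le_of_int_ceiling[of u] in auto)
  thus "v \<in> (\<lambda>i. \<phi> (real_of_int i)) ` lower_jumps \<iota> L\<^sub>0" using int vu by (metis imageI)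
qed

text \<open>Up to the jump of index q and after the previous one the slope is p^(n - q) / p^n. The
  free starting point x serves both for 0 and for the previous jump.\<close>

lemma phi_segment:
  assumes "q < n" "0 \<le> x" "x \<le> W.jump q" "0 < q \<Longrightarrow> W.jump (q - 1) \<le> x"
  shows "\<phi> (real_of_int (W.jump q)) - \<phi> (real_of_int x) = real_of_int (W.jump q - x) / real (p ^ q)"
proof -
  let ?c = "1 / real (p ^ q)"
  have p0: "0 < p" using prime_p prime_gt_0_nat by blast
  \<comment> \<open>At the left end x the group may still be the larger one; a single point does not
    affect the integral.\<close>
  have "slope z = ?c" if "z \<in> {real_of_int x..real_of_int (W.jump q)} - {real_of_int x}" for z
  proof -
    have z: "real_of_int x < z" "z \<le> real_of_int (W.jump q)" using that by auto
    have "x < \<lceil>z\<rceil>" "\<lceil>z\<rceil> \<le> W.jump q" using z by (simp_all add: less_ceiling_iff ceiling_le_iff)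
    moreover have "0 \<le> \<lceil>z\<rceil>" using calculation(1) assms(2) by linarith
    moreover have "W.jump (q - 1) < \<lceil>z\<rceil>" if "0 < q" using calculation(1) assms(4)[OF that] by linarith
    ultimately have "card (ram \<lceil>z\<rceil>) = p ^ (n - q)" using assms(1) card_ram[of q "\<lceil>z\<rceil>"] by linarith
    moreover have "real (p ^ n) = real (p ^ (n - q)) * real (p ^ q)"
      using assms(1) by (simp flip: power_add of_nat_mult)
    ultimately show ?thesis using p0 by (simp add: slope_def card_ram_0)
  qed
  moreover have "((\<lambda>_. ?c) has_integral ?c * (real_of_int (W.jump q) - real_of_int x))
      {real_of_int x..real_of_int (W.jump q)}"
    using has_integral_const_real[of ?c "real_of_int x" "real_of_int (W.jump q)"] assms(3)
    by (simp add: mult.commute)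
  ultimately have "(slope has_integral ?c * (real_of_int (W.jump q) - real_of_int x))
      {real_of_int x..real_of_int (W.jump q)}"
    by (intro has_integral_spike_finite[of "{real_of_int x}" _ slope "\<lambda>_. ?c"]) auto
  thus ?thesis using assms by (simp add: phi_diff integral_unique)
qed

lemma phi_jump:
  assumes "q < n"
  shows "\<exists>k. \<phi> (real_of_int (W.jump q)) = real_of_int (W.jump 0 + int m * k)"
  using assms
proof (induction q)
  case 0
  \<comment> \<open>Up to the first jump the group is all of P and the slope is 1.\<close>
  have "\<phi> (real_of_int (W.jump 0)) = real_of_int (W.jump 0)"
    using phi_segment[of 0 0] jump_pos[OF n_pos] n_pos by (simp add: phi_eq)
  thus ?case by (intro exI[of _ 0]) simp
next
  case (Suc q)
  then obtain k where k: "\<phi> (real_of_int (W.jump q)) = real_of_int (W.jump 0 + int m * k)" by auto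
  have ne: "s ^^ (p ^ Suc q) \<noteq> id" "s ^^ (p ^ q) \<noteq> id" by (rule s_power_ne_id, use Suc.prems in simp)+
  have "int m dvd W.jump (Suc q) - W.jump q" by (rule depth_cong[OF ne])
  moreover have "int p ^ Suc q dvd W.jump (Suc q) - W.jump q" by (rule W.sen[OF ne(1)])
  moreover have "coprime (int m) (int p ^ Suc q)"
    using m prime_p by (metis coprime_commute coprime_int_iff coprime_power_right_iff prime_imp_coprime)
  ultimately have "int m * int p ^ Suc q dvd W.jump (Suc q) - W.jump q" by (intro divides_mult)
  then obtain j where j: "W.jump (Suc q) - W.jump q = int m * int p ^ Suc q * j" by (elim dvdE)
  have "\<phi> (real_of_int (W.jump (Suc q))) - \<phi> (real_of_int (W.jump q))
      = real_of_int (W.jump (Suc q) - W.jump q) / real (p ^ Suc q)"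
    using Suc.prems jump_strict_mono[of q "Suc q"] jump_pos[of q] by (intro phi_segment) auto
  also have "\<dots> = real_of_int (int m * j)"
    using prime_p prime_gt_0_nat[of p] unfolding j by simp
  finally have "\<phi> (real_of_int (W.jump (Suc q))) = real_of_int (W.jump 0 + int m * (k + j))"
    using k by (simp add: algebra_simps)
  thus ?case by blast
qed

theorem lower_jumps_cong:
  assumes "i \<in> lower_jumps \<iota> L\<^sub>0" "j \<in> lower_jumps \<iota> L\<^sub>0"
  shows "[i = j] (mod int m)"
proof -
  obtain q r where "q < n" "i = W.jump q" "r < n" "j = W.jump r" using assms lower_jumps_subset by blast
  thus ?thesis using depth_cong s_power_ne_id by (simp add: cong_iff_dvd_diff)
qed

theorem upper_jumps_cong:
  assumes "u \<in> upper_jumps \<iota> L\<^sub>0" "v \<in> upper_jumps \<iota> L\<^sub>0"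
  shows "\<exists>a b :: int. u = real_of_int a \<and> v = real_of_int b \<and> [a = b] (mod int m)"
proof -
  have *: "\<exists>k. x = real_of_int (W.jump 0 + int m * k)" if "x \<in> upper_jumps \<iota> L\<^sub>0" for x
  proof -
    obtain q where "q < n" "x = \<phi> (real_of_int (W.jump q))"
    proof -
      obtain i where i: "i \<in> lower_jumps \<iota> L\<^sub>0" "x = \<phi> (real_of_int i)"
        using \<open>x \<in> upper_jumps \<iota> L\<^sub>0\<close> upper_jumps_subset by blast
      obtain q where "q < n" "i = W.jump q" using i(1) lower_jumps_subset by blast
      with i(2) that show ?thesis by blast
    qed
    thus ?thesis using phi_jump by simp
  qed
  obtain k l where "u = real_of_int (W.jump 0 + int m * k)" "v = real_of_int (W.jump 0 + int m * l)"
    using *[OF assms(1)] *[OF assms(2)] by blast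
  moreover have "[W.jump 0 + int m * k = W.jump 0 + int m * l] (mod int m)"
    by (simp add: cong_iff_dvd_diff flip: right_diff_distrib)
  ultimately show ?thesis by blast
qed

end

section \<open>Cyclic groups of functions\<close>

lemma cyclic_generator:
  fixes \<G> :: "('x \<Rightarrow> 'x) monoid"
  assumes mult: "monoid.mult \<G> = (\<circ>)" and one: "one \<G> = id"
    and H: "subgroup H \<G>" and iso: "\<G>\<lparr>carrier := H\<rparr> \<cong> integer_mod_group N" and N: "0 < N"
  obtains s where "s \<in> H" "H = (\<lambda>b. s ^^ b) ` {..<N}" "\<And>b. s ^^ b \<in> H" "\<And>b. s ^^ b = id \<longleftrightarrow> N dvd b"
proof -
  obtain f where f: "f \<in> Group.iso (\<G>\<lparr>carrier := H\<rparr>) (integer_mod_group N)"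
    using iso by (auto simp: is_iso_def)
  have bij: "bij_betw f H {0..<int N}" using f N by (auto simp: Group.iso_def carrier_integer_mod_group)
  have hom: "f (x \<circ> y) = (f x + f y) mod int N" if "x \<in> H" "y \<in> H" for x y
    using f that by (auto simp: Group.iso_def hom_def mult)
  have idH: "id \<in> H" using subgroup.one_closed[OF H] by (simp add: one)
  have comp: "x \<circ> y \<in> H" if "x \<in> H" "y \<in> H" for x y
    using subgroup.m_closed[OF H that] by (simp add: mult)
  have range: "0 \<le> f x \<and> f x < int N" if "x \<in> H" for x using bij that by (auto simp: bij_betw_def)
  have "f id = (f id + f id) mod int N" using hom[OF idH idH] by simp
  hence "int N dvd (f id + f id) - f id" by (metis mod_eq_dvd_iff mod_mod_trivial)
  hence f_id: "f id = 0" using range[OF idH] zdvd_not_zless by force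
  \<comment> \<open>For N = 1 the class of 1 is 0, which is why the generator is sought at
    \<open>1 mod int N\<close>.\<close>
  have "1 mod int N \<in> {0..<int N}" using N by simp
  then obtain s where s: "s \<in> H" "f s = 1 mod int N" using bij by (metis bij_betw_iff_bijections)
  have sH: "s ^^ b \<in> H" for b by (induction b) (simp_all only: funpow.simps idH comp s(1))
  have fs: "f (s ^^ b) = int b mod int N" for b
  proof (induction b)
    case (Suc b)
    have "f (s ^^ Suc b) = (1 mod int N + int b mod int N) mod int N"
      using hom[OF s(1) sH[of b]] by (simp only: funpow.simps s(2) Suc)
    also have "\<dots> = int (Suc b) mod int N" by (simp add: mod_add_eq)
    finally show ?case .
  qed (use f_id in \<open>simp add: id_def\<close>)
  have inj: "x = y" if "x \<in> H" "y \<in> H" "f x = f y" for x y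
    using bij that by (auto simp: bij_betw_def inj_on_def)
  have "H = (\<lambda>b. s ^^ b) ` {..<N}"
  proof (intro equalityI subsetI)
    fix x assume x: "x \<in> H"
    have "f x = f (s ^^ nat (f x))" using range[OF x] by (simp add: fs)
    hence "x = s ^^ nat (f x)" using inj x sH by blast
    moreover have "nat (f x) < N" using range[OF x] N by linarith
    ultimately show "x \<in> (\<lambda>b. s ^^ b) ` {..<N}" by blast
  qed (use sH in auto)
  moreover have "s ^^ b = id \<longleftrightarrow> N dvd b" for b
  proof -
    have "s ^^ b = id \<longleftrightarrow> f (s ^^ b) = f id" using inj[OF sH idH, of b] by metis
    also have "\<dots> \<longleftrightarrow> int b mod int N = 0" by (simp only: fs f_id)
    also have "\<dots> \<longleftrightarrow> N dvd b" by (simp add: mod_eq_0_iff_dvd)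
    finally show ?thesis .
  qed
  ultimately show ?thesis using that s(1) sH by blast
qed

theorem proposition4p2:
  fixes \<iota> :: "'k::alg_closed_field fls \<Rightarrow> 'l::field"
    and p n m :: nat
    and G :: "('l \<Rightarrow> 'l) monoid"
    and P C :: "('l \<Rightarrow> 'l) set"
    and L\<^sub>0 :: "'l set"
  assumes "prime p" and "CHAR('k) = p"
    and "n \<ge> 1" and "m \<ge> 1" and "\<not> p dvd m"
    and "finite_galois \<iota>"
    and "G = gal_group (range \<iota>)"
    and "inner_semidirect_product G P C"
    and "G\<lparr>carrier := P\<rparr> \<cong> integer_mod_group (p ^ n)"
    and "G\<lparr>carrier := C\<rparr> \<cong> integer_mod_group m"
    and "L\<^sub>0 = fixed_field P"
  shows "(\<forall>i \<in> lower_jumps \<iota> L\<^sub>0. \<forall>j \<in> lower_jumps \<iota> L\<^sub>0. [i = j] (mod int m)) \<and>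
    (\<forall>u \<in> upper_jumps \<iota> L\<^sub>0. \<forall>v \<in> upper_jumps \<iota> L\<^sub>0.
       \<exists>a b :: int. u = real_of_int a \<and> v = real_of_int b \<and> [a = b] (mod int m))"
proof -
  have mult: "monoid.mult G = (\<circ>)" and one: "one G = id" by (simp_all add: assms(7) gal_group_def)
  have normal: "P \<lhd> G" and subC: "subgroup C G" and PC: "P <#>\<^bsub>G\<^esub> C = carrier G"
    using assms(8) by (auto simp: inner_semidirect_product_def)
  have subP: "subgroup P G" using normal by (rule normal_imp_subgroup)
  have grp: "group G" using normal by (rule normal.axioms(2))
  have p0: "0 < p ^ n" using assms(1) prime_gt_0_nat by simp
  obtain s where s: "s \<in> P" "P = (\<lambda>b. s ^^ b) ` {..<p ^ n}" "\<And>b. s ^^ b \<in> P" "\<And>b. s ^^ b = id \<longleftrightarrow> p ^ n dvd b"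
    using cyclic_generator[OF mult one subP assms(9) p0] by blast
  have m0: "0 < m" using assms(4) by simp
  obtain \<gamma> where g: "\<gamma> \<in> C" "C = (\<lambda>b. \<gamma> ^^ b) ` {..<m}" "\<And>b. \<gamma> ^^ b \<in> C" "\<And>b. \<gamma> ^^ b = id \<longleftrightarrow> m dvd b"
    using cyclic_generator[OF mult one subC assms(10) m0] by blast
  have PG: "P \<subseteq> carrier G" and CG: "C \<subseteq> carrier G" using subP subC subgroup.subset by auto
  have Prange: "P = range (\<lambda>b. s ^^ b)" using s(2,3) by auto
  have carrier: "\<exists>x\<in>P. \<exists>y\<in>C. \<sigma> = x \<circ> y" if "\<sigma> \<in> carrier G" for \<sigma>
    using that unfolding PC[symmetric] set_mult_def by (auto simp: mult)
  \<comment> \<open>Finiteness is read off from the factorization of the group into two finite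
    cyclic ones.\<close>
  have fin: "finite (carrier G)"
  proof (rule finite_subset)
    show "carrier G \<subseteq> (\<lambda>(x, y). x \<circ> y) ` (P \<times> C)" using carrier by force
    show "finite ((\<lambda>(x, y). x \<circ> y) ` (P \<times> C))" by (subst s(2), subst g(2)) auto
  qed
  define \<gamma>' where "\<gamma>' = inv\<^bsub>G\<^esub> \<gamma>"
  have gG: "\<gamma> \<in> carrier G" using g(1) CG by blast
  have g': "\<gamma>' \<in> carrier G" "\<gamma> \<circ> \<gamma>' = id" "\<gamma>' \<circ> \<gamma> = id"
    using group.inv_closed[OF grp gG] group.r_inv[OF grp gG] group.l_inv[OF grp gG]
    by (simp_all add: \<gamma>'_def mult one)
  have "\<gamma> \<circ> s \<circ> \<gamma>' \<in> P"
    using normal.inv_op_closed2[OF normal gG s(1)] by (simp add: \<gamma>'_def mult)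
  then obtain a where a: "\<gamma> \<circ> s \<circ> \<gamma>' = s ^^ a" using Prange by auto
  have fixed: "(\<forall>\<sigma>\<in>carrier G. \<sigma> x = x) \<longleftrightarrow> x \<in> range \<iota>" for x
    using assms(6) by (auto simp: finite_galois_def fixed_field_def assms(7))
  interpret wild_tame_galois \<iota> "carrier G" p s \<gamma> \<gamma>' n m a
  proof unfold_locales
    show "field_embedding \<iota>" using assms(6) by (simp add: finite_galois_def finite_extension_def)
    show "id \<in> carrier G" using monoid.one_closed[OF group.is_monoid[OF grp]] by (simp add: one)
    show "\<sigma> \<circ> \<tau> \<in> carrier G" if "\<sigma> \<in> carrier G" "\<tau> \<in> carrier G" for \<sigma> \<tau>
      using monoid.m_closed[OF group.is_monoid[OF grp] that] by (simp add: mult)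
    show "field_embedding \<sigma>" if "\<sigma> \<in> carrier G" for \<sigma> using that by (simp add: assms(7) gal_group_def)
    show "\<exists>b c. \<sigma> = s ^^ b \<circ> \<gamma> ^^ c" if "\<sigma> \<in> carrier G" for \<sigma>
      using carrier[OF that] s(2) g(2) by blast
  qed (use assms fin fixed s g gG g' a PG in auto)
  have "L\<^sub>0 = fixed_field (range (\<lambda>b. s ^^ b))" by (simp add: assms(11) Prange)
  thus ?thesis using lower_jumps_cong upper_jumps_cong by simp
qed

end
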